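(* There is a randomized implementation of a (linearizable) TAS object for $n$ processes from $\Theta(n)$ registers whose expected max-step complexity against any location-oblivious adversary is $O(\log^\ast k)$, where $k$ is the max-contention of the $\mathrm{TAS}()$ operation.
   Context: Model. There are $n$ processes with IDs $1,\dots,n$ in an asynchronous shared-memory system communicating via atomic multi-reader multi-writer read/write registers. Algorithms are randomized: a coin flip is a private local step returning a value drawn from a fixed distribution on a countable set; w.l.o.g. each process alternates coin-flip steps and shared-memory steps. An adversary is a function mapping each finite execution to the ID of the process taking the next step; algorithm $M$, adversary $A$ and a random coin-flip vector yield a random execution $\mathcal E_{M,A}$. A location-oblivious adversary chooses the next process based only on (i) the past schedule, (ii) the outcomes of each process $p$'s coin flips that precede $p$'s latest shared-memory step, and (iii) for each unfinished process whose next step is a shared-memory step, whether it is a read or a write and the value to be written; it does not know which register a process will access next if that register is chosen by a coin flip taken after the process's latest shared-memory step. A TAS object stores a bit, initially $0$, and supports a one-time operation $\mathrm{TAS}()$ (each process calls it at most once) that sets the bit and returns its previous value; the implementation must be linearizable. Complexity. For an execution $\mathcal E$ of an algorithm $M$ using the object, let $T_p(\mathcal E)$ be the number of shared-memory steps $p$ takes in its $\mathrm{TAS}()$ call; let $\mathcal E'$ be the prefix ending when the first process becomes poised to invoke $\mathrm{TAS}()$; the max-contention $k$ is the maximum number of processes invoking $\mathrm{TAS}()$ in any execution of $M$ extending $\mathcal E'$. The expected max-step complexity against an adversary model is $\tau(k)=\sup\mathbb E[\max_p T_p(\mathcal E_{M,A})\mid \mathcal E_{M,A}\text{ extends }\mathcal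 E']$, over all algorithms $M$, adversaries $A$ in the model, and prefixes $\mathcal E'$ arising under $A$ with max-contention at most $k$. $\log^\ast k=\inf\{i: \log_2^{(i)}k\le 1\}$. *)

theory Defs
  imports "HOL-Probability.Probability" "HOL-Library.Landau_Symbols"
begin

text \<open>Shared-memory operations on multi-reader multi-writer registers (indexed by nat,
  holding nat values).  The adversary may see the kind of a pending operation and the
  value to be written, but not the register.\<close>

datatype op = Rd nat | Wr nat nat

datatype opkind = KRd | KWr nat

fun kind :: "op \<Rightarrow> opkind" where
  "kind (Rd r) = KRd"
| "kind (Wr r v) = KWr v"

fun reg :: "op \<Rightarrow> nat" where
  "reg (Rd r) = r"
| "reg (Wr r v) = r"

text \<open>A randomized implementation of the TAS() operation.  Local state of type 's.
  In local state s the process flips a coin c drawn from coin s (a distribution on a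
  countable set, here nat), then performs the shared-memory operation act s c, and moves to
  local state upd s c resp (resp is the value read, 0 for a write).  Whenever ret s = Some b
  the operation returns b (False = 0, True = 1).  Registers used: 0 ..< nregs, with
  initial contents mem0.\<close>

record 's tas_impl =
  nregs :: nat
  mem0  :: "nat \<Rightarrow> nat"
  init  :: "nat \<Rightarrow> 's"
  coin  :: "'s \<Rightarrow> nat pmf"
  act   :: "'s \<Rightarrow> nat \<Rightarrow> op"
  upd   :: "'s \<Rightarrow> nat \<Rightarrow> nat \<Rightarrow> 's"
  ret   :: "'s \<Rightarrow> bool option"

definition wf_impl :: "'s tas_impl \<Rightarrow> bool" where
  "wf_impl I \<longleftrightarrow> (\<forall>s c. reg (act I s c) < nregs I)"

datatype 's pstat = Idle | Active 's | Done bool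

text \<open>Events: invocation of TAS() by process p, or a shared-memory step of p that used
  coin value c (the coin flipped just before that step).\<close>
datatype event = Inv nat | Stp nat nat

definition enter :: "'s tas_impl \<Rightarrow> 's \<Rightarrow> 's pstat" where
  "enter I s = (case ret I s of Some b \<Rightarrow> Done b | None \<Rightarrow> Active s)"

type_synonym 's cfg = "(nat \<Rightarrow> nat) \<times> (nat \<Rightarrow> 's pstat)"

fun apply_ev :: "'s tas_impl \<Rightarrow> 's cfg \<Rightarrow> event \<Rightarrow> 's cfg" where
  "apply_ev I (m, st) (Inv p) =
     (case st p of Idle \<Rightarrow> (m, st(p := enter I (init I p))) | _ \<Rightarrow> (m, st))"
| "apply_ev I (m, st) (Stp p c) =
     (case st p of
        Active s \<Rightarrow>
          (case act I s c of
             Rd r \<Rightarrow> (m, st(p := enter I (upd I s c (m r))))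
           | Wr r v \<Rightarrow> (m(r := v), st(p := enter I (upd I s c 0))))
      | _ \<Rightarrow> (m, st))"

definition run :: "'s tas_impl \<Rightarrow> event list \<Rightarrow> 's cfg" where
  "run I h = fold (\<lambda>e cf. apply_ev I cf e) h (mem0 I, \<lambda>_. Idle)"

fun enabled :: "'s tas_impl \<Rightarrow> nat \<Rightarrow> 's cfg \<Rightarrow> event \<Rightarrow> bool" where
  "enabled I n (m, st) (Inv p) = (p \<in> {1..n} \<and> st p = Idle)"
| "enabled I n (m, st) (Stp p c) = (\<exists>s. st p = Active s \<and> c \<in> set_pmf (coin I s))"

definition feasible :: "'s tas_impl \<Rightarrow> nat \<Rightarrow> event list \<Rightarrow> bool" where
  "feasible I n h \<longleftrightarrow> (\<forall>i<length h. enabled I n (run I (take i h)) (h ! i))"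

definition is_done :: "'s pstat \<Rightarrow> bool" where
  "is_done x \<longleftrightarrow> (\<exists>b. x = Done b)"

definition precedes :: "'s tas_impl \<Rightarrow> event list \<Rightarrow> nat \<Rightarrow> nat \<Rightarrow> bool" where
  "precedes I h a b \<longleftrightarrow>
     (\<exists>j<length h. h ! j = Inv b \<and> is_done (snd (run I (take j h)) a))"

text \<open>Linearizability w.r.t. the sequential specification of a one-shot TAS bit
  (initially 0): there is a sequence L of invoked operations containing every completed one,
  respecting real-time order, such that each completed operation returns the previous bit,
  i.e. 0 (False) iff it is first in L.\<close>
definition linearizable :: "'s tas_impl \<Rightarrow> event list \<Rightarrow> bool" where
  "linearizable I h \<longleftrightarrow>
     (\<exists>L. distinct L \<and> (\<forall>p\<in>set L. Inv p \<in> set h) \<and>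
        (\<forall>p b. snd (run I h) p = Done b \<longrightarrow> p \<in> set L \<and> b = (hd L \<noteq> p)) \<and>
        (\<forall>i<length L. \<forall>j<length L. precedes I h (L ! i) (L ! j) \<longrightarrow> i < j))"

definition correct_tas :: "'s tas_impl \<Rightarrow> nat \<Rightarrow> bool" where
  "correct_tas I n \<longleftrightarrow> (\<forall>h. feasible I n h \<longrightarrow> linearizable I h)"

text \<open>View of a location-oblivious adversary: the past schedule together with the coin
  values used by all shared-memory steps taken so far (i.e. the whole history), and for
  every active process the kind (read / write of value v) of its pending operation, whose
  coin has already been flipped but is not revealed.  The adversary returns the ID of the
  next process to be scheduled: an idle process thereby invokes TAS() (if allowed by the
  contention bound), an active process takes its next step; anything else is a step of the
  surrounding algorithm that does not touch the object.\<close>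

type_synonym view = "event list \<times> (nat \<Rightarrow> opkind option)"
type_synonym adversary = "view \<Rightarrow> nat"

type_synonym 's sysstate = "event list \<times> (nat \<Rightarrow> nat)"

definition adv_view :: "'s tas_impl \<Rightarrow> event list \<Rightarrow> (nat \<Rightarrow> nat) \<Rightarrow> view" where
  "adv_view I h pend =
     (h, \<lambda>p. case snd (run I h) p of Active s \<Rightarrow> Some (kind (act I s (pend p))) | _ \<Rightarrow> None)"

definition draw :: "'s tas_impl \<Rightarrow> event list \<Rightarrow> (nat \<Rightarrow> nat) \<Rightarrow> nat \<Rightarrow> 's sysstate pmf" where
  "draw I h pend p =
     (case snd (run I h) p of
        Active s \<Rightarrow> map_pmf (\<lambda>c. (h, pend(p := c))) (coin I s)
      | _ \<Rightarrow> return_pmf (h, pend))"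

definition step_pmf :: "'s tas_impl \<Rightarrow> nat \<Rightarrow> nat \<Rightarrow> adversary \<Rightarrow> 's sysstate \<Rightarrow> 's sysstate pmf" where
  "step_pmf I n k A x =
     (let h = fst x; pend = snd x; st = snd (run I h); p = A (adv_view I h pend) in
      if p \<in> {1..n} \<and> st p = Idle \<and> card {q. Inv q \<in> set h} < k
      then draw I (h @ [Inv p]) pend p
      else (case st p of
              Active s \<Rightarrow> draw I (h @ [Stp p (pend p)]) pend p
            | _ \<Rightarrow> return_pmf (h, pend)))"

definition exec_pmf :: "'s tas_impl \<Rightarrow> nat \<Rightarrow> nat \<Rightarrow> adversary \<Rightarrow> nat \<Rightarrow> 's sysstate pmf" where
  "exec_pmf I n k A t =
     ((\<lambda>P. bind_pmf P (step_pmf I n k A)) ^^ t) (return_pmf ([], \<lambda>_. 0))"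

definition steps :: "nat \<Rightarrow> event list \<Rightarrow> nat" where
  "steps p h = length (filter (\<lambda>e. \<exists>c. e = Stp p c) h)"

definition max_steps :: "nat \<Rightarrow> event list \<Rightarrow> nat" where
  "max_steps n h = Max ((\<lambda>p. steps p h) ` {1..n})"

text \<open>Expected max-step complexity tau(k) against location-oblivious adversaries.  The
  expectation of the (monotone) quantity over the infinite execution equals the supremum of
  its expectations over finite horizons t (monotone convergence).\<close>
definition max_step_cx :: "'s tas_impl \<Rightarrow> nat \<Rightarrow> nat \<Rightarrow> ennreal" where
  "max_step_cx I n k =
     (SUP A_t \<in> (UNIV :: (adversary \<times> nat) set).
        \<integral>\<^sup>+ x. ennreal (real (max_steps n (fst x)))
           \<partial>measure_pmf (exec_pmf I n k (fst A_t) (snd A_t)))"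

definition logstar :: "nat \<Rightarrow> nat" where
  "logstar k = (LEAST i. ((\<lambda>x. log 2 x) ^^ i) (real k) \<le> 1)"

end

(* The algorithm chains levels.  At level i a process runs a group election: it marks a cell G[i,x]
   with x geometric and survives iff G[i,x+1] is unmarked.  Survivors enter a splitter; the process
   that stops there leaves for the duel at level i, the ones that turn right go on to level i+1, all
   others lose.  The duel at level i opposes the splitter winner of level i to the winner of the duel
   at level i+1: both advance a counter with probability 1/2 per attempt, a process that sees itself
   behind loses and one that is two ahead wins.  The winner of duel 0 wins the object.  A loser sets a
   flag before returning, and a process that finds the flag set on arrival loses.

   Coins only ever select a register, never the kind of an operation or a written value.  Hence the
   view of a location-oblivious adversary is a function of the history, and every coin may be flipped
   only when its step is executed.  Against such an adversary each G[i,j] that is still unmarked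
   admits at most two survivors in expectation, while a writer exceeds J with probability 2^-J; so
   if N processes reach level i, at most 2 J + 2^-J E[N] reach level i+1 in expectation, for every J.
   This makes the expected number of processes constant after log* k levels.  From there on the
   splitters remove at least one process per level, and every duel costs O(1) steps in expectation.
   Since splitters alone suffice after the first O(log n) levels, O(n) registers are enough. *)

theory Submission
  imports Defs
begin

section \<open>The algorithm as an abstract machine\<close>

text \<open>Linearizability is required of every finite history, including those in which some
  processes have already lost while no winner is decided. For such a history a process must be named
  that can still be placed first, and it must not have been invoked after a loser returned.
  Uniqueness of the winner is therefore only half of safety: a further invariant shows that the
  losers never exhaust the field, and the flag keeps late arrivals from becoming the named process.
  On the probabilistic side the adversary is adaptive, so the population of a level depends on all
  earlier coins and no independence between levels is available. Every estimate is instead a drift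
  inequality: a potential \<open>F\<close> grows in expectation by no more than a budget
  \<open>G\<close> in each single step, whatever the schedule. The maximum over processes is removed
  deterministically: no process enters more levels than \<open>m\<close> plus the number of
  processes that reach level \<open>m\<close>, and duel steps are summed over all levels.
  Expectations of cardinalities then suffice.\<close>

datatype areg = DoneReg | DummyReg | XReg nat | YReg nat | Counter nat bool | GReg nat nat

text \<open>In \<open>DuelRead j b d\<close> and \<open>DuelWrite j b d\<close>, \<open>j\<close> is the level, \<open>d\<close> the own counter and \<open>b\<close> the side: \<open>False\<close>
  for the splitter winner of level \<open>j\<close>, \<open>True\<close> for the winner of duel \<open>j + 1\<close>.  The parameter \<open>s\<close> below is
  both the number of levels with a group election and the largest cell index drawn there.\<close>

datatype lstate = Start | GWrite nat | GRead nat nat | WriteX nat | ReadY nat | WriteY nat | ReadX nat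
  | DuelRead nat bool nat | DuelWrite nat bool nat | Losing | Return bool

instance lstate :: countable by countable_datatype

datatype aop = ARd areg | AWr areg nat

definition enter_level :: "nat \<Rightarrow> nat \<Rightarrow> lstate" where
  "enter_level s i = (if i < s then GWrite i else WriteX i)"

text \<open>A failed duel attempt writes the same value \<open>Suc d\<close> to
  \<open>DummyReg\<close>, because an adversary that sees pending values must not learn the coin.
  The cap \<open>min c s\<close> keeps the number of cells finite.\<close>

fun next_op :: "nat \<Rightarrow> nat \<Rightarrow> lstate \<Rightarrow> nat \<Rightarrow> aop" where
  "next_op s p Start c = ARd DoneReg"
| "next_op s p (GWrite i) c = AWr (GReg i (min c s)) 1"
| "next_op s p (GRead i x) c = ARd (GReg i (Suc x))"
| "next_op s p (WriteX i) c = AWr (XReg i) p"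
| "next_op s p (ReadY i) c = ARd (YReg i)"
| "next_op s p (WriteY i) c = AWr (YReg i) 1"
| "next_op s p (ReadX i) c = ARd (XReg i)"
| "next_op s p (DuelRead j b d) c = ARd (Counter j (\<not> b))"
| "next_op s p (DuelWrite j b d) c = AWr (if c = 0 then Counter j b else DummyReg) (Suc d)"
| "next_op s p Losing c = AWr DoneReg 1"
| "next_op s p (Return b) c = ARd DummyReg"

fun next_state :: "nat \<Rightarrow> nat \<Rightarrow> lstate \<Rightarrow> nat \<Rightarrow> nat \<Rightarrow> lstate" where
  "next_state s p Start c v = (if v = 0 then enter_level s 0 else Return True)"
| "next_state s p (GWrite i) c v = GRead i (min c s)"
| "next_state s p (GRead i x) c v = (if v = 0 then WriteX i else Losing)"
| "next_state s p (WriteX i) c v = ReadY i"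
| "next_state s p (ReadY i) c v = (if v = 0 then WriteY i else Losing)"
| "next_state s p (WriteY i) c v = ReadX i"
| "next_state s p (ReadX i) c v = (if v = p then DuelRead i False 0 else enter_level s (Suc i))"
| "next_state s p (DuelRead j b d) c v =
     (if d < v then Losing
      else if v + 2 \<le> d then (if j = 0 then Return False else DuelRead (j - 1) True 0)
      else DuelWrite j b d)"
| "next_state s p (DuelWrite j b d) c v = DuelRead j b (if c = 0 then Suc d else d)"
| "next_state s p Losing c v = Return True"
| "next_state s p (Return b) c v = Return b"

text \<open>The last four fields are ghosts: the number of levels a process has entered, the winner of the
  splitter and of the duel of each level, and the number of steps spent in the duel of each level,
  excluding the read by which a process leaves that duel.\<close>

record acfg =
  mem :: "areg \<Rightarrow> nat"
  stat :: "nat \<Rightarrow> lstate pstat"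
  levels :: "nat \<Rightarrow> nat"
  splitter_winner :: "nat \<Rightarrow> nat option"
  duel_winner :: "nat \<Rightarrow> nat option"
  duel_steps :: "nat \<Rightarrow> nat"

definition init_cfg :: acfg where
  "init_cfg = \<lparr>mem = \<lambda>_. 0, stat = \<lambda>_. Idle, levels = \<lambda>_. 0, splitter_winner = \<lambda>_. None, duel_winner = \<lambda>_. None, duel_steps = \<lambda>_. 0\<rparr>"

text \<open>One rule per branch, so that an invariant is proved by one case distinction with all
  guards explicit, and each ghost field is updated where its meaning changes. \<open>tr_act\<close>
  ties the rules to \<open>next_op\<close> and \<open>next_state\<close>.\<close>

inductive tr :: "nat \<Rightarrow> nat \<Rightarrow> nat \<Rightarrow> acfg \<Rightarrow> acfg \<Rightarrow> bool" for s p c \<sigma> where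
  Start1: "stat \<sigma> p = Active Start \<Longrightarrow> mem \<sigma> DoneReg \<noteq> 0 \<Longrightarrow>
    tr s p c \<sigma> (\<sigma>\<lparr>stat := (stat \<sigma>)(p := Done True)\<rparr>)"
| Start0: "stat \<sigma> p = Active Start \<Longrightarrow> mem \<sigma> DoneReg = 0 \<Longrightarrow>
    tr s p c \<sigma> (\<sigma>\<lparr>stat := (stat \<sigma>)(p := Active (enter_level s 0)), levels := (levels \<sigma>)(p := 1)\<rparr>)"
| GWrite: "stat \<sigma> p = Active (GWrite i) \<Longrightarrow>
    tr s p c \<sigma> (\<sigma>\<lparr>mem := (mem \<sigma>)(GReg i (min c s) := 1), stat := (stat \<sigma>)(p := Active (GRead i (min c s)))\<rparr>)"
| GRead0: "stat \<sigma> p = Active (GRead i x) \<Longrightarrow> mem \<sigma> (GReg i (Suc x)) = 0 \<Longrightarrow>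
    tr s p c \<sigma> (\<sigma>\<lparr>stat := (stat \<sigma>)(p := Active (WriteX i))\<rparr>)"
| GRead1: "stat \<sigma> p = Active (GRead i x) \<Longrightarrow> mem \<sigma> (GReg i (Suc x)) \<noteq> 0 \<Longrightarrow>
    tr s p c \<sigma> (\<sigma>\<lparr>stat := (stat \<sigma>)(p := Active Losing)\<rparr>)"
| WriteX: "stat \<sigma> p = Active (WriteX i) \<Longrightarrow>
    tr s p c \<sigma> (\<sigma>\<lparr>mem := (mem \<sigma>)(XReg i := p), stat := (stat \<sigma>)(p := Active (ReadY i))\<rparr>)"
| ReadY0: "stat \<sigma> p = Active (ReadY i) \<Longrightarrow> mem \<sigma> (YReg i) = 0 \<Longrightarrow>
    tr s p c \<sigma> (\<sigma>\<lparr>stat := (stat \<sigma>)(p := Active (WriteY i))\<rparr>)"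
| ReadY1: "stat \<sigma> p = Active (ReadY i) \<Longrightarrow> mem \<sigma> (YReg i) \<noteq> 0 \<Longrightarrow>
    tr s p c \<sigma> (\<sigma>\<lparr>stat := (stat \<sigma>)(p := Active Losing)\<rparr>)"
| WriteY: "stat \<sigma> p = Active (WriteY i) \<Longrightarrow>
    tr s p c \<sigma> (\<sigma>\<lparr>mem := (mem \<sigma>)(YReg i := 1), stat := (stat \<sigma>)(p := Active (ReadX i))\<rparr>)"
| ReadX_stop: "stat \<sigma> p = Active (ReadX i) \<Longrightarrow> mem \<sigma> (XReg i) = p \<Longrightarrow>
    tr s p c \<sigma> (\<sigma>\<lparr>stat := (stat \<sigma>)(p := Active (DuelRead i False 0)), splitter_winner := (splitter_winner \<sigma>)(i := Some p)\<rparr>)"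
| ReadX_right: "stat \<sigma> p = Active (ReadX i) \<Longrightarrow> mem \<sigma> (XReg i) \<noteq> p \<Longrightarrow>
    tr s p c \<sigma> (\<sigma>\<lparr>stat := (stat \<sigma>)(p := Active (enter_level s (Suc i))), levels := (levels \<sigma>)(p := Suc (Suc i))\<rparr>)"
| Duel_lose: "stat \<sigma> p = Active (DuelRead j b d) \<Longrightarrow> d < mem \<sigma> (Counter j (\<not> b)) \<Longrightarrow>
    tr s p c \<sigma> (\<sigma>\<lparr>stat := (stat \<sigma>)(p := Active Losing)\<rparr>)"
| Duel_win0: "stat \<sigma> p = Active (DuelRead 0 b d) \<Longrightarrow> mem \<sigma> (Counter 0 (\<not> b)) + 2 \<le> d \<Longrightarrow>
    tr s p c \<sigma> (\<sigma>\<lparr>stat := (stat \<sigma>)(p := Done False), duel_winner := (duel_winner \<sigma>)(0 := Some p)\<rparr>)"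
| Duel_win: "stat \<sigma> p = Active (DuelRead (Suc j) b d) \<Longrightarrow> mem \<sigma> (Counter (Suc j) (\<not> b)) + 2 \<le> d \<Longrightarrow>
    tr s p c \<sigma> (\<sigma>\<lparr>stat := (stat \<sigma>)(p := Active (DuelRead j True 0)), duel_winner := (duel_winner \<sigma>)(Suc j := Some p)\<rparr>)"
| Duel_cont: "stat \<sigma> p = Active (DuelRead j b d) \<Longrightarrow> mem \<sigma> (Counter j (\<not> b)) \<le> d \<Longrightarrow> d < mem \<sigma> (Counter j (\<not> b)) + 2 \<Longrightarrow>
    tr s p c \<sigma> (\<sigma>\<lparr>stat := (stat \<sigma>)(p := Active (DuelWrite j b d)), duel_steps := (duel_steps \<sigma>)(j := Suc (duel_steps \<sigma> j))\<rparr>)"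
| DuelWrite0: "stat \<sigma> p = Active (DuelWrite j b d) \<Longrightarrow> c = 0 \<Longrightarrow>
    tr s p c \<sigma> (\<sigma>\<lparr>mem := (mem \<sigma>)(Counter j b := Suc d), stat := (stat \<sigma>)(p := Active (DuelRead j b (Suc d))),
      duel_steps := (duel_steps \<sigma>)(j := Suc (duel_steps \<sigma> j))\<rparr>)"
| DuelWrite1: "stat \<sigma> p = Active (DuelWrite j b d) \<Longrightarrow> c \<noteq> 0 \<Longrightarrow>
    tr s p c \<sigma> (\<sigma>\<lparr>mem := (mem \<sigma>)(DummyReg := Suc d), stat := (stat \<sigma>)(p := Active (DuelRead j b d)),
      duel_steps := (duel_steps \<sigma>)(j := Suc (duel_steps \<sigma> j))\<rparr>)"
| Losing: "stat \<sigma> p = Active Losing \<Longrightarrow>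
    tr s p c \<sigma> (\<sigma>\<lparr>mem := (mem \<sigma>)(DoneReg := 1), stat := (stat \<sigma>)(p := Done True)\<rparr>)"

lemma tr_ex: "stat \<sigma> p = Active x \<Longrightarrow> (\<And>b. x \<noteq> Return b) \<Longrightarrow> \<exists>\<sigma>'. tr s p c \<sigma> \<sigma>'"
proof (cases x)
  case (DuelRead j b d)
  assume a: "stat \<sigma> p = Active x"
  show ?thesis
    using a DuelRead by (cases j; cases "d < mem \<sigma> (Counter j (\<not> b))"; cases "mem \<sigma> (Counter j (\<not> b)) + 2 \<le> d")
      (auto intro: tr.intros simp: not_less not_le simp del: add_2_eq_Suc')
next
  case (DuelWrite j b d)
  assume a: "stat \<sigma> p = Active x"
  show ?thesis using a DuelWrite by (cases "c = 0") (auto intro: tr.intros)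
qed (blast intro: tr.intros)+

text \<open>The inner case on \<open>Return b\<close> mirrors \<open>enter\<close>: a process that
  reaches a returning state is \<open>Done\<close> within the same step.\<close>

lemma tr_act:
  assumes "tr s p c \<sigma> \<sigma>'"
  obtains x where "stat \<sigma> p = Active x"
    "mem \<sigma>' = (case next_op s p x c of ARd r \<Rightarrow> mem \<sigma> | AWr r u \<Rightarrow> (mem \<sigma>)(r := u))"
    "stat \<sigma>' = (stat \<sigma>)(p := (case next_state s p x c (case next_op s p x c of ARd r \<Rightarrow> mem \<sigma> r | AWr r u \<Rightarrow> 0)
        of Return b \<Rightarrow> Done b | y \<Rightarrow> Active y))"
  using assms by (cases rule: tr.cases) (auto simp: enter_level_def)

section \<open>Levels\<close>

fun pre_level :: "lstate \<Rightarrow> nat option" where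
  "pre_level (GWrite i) = Some i"
| "pre_level (GRead i x) = Some i"
| "pre_level (WriteX i) = Some i"
| "pre_level (ReadY i) = Some i"
| "pre_level (WriteY i) = Some i"
| "pre_level (ReadX i) = Some i"
| "pre_level _ = None"

fun chain_port :: "lstate \<Rightarrow> (nat \<times> bool) option" where
  "chain_port (DuelRead j b d) = Some (j, b)"
| "chain_port (DuelWrite j b d) = Some (j, b)"
| "chain_port _ = None"

text \<open>The key clause says that the process named in \<open>XReg i\<close> has entered level
  \<open>i\<close> but no later one. It persists since a process turns right only on finding a
  foreign ID in \<open>XReg i\<close>. IDs start at 1, so the content 0 means that nobody has
  written yet.\<close>

definition inv_levels :: "nat \<Rightarrow> nat \<Rightarrow> acfg \<Rightarrow> bool" where
  "inv_levels n s \<sigma> \<longleftrightarrow>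
    (\<forall>p x i. stat \<sigma> p = Active x \<longrightarrow> pre_level x = Some i \<longrightarrow> levels \<sigma> p = Suc i) \<and>
    (\<forall>p i x. (stat \<sigma> p = Active (GWrite i) \<longrightarrow> i < s) \<and> (stat \<sigma> p = Active (GRead i x) \<longrightarrow> i < s \<and> x \<le> s)) \<and>
    (\<forall>p x j b. stat \<sigma> p = Active x \<longrightarrow> chain_port x = Some (j, b) \<longrightarrow> j < levels \<sigma> p) \<and>
    (\<forall>p. stat \<sigma> p = Idle \<or> stat \<sigma> p = Active Start \<longrightarrow> levels \<sigma> p = 0) \<and>
    (\<forall>p. stat \<sigma> p = Active Losing \<longrightarrow> levels \<sigma> p \<noteq> 0) \<and>
    (\<forall>i. mem \<sigma> (XReg i) \<noteq> 0 \<longrightarrow> levels \<sigma> (mem \<sigma> (XReg i)) = Suc i) \<and>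
    (\<forall>p i. Suc i < levels \<sigma> p \<longrightarrow> mem \<sigma> (XReg i) \<noteq> 0) \<and>
    (\<forall>p i. stat \<sigma> p \<in> {Active (ReadY i), Active (WriteY i), Active (ReadX i)} \<longrightarrow> mem \<sigma> (XReg i) \<noteq> 0) \<and>
    (\<forall>p. levels \<sigma> p \<noteq> 0 \<or> stat \<sigma> p \<noteq> Idle \<longrightarrow> p \<in> {1..n}) \<and>
    (\<forall>p b. stat \<sigma> p \<noteq> Active (Return b))"

lemma inv_levels_D:
  assumes "inv_levels n s \<sigma>"
  shows inv_levels_pre_level: "\<And>p x i. stat \<sigma> p = Active x \<Longrightarrow> pre_level x = Some i \<Longrightarrow> levels \<sigma> p = Suc i"
    and inv_levels_G: "\<And>p i x. (stat \<sigma> p = Active (GWrite i) \<longrightarrow> i < s) \<and> (stat \<sigma> p = Active (GRead i x) \<longrightarrow> i < s \<and> x \<le> s)"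
    and inv_levels_chain_port: "\<And>p x j b. stat \<sigma> p = Active x \<Longrightarrow> chain_port x = Some (j, b) \<Longrightarrow> j < levels \<sigma> p"
    and inv_levels_lv0: "\<And>p. stat \<sigma> p = Idle \<or> stat \<sigma> p = Active Start \<Longrightarrow> levels \<sigma> p = 0"
    and inv_levels_Losing: "\<And>p. stat \<sigma> p = Active Losing \<Longrightarrow> levels \<sigma> p \<noteq> 0"
    and inv_levels_X: "\<And>i. mem \<sigma> (XReg i) \<noteq> 0 \<Longrightarrow> levels \<sigma> (mem \<sigma> (XReg i)) = Suc i"
    and inv_levels_X0: "\<And>p i. Suc i < levels \<sigma> p \<Longrightarrow> mem \<sigma> (XReg i) \<noteq> 0"
    and inv_levels_status: "\<And>p i. stat \<sigma> p \<in> {Active (ReadY i), Active (WriteY i), Active (ReadX i)} \<Longrightarrow> mem \<sigma> (XReg i) \<noteq> 0"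
    and inv_levels_p: "\<And>p. levels \<sigma> p \<noteq> 0 \<or> stat \<sigma> p \<noteq> Idle \<Longrightarrow> p \<in> {1..n}"
    and inv_levels_Return: "\<And>p b. stat \<sigma> p \<noteq> Active (Return b)"
proof -
  note I = assms[unfolded inv_levels_def]
  note I5 = I[THEN conjunct2, THEN conjunct2, THEN conjunct2, THEN conjunct2, THEN conjunct2]
  show "\<And>p x i. stat \<sigma> p = Active x \<Longrightarrow> pre_level x = Some i \<Longrightarrow> levels \<sigma> p = Suc i"
    using I[THEN conjunct1] by blast
  show "\<And>p i x. (stat \<sigma> p = Active (GWrite i) \<longrightarrow> i < s) \<and> (stat \<sigma> p = Active (GRead i x) \<longrightarrow> i < s \<and> x \<le> s)"
    using I[THEN conjunct2, THEN conjunct1] by blast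
  show "\<And>p x j b. stat \<sigma> p = Active x \<Longrightarrow> chain_port x = Some (j, b) \<Longrightarrow> j < levels \<sigma> p"
    using I[THEN conjunct2, THEN conjunct2, THEN conjunct1] by blast
  show "\<And>p. stat \<sigma> p = Idle \<or> stat \<sigma> p = Active Start \<Longrightarrow> levels \<sigma> p = 0"
    using I[THEN conjunct2, THEN conjunct2, THEN conjunct2, THEN conjunct1] by blast
  show "\<And>p. stat \<sigma> p = Active Losing \<Longrightarrow> levels \<sigma> p \<noteq> 0"
    using I[THEN conjunct2, THEN conjunct2, THEN conjunct2, THEN conjunct2, THEN conjunct1] by blast
  show "\<And>i. mem \<sigma> (XReg i) \<noteq> 0 \<Longrightarrow> levels \<sigma> (mem \<sigma> (XReg i)) = Suc i"
    using I5[THEN conjunct1] by blast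
  show "\<And>p i. Suc i < levels \<sigma> p \<Longrightarrow> mem \<sigma> (XReg i) \<noteq> 0"
    using I5[THEN conjunct2, THEN conjunct1] by blast
  show "\<And>p i. stat \<sigma> p \<in> {Active (ReadY i), Active (WriteY i), Active (ReadX i)} \<Longrightarrow> mem \<sigma> (XReg i) \<noteq> 0"
    using I5[THEN conjunct2, THEN conjunct2, THEN conjunct1] by blast
  show "\<And>p. levels \<sigma> p \<noteq> 0 \<or> stat \<sigma> p \<noteq> Idle \<Longrightarrow> p \<in> {1..n}"
    using I5[THEN conjunct2, THEN conjunct2, THEN conjunct2, THEN conjunct1] by blast
  show "\<And>p b. stat \<sigma> p \<noteq> Active (Return b)"
    using I5[THEN conjunct2, THEN conjunct2, THEN conjunct2, THEN conjunct2] by blast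
qed

lemma inv_levels_init_cfg: "inv_levels n s init_cfg"
  by (auto simp: inv_levels_def init_cfg_def)

lemma inv_levels_inv: "inv_levels n s \<sigma> \<Longrightarrow> p \<in> {1..n} \<Longrightarrow> stat \<sigma> p = Idle \<Longrightarrow>
  inv_levels n s (\<sigma>\<lparr>stat := (stat \<sigma>)(p := Active Start)\<rparr>)"
  unfolding inv_levels_def by (simp add: all_conj_distrib)

lemma inv_levels_tr:
  assumes tr: "tr s p c \<sigma> \<sigma>'" and inv: "inv_levels n s \<sigma>"
  shows "inv_levels n s \<sigma>'"
proof -
  have "stat \<sigma> p \<noteq> Idle" using tr by (cases rule: tr.cases) auto
  then have p: "p \<in> {1..n}" "p \<noteq> 0" using inv_levels_p[OF inv] by force+
  note pl = inv_levels_pre_level[OF inv]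
  have pl': "stat \<sigma> p = Active (GWrite i) \<Longrightarrow> levels \<sigma> p = Suc i" "stat \<sigma> p = Active (GRead i y) \<Longrightarrow> levels \<sigma> p = Suc i"
    "stat \<sigma> p = Active (WriteX i) \<Longrightarrow> levels \<sigma> p = Suc i" "stat \<sigma> p = Active (ReadY i) \<Longrightarrow> levels \<sigma> p = Suc i"
    "stat \<sigma> p = Active (WriteY i) \<Longrightarrow> levels \<sigma> p = Suc i" "stat \<sigma> p = Active (ReadX i) \<Longrightarrow> levels \<sigma> p = Suc i" for i y
    by (simp_all add: pl)
  have x0: "mem \<sigma> (XReg k) \<noteq> 0" if "levels \<sigma> p = Suc i" "k < i" for i k
    using inv_levels_X0[OF inv, of k p] that by simp
  have x1: "mem \<sigma> (XReg i) \<noteq> 0" if "stat \<sigma> p = Active (ReadX i)" for i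
    using inv_levels_status[OF inv, of p i] that by simp
  have lv0: "levels \<sigma> p = 0" if "stat \<sigma> p = Active Start" using inv_levels_lv0[OF inv] that by blast
  have chl: "\<And>j b d. stat \<sigma> p = Active (DuelRead j b d) \<Longrightarrow> 0 < levels \<sigma> p"
    using inv_levels_chain_port[OF inv] by (metis chain_port.simps(1) gr_zeroI not_less_zero)
  have ch: "\<And>j b d. stat \<sigma> p = Active (DuelRead (Suc j) b d) \<Longrightarrow> j < levels \<sigma> p"
    using inv_levels_chain_port[OF inv] by (metis chain_port.simps(1) Suc_lessD)
  show ?thesis
    unfolding inv_levels_def
    apply (intro conjI)
    subgoal using tr inv_levels_pre_level[OF inv] by (cases rule: tr.cases) (auto simp: enter_level_def)
    subgoal using tr inv_levels_G[OF inv] by (cases rule: tr.cases) (auto simp: enter_level_def)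
    subgoal using tr inv_levels_chain_port[OF inv] inv_levels_pre_level[OF inv] ch by (cases rule: tr.cases) (auto simp: enter_level_def)
    subgoal using tr inv_levels_lv0[OF inv] by (cases rule: tr.cases) (auto simp: enter_level_def)
    subgoal using tr inv_levels_Losing[OF inv] pl' chl by (cases rule: tr.cases) (auto simp: enter_level_def)
    subgoal using tr inv_levels_X[OF inv] lv0 pl' p by (cases rule: tr.cases) (auto simp: enter_level_def)
    subgoal using tr inv_levels_X0[OF inv] x0 x1 pl' p by (cases rule: tr.cases) (auto simp: enter_level_def less_Suc_eq)
    subgoal using tr inv_levels_status[OF inv] p by (cases rule: tr.cases) (auto simp: enter_level_def)
    subgoal using tr inv_levels_p[OF inv] p by (cases rule: tr.cases) (auto simp: enter_level_def)
    subgoal using tr inv_levels_Return[OF inv] by (cases rule: tr.cases) (auto simp: enter_level_def)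
    done
qed

section \<open>Counting the processes that reach a level\<close>

definition reached :: "acfg \<Rightarrow> nat \<Rightarrow> nat set" where
  "reached \<sigma> i = {p. i < levels \<sigma> p}"

lemma reached_sub: "inv_levels n s \<sigma> \<Longrightarrow> reached \<sigma> i \<subseteq> {1..n}"
proof
  fix p assume "inv_levels n s \<sigma>" "p \<in> reached \<sigma> i"
  then show "p \<in> {1..n}" using inv_levels_p[of n s \<sigma> p] by (simp add: reached_def)
qed

lemma reached_finite: "inv_levels n s \<sigma> \<Longrightarrow> finite (reached \<sigma> i)"
  by (rule finite_subset[OF reached_sub]) auto

text \<open>Once somebody has turned right at level \<open>i\<close>, \<open>XReg i\<close> holds an
  ID, and the process it names has entered level \<open>i\<close> but not the next.\<close>

lemma reached_card_Suc:
  assumes "inv_levels n s \<sigma>" "reached \<sigma> (Suc i) \<noteq> {}"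
  shows "card (reached \<sigma> (Suc i)) < card (reached \<sigma> i)"
proof -
  obtain p where "Suc i < levels \<sigma> p" using assms(2) by (auto simp: reached_def)
  then have "levels \<sigma> (mem \<sigma> (XReg i)) = Suc i" using inv_levels_X[OF assms(1) inv_levels_X0[OF assms(1)]] by simp
  then have "mem \<sigma> (XReg i) \<in> reached \<sigma> i - reached \<sigma> (Suc i)" by (simp add: reached_def)
  moreover have "reached \<sigma> (Suc i) \<subseteq> reached \<sigma> i" by (auto simp: reached_def)
  ultimately show ?thesis using reached_finite[OF assms(1)] by (intro psubset_card_mono) auto
qed

lemma reached_card_add:
  assumes "inv_levels n s \<sigma>" "reached \<sigma> (i + r) \<noteq> {}"
  shows "card (reached \<sigma> i) > r"
  using assms(2)
proof (induction r arbitrary: i)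
  case 0
  then show ?case using reached_finite[OF assms(1)] by (simp add: card_gt_0_iff)
next
  case (Suc r)
  have "reached \<sigma> (Suc i + r) \<noteq> {}" using Suc.prems by simp
  from Suc.IH[OF this] have 1: "r < card (reached \<sigma> (Suc i))" .
  then have "reached \<sigma> (Suc i) \<noteq> {}" by auto
  from reached_card_Suc[OF assms(1) this] 1 show ?case by simp
qed

text \<open>Every level beyond \<open>m\<close> costs at least one process, so the deepest level is
  controlled by the population of the single level \<open>m\<close>. This is used with
  \<open>m = 0\<close> for the register bound and with \<open>m\<close> equal to a log* for the step
  bound.\<close>

lemma levels_le_add: "inv_levels n s \<sigma> \<Longrightarrow> levels \<sigma> p \<le> m + card (reached \<sigma> m)"
proof (cases "levels \<sigma> p \<le> m")
  case False
  assume "inv_levels n s \<sigma>"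
  have "p \<in> reached \<sigma> (m + (levels \<sigma> p - 1 - m))" using False by (simp add: reached_def)
  then have "levels \<sigma> p - 1 - m < card (reached \<sigma> m)" by (intro reached_card_add[OF \<open>inv_levels n s \<sigma>\<close>]) blast
  then show ?thesis using False by simp
qed simp

lemma levels_le: "inv_levels n s \<sigma> \<Longrightarrow> levels \<sigma> p \<le> n"
proof -
  assume "inv_levels n s \<sigma>"
  then have "levels \<sigma> p \<le> card (reached \<sigma> 0)" using levels_le_add[of n s \<sigma> p 0] by simp
  also have "\<dots> \<le> card {1..n}" using reached_sub[OF \<open>inv_levels n s \<sigma>\<close>] by (intro card_mono) auto
  finally show ?thesis by simp
qed

section \<open>Uniqueness of winners\<close>

text \<open>Side \<open>b\<close> of duel \<open>j\<close> is used by at most one process in the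
  whole execution. This makes each counter a single-writer register that agrees with the local copy
  \<open>d\<close>.\<close>

definition owner :: "acfg \<Rightarrow> nat \<Rightarrow> bool \<Rightarrow> nat option" where
  "owner \<sigma> j b = (if b then duel_winner \<sigma> (Suc j) else splitter_winner \<sigma> j)"

lemma owner_simps [simp]:
  "owner (\<sigma>\<lparr>mem := a\<rparr>) j b = owner \<sigma> j b"
  "owner (\<sigma>\<lparr>stat := f\<rparr>) j b = owner \<sigma> j b"
  "owner (\<sigma>\<lparr>levels := g\<rparr>) j b = owner \<sigma> j b"
  "owner (\<sigma>\<lparr>duel_steps := g\<rparr>) j b = owner \<sigma> j b"
  "owner (\<sigma>\<lparr>splitter_winner := (splitter_winner \<sigma>)(i := x)\<rparr>) j b = (if j = i \<and> \<not> b then x else owner \<sigma> j b)"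
  "owner (\<sigma>\<lparr>duel_winner := (duel_winner \<sigma>)(i := x)\<rparr>) j b = (if Suc j = i \<and> b then x else owner \<sigma> j b)"
  by (auto simp: owner_def)

text \<open>The lead that a decided winner keeps forever. A lead of two is demanded only while the
  opponent has a write pending: that write costs one, and afterwards the opponent can only read,
  find itself behind and lose.\<close>

definition leads :: "acfg \<Rightarrow> nat \<Rightarrow> nat \<Rightarrow> bool \<Rightarrow> bool" where
  "leads \<sigma> j p b \<longleftrightarrow> owner \<sigma> j b = Some p \<and>
     (\<forall>d. stat \<sigma> p \<noteq> Active (DuelRead j b d) \<and> stat \<sigma> p \<noteq> Active (DuelWrite j b d)) \<and>
     mem \<sigma> (Counter j (\<not> b)) < mem \<sigma> (Counter j b) \<and>
     (\<forall>q d. stat \<sigma> q = Active (DuelWrite j (\<not> b) d) \<longrightarrow> mem \<sigma> (Counter j (\<not> b)) + 2 \<le> mem \<sigma> (Counter j b))"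

text \<open>The splitter clause expresses uniqueness of the process that stops: later writers of
  \<open>XReg i\<close> are turned away by \<open>YReg i\<close>, and the processes already past
  that test see a foreign ID. The last clause lets a new owner start from counter 0.\<close>

definition inv_duels :: "acfg \<Rightarrow> bool" where
  "inv_duels \<sigma> \<longleftrightarrow>
    (\<forall>p j b d. stat \<sigma> p = Active (DuelRead j b d) \<or> stat \<sigma> p = Active (DuelWrite j b d) \<longrightarrow>
       mem \<sigma> (Counter j b) = d \<and> owner \<sigma> j b = Some p) \<and>
    (\<forall>p j b d. stat \<sigma> p = Active (DuelWrite j b d) \<longrightarrow> d \<le> Suc (mem \<sigma> (Counter j (\<not> b)))) \<and>
    (\<forall>p j. duel_winner \<sigma> j = Some p \<longrightarrow> (\<exists>b. leads \<sigma> j p b)) \<and>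
    (\<forall>q i. splitter_winner \<sigma> i = Some q \<longrightarrow> mem \<sigma> (YReg i) \<noteq> 0 \<and>
       (\<forall>p. stat \<sigma> p = Active (WriteY i) \<or> stat \<sigma> p = Active (ReadX i) \<longrightarrow> mem \<sigma> (XReg i) \<noteq> p)) \<and>
    (\<forall>p i. stat \<sigma> p = Active (ReadX i) \<longrightarrow> mem \<sigma> (YReg i) \<noteq> 0) \<and>
    (\<forall>p. stat \<sigma> p = Done False \<longleftrightarrow> duel_winner \<sigma> 0 = Some p) \<and>
    (\<forall>j b. mem \<sigma> (Counter j b) \<noteq> 0 \<longrightarrow> owner \<sigma> j b \<noteq> None)"

lemma inv_duels_D:
  assumes "inv_duels \<sigma>"
  shows inv_duels_mem: "\<And>p j b d. stat \<sigma> p = Active (DuelRead j b d) \<or> stat \<sigma> p = Active (DuelWrite j b d) \<Longrightarrow>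
       mem \<sigma> (Counter j b) = d \<and> owner \<sigma> j b = Some p"
    and inv_duels_DuelWrite: "\<And>p j b d. stat \<sigma> p = Active (DuelWrite j b d) \<Longrightarrow> d \<le> Suc (mem \<sigma> (Counter j (\<not> b)))"
    and inv_duels_duel_winner: "\<And>p j. duel_winner \<sigma> j = Some p \<Longrightarrow> \<exists>b. leads \<sigma> j p b"
    and inv_duels_splitter_winner: "\<And>q i. splitter_winner \<sigma> i = Some q \<Longrightarrow> mem \<sigma> (YReg i) \<noteq> 0 \<and>
       (\<forall>p. stat \<sigma> p = Active (WriteY i) \<or> stat \<sigma> p = Active (ReadX i) \<longrightarrow> mem \<sigma> (XReg i) \<noteq> p)"
    and inv_duels_ST: "\<And>p i. stat \<sigma> p = Active (ReadX i) \<Longrightarrow> mem \<sigma> (YReg i) \<noteq> 0"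
    and inv_duels_Done: "\<And>p. stat \<sigma> p = Done False \<longleftrightarrow> duel_winner \<sigma> 0 = Some p"
    and inv_duels_own: "\<And>j b. mem \<sigma> (Counter j b) \<noteq> 0 \<Longrightarrow> owner \<sigma> j b \<noteq> None"
proof -
  note I = assms[unfolded inv_duels_def]
  show "\<And>p j b d. stat \<sigma> p = Active (DuelRead j b d) \<or> stat \<sigma> p = Active (DuelWrite j b d) \<Longrightarrow>
       mem \<sigma> (Counter j b) = d \<and> owner \<sigma> j b = Some p"
    using I[THEN conjunct1] by blast
  show "\<And>p j b d. stat \<sigma> p = Active (DuelWrite j b d) \<Longrightarrow> d \<le> Suc (mem \<sigma> (Counter j (\<not> b)))"
    using I[THEN conjunct2, THEN conjunct1] by blast
  show "\<And>p j. duel_winner \<sigma> j = Some p \<Longrightarrow> \<exists>b. leads \<sigma> j p b"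
    using I[THEN conjunct2, THEN conjunct2, THEN conjunct1] by blast
  show "\<And>q i. splitter_winner \<sigma> i = Some q \<Longrightarrow> mem \<sigma> (YReg i) \<noteq> 0 \<and>
       (\<forall>p. stat \<sigma> p = Active (WriteY i) \<or> stat \<sigma> p = Active (ReadX i) \<longrightarrow> mem \<sigma> (XReg i) \<noteq> p)"
    using I[THEN conjunct2, THEN conjunct2, THEN conjunct2, THEN conjunct1] by blast
  show "\<And>p i. stat \<sigma> p = Active (ReadX i) \<Longrightarrow> mem \<sigma> (YReg i) \<noteq> 0"
    using I[THEN conjunct2, THEN conjunct2, THEN conjunct2, THEN conjunct2, THEN conjunct1] by blast
  show "\<And>p. stat \<sigma> p = Done False \<longleftrightarrow> duel_winner \<sigma> 0 = Some p"
    using I[THEN conjunct2, THEN conjunct2, THEN conjunct2, THEN conjunct2, THEN conjunct2, THEN conjunct1] by blast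
  show "\<And>j b. mem \<sigma> (Counter j b) \<noteq> 0 \<Longrightarrow> owner \<sigma> j b \<noteq> None"
    using I[THEN conjunct2, THEN conjunct2, THEN conjunct2, THEN conjunct2, THEN conjunct2, THEN conjunct2] by blast
qed

lemma inv_duels_init_cfg: "inv_duels init_cfg"
  by (auto simp: inv_duels_def init_cfg_def)

lemma inv_duels_inv:
  assumes inv: "inv_duels \<sigma>" and p: "stat \<sigma> p = Idle"
  shows "inv_duels (\<sigma>\<lparr>stat := (stat \<sigma>)(p := Active Start)\<rparr>)"
  unfolding inv_duels_def
  apply (intro conjI)
  subgoal using inv_duels_mem[OF inv] by auto
  subgoal using inv_duels_DuelWrite[OF inv] by auto
  subgoal
  proof (intro allI impI)
    fix q j assume "duel_winner (\<sigma>\<lparr>stat := (stat \<sigma>)(p := Active Start)\<rparr>) j = Some q"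
    then obtain b where "leads \<sigma> j q b" using inv_duels_duel_winner[OF inv] by auto
    then have "leads (\<sigma>\<lparr>stat := (stat \<sigma>)(p := Active Start)\<rparr>) j q b"
      by (auto simp: leads_def)
    then show "\<exists>b. leads (\<sigma>\<lparr>stat := (stat \<sigma>)(p := Active Start)\<rparr>) j q b" ..
  qed
  subgoal using inv_duels_splitter_winner[OF inv] by auto
  subgoal using inv_duels_ST[OF inv] by auto
  subgoal using inv_duels_Done[OF inv] inv_duels_Done[OF inv, of p] p by auto
  subgoal using inv_duels_own[OF inv] by auto
  done

text \<open>A participant that is not behind contradicts a decided duel on either side: on the
  winner's side it would be the winner, who has left; on the other side it would have to be
  behind.\<close>

lemma duel_winner_None:
  assumes inv: "inv_duels \<sigma>" and p: "stat \<sigma> p = Active (DuelRead j b d)" and le: "mem \<sigma> (Counter j (\<not> b)) \<le> d"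
  shows "duel_winner \<sigma> j = None"
proof (rule ccontr)
  assume "duel_winner \<sigma> j \<noteq> None"
  then obtain q where q: "duel_winner \<sigma> j = Some q" by blast
  obtain b' where L: "leads \<sigma> j q b'" using inv_duels_duel_winner[OF inv q] by (elim exE)
  have m: "mem \<sigma> (Counter j b) = d" "owner \<sigma> j b = Some p" using inv_duels_mem[OF inv, of p j b d] p by simp_all
  show False
  proof (cases "b' = b")
    case True
    then show ?thesis using L m p unfolding leads_def by simp
  next
    case False
    then have "b' = (\<not> b)" by simp
    then show ?thesis using L m le unfolding leads_def by simp
  qed
qed

lemma splitter_winner_None:
  assumes inv: "inv_duels \<sigma>" and p: "stat \<sigma> p = Active (ReadX i)" and X: "mem \<sigma> (XReg i) = p"
  shows "splitter_winner \<sigma> i = None"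
  using inv_duels_splitter_winner[OF inv, of i] p X by (cases "splitter_winner \<sigma> i") auto

text \<open>Only a pending write of the opponent can shrink the lead, and no new write becomes
  pending: \<open>Duel_cont\<close> requires a participant that is not behind, which is impossible
  once the duel is decided.\<close>

lemma leads_tr:
  assumes tr: "tr s p c \<sigma> \<sigma>'" and inv: "inv_duels \<sigma>" and w: "duel_winner \<sigma> j = Some q" and l: "leads \<sigma> j q b"
  shows "leads \<sigma>' j q b"
proof -
  note l' = l[unfolded leads_def]
  note l1 = l'[THEN conjunct1] and l2 = l'[THEN conjunct2, THEN conjunct1]
    and l3 = l'[THEN conjunct2, THEN conjunct2, THEN conjunct1]
    and l4 = l'[THEN conjunct2, THEN conjunct2, THEN conjunct2]
  have own: "owner \<sigma>' j b = owner \<sigma> j b" using tr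
  proof (cases rule: tr.cases)
    case (ReadX_stop i)
    have "splitter_winner \<sigma> i = None" using splitter_winner_None[OF inv] ReadX_stop by simp
    then show ?thesis using l1 ReadX_stop by (auto simp: owner_def)
  next
    case (Duel_win0 b' d)
    then show ?thesis by (auto simp: owner_def)
  next
    case (Duel_win j' b' d)
    have "duel_winner \<sigma> (Suc j') = None" using duel_winner_None[OF inv, of p "Suc j'" b' d] Duel_win by simp
    then show ?thesis using l1 Duel_win by (auto simp: owner_def)
  qed simp_all
  have bck: "stat \<sigma>' r = Active (DuelWrite j e d) \<Longrightarrow> stat \<sigma> r = Active (DuelWrite j e d)" for r e d
    using tr
  proof (cases rule: tr.cases)
    case (Duel_cont j' b' d')
    have "j \<noteq> j'" using duel_winner_None[OF inv, of p j' b' d'] Duel_cont w by auto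
    moreover assume "stat \<sigma>' r = Active (DuelWrite j e d)"
    ultimately show ?thesis using Duel_cont by (simp split: if_splits)
  qed (simp_all add: enter_level_def split: if_splits)
  have 2: "stat \<sigma>' q \<noteq> Active (DuelRead j b d)" for d
  proof
    assume a: "stat \<sigma>' q = Active (DuelRead j b d)"
    have n: "stat \<sigma> q \<noteq> Active (DuelRead j b d)" "\<And>e. stat \<sigma> q \<noteq> Active (DuelWrite j b e)" using l2 by auto
    show False using tr
    proof (cases rule: tr.cases)
      case (ReadX_stop i)
      have "splitter_winner \<sigma> i = None" using splitter_winner_None[OF inv] ReadX_stop by simp
      then show ?thesis using l1 ReadX_stop a n(1) by (simp add: owner_def split: if_splits)
    next
      case (Duel_win j' b' d')
      have "duel_winner \<sigma> (Suc j') = None" using duel_winner_None[OF inv, of p "Suc j'" b' d'] Duel_win by simp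
      then show ?thesis using l1 Duel_win a n(1) by (simp add: owner_def split: if_splits)
    next
      case (DuelWrite0 j' b' d')
      then show ?thesis using a n by (auto split: if_splits)
    next
      case (DuelWrite1 j' b' d')
      then show ?thesis using a n by (auto split: if_splits)
    qed (use a n(1) in \<open>simp_all add: enter_level_def split: if_splits\<close>)
  qed
  have 34: "mem \<sigma>' (Counter j (\<not> b)) < mem \<sigma>' (Counter j b) \<and>
    (\<forall>r d. stat \<sigma>' r = Active (DuelWrite j (\<not> b) d) \<longrightarrow> mem \<sigma>' (Counter j (\<not> b)) + 2 \<le> mem \<sigma>' (Counter j b))"
  proof (cases "mem \<sigma>' (Counter j True) = mem \<sigma> (Counter j True) \<and> mem \<sigma>' (Counter j False) = mem \<sigma> (Counter j False)")
    case True
    then have "mem \<sigma>' (Counter j e) = mem \<sigma> (Counter j e)" for e by (cases e) auto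
    moreover have "mem \<sigma> (Counter j (\<not> b)) + 2 \<le> mem \<sigma> (Counter j b)" if "stat \<sigma>' r = Active (DuelWrite j (\<not> b) d)" for r d
      using l4[rule_format, OF bck[OF that]] .
    ultimately show ?thesis using l3 by simp
  next
    case ne: False
    show ?thesis using tr
    proof (cases rule: tr.cases)
      case (DuelWrite0 j' b' d)
      have jj: "j' = j" using ne DuelWrite0 by (auto split: if_splits)
      have m: "mem \<sigma> (Counter j b') = d" "owner \<sigma> j b' = Some p" using inv_duels_mem[OF inv, of p j b' d] DuelWrite0 jj by simp_all
      have b': "b' = (\<not> b)"
      proof (rule ccontr)
        assume "b' \<noteq> (\<not> b)"
        then have "b' = b" by auto
        then show False using m l1 l2 DuelWrite0 jj by auto
      qed
      \<comment> \<open>This is the margin of two reserved for exactly this write; after it the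
        opponent has no write pending, so a lead of one is enough.\<close>
      have "mem \<sigma> (Counter j (\<not> b)) + 2 \<le> mem \<sigma> (Counter j b)" using l4[rule_format, of p d] DuelWrite0 jj b' by simp
      moreover have "stat \<sigma>' r \<noteq> Active (DuelWrite j (\<not> b) e)" for r e
      proof
        assume a: "stat \<sigma>' r = Active (DuelWrite j (\<not> b) e)"
        then have "owner \<sigma> j (\<not> b) = Some r" using bck[OF a] inv_duels_mem[OF inv, of r j "\<not> b" e] by simp
        then have "r = p" using m b' by simp
        then show False using a DuelWrite0 by simp
      qed
      ultimately show ?thesis using DuelWrite0 jj b' m by auto
    qed (use ne in auto)
  qed
  have ncw: "stat \<sigma>' q \<noteq> Active (DuelWrite j b d)" for d using bck[of q b d] l2 by metis
  show ?thesis unfolding leads_def using own l1 2 ncw 34 by simp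
qed

lemma inv_duels_tr:
  assumes tr: "tr s p c \<sigma> \<sigma>'" and inv: "inv_duels \<sigma>"
  shows "inv_duels \<sigma>'"
proof -
  note e0 = splitter_winner_None[OF inv] and wn = duel_winner_None[OF inv]
  have ownm: "owner \<sigma>' j b = owner \<sigma> j b" if "owner \<sigma> j b \<noteq> None" for j b
    using tr
  proof (cases rule: tr.cases)
    case (ReadX_stop i)
    then show ?thesis using that e0[of p i] by (cases b) (auto simp: owner_def)
  next
    case (Duel_win0 b' d)
    then show ?thesis by (auto simp: owner_def)
  next
    case (Duel_win j' b' d)
    then show ?thesis using that wn[of p "Suc j'" b' d] by (cases b) (auto simp: owner_def)
  qed simp_all
  have memC: "mem \<sigma>' (Counter j b) = mem \<sigma> (Counter j b) \<or>
    stat \<sigma> p = Active (DuelWrite j b (mem \<sigma> (Counter j b))) \<and> stat \<sigma>' p = Active (DuelRead j b (Suc (mem \<sigma> (Counter j b)))) \<and>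
    mem \<sigma>' (Counter j b) = Suc (mem \<sigma> (Counter j b))" for j b
    using tr
  proof (cases rule: tr.cases)
    case (DuelWrite0 j' b' d)
    then show ?thesis using inv_duels_mem[OF inv, of p j' b' d] by auto
  qed simp_all
  have stC: "stat \<sigma>' q = stat \<sigma> q" if "q \<noteq> p" for q
    using tr that by (cases rule: tr.cases) simp_all
  have k1: "mem \<sigma>' (Counter j b) = d \<and> owner \<sigma>' j b = Some q"
    if a: "stat \<sigma>' q = Active (DuelRead j b d) \<or> stat \<sigma>' q = Active (DuelWrite j b d)" for q j b d
  proof (cases "q = p")
    case False
    then have "mem \<sigma> (Counter j b) = d" and o: "owner \<sigma> j b = Some q"
      using inv_duels_mem[OF inv, of q j b d] stC a by auto
    moreover have "mem \<sigma>' (Counter j b) = mem \<sigma> (Counter j b)"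
      using memC[of j b] inv_duels_mem[OF inv, of p j b "mem \<sigma> (Counter j b)"] o False by auto
    ultimately show ?thesis using ownm[of j b] by simp
  next
    case True
    show ?thesis using tr
    proof (cases rule: tr.cases)
      case (ReadX_stop i)
      \<comment> \<open>A side without owner has an untouched counter, which matches the local
        counter 0 of the newcomer.\<close>
      have n: "owner \<sigma> i False = None" using ReadX_stop e0[of p i] by (simp add: owner_def)
      then have "mem \<sigma> (Counter i False) = 0" using inv_duels_own[OF inv, of i False] by auto
      then show ?thesis using a True ReadX_stop by (auto simp: owner_def)
    next
      case (Duel_win j' b' d')
      have n: "owner \<sigma> j' True = None" using Duel_win wn[of p "Suc j'" b' d'] by (simp add: owner_def)
      then have "mem \<sigma> (Counter j' True) = 0" using inv_duels_own[OF inv, of j' True] by auto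
      then show ?thesis using a True Duel_win by (auto simp: owner_def)
    next
      case (Duel_cont j' b' d')
      then show ?thesis using a True inv_duels_mem[OF inv, of p j' b' d'] by auto
    next
      case (DuelWrite0 j' b' d')
      then show ?thesis using a True inv_duels_mem[OF inv, of p j' b' d'] by auto
    next
      case (DuelWrite1 j' b' d')
      then show ?thesis using a True inv_duels_mem[OF inv, of p j' b' d'] by auto
    qed (use a True in \<open>auto simp: enter_level_def split: if_splits\<close>)
  qed
  have mono: "mem \<sigma> (Counter j b) \<le> mem \<sigma>' (Counter j b)" for j b using memC[of j b] by auto
  show ?thesis
    unfolding inv_duels_def
    apply (intro conjI)
    subgoal using k1 by blast
    subgoal
    proof (intro allI impI)
      fix q j b d assume a: "stat \<sigma>' q = Active (DuelWrite j b d)"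
      show "d \<le> Suc (mem \<sigma>' (Counter j (\<not> b)))"
      proof (cases "stat \<sigma> q = Active (DuelWrite j b d)")
        case True
        then show ?thesis using inv_duels_DuelWrite[OF inv, of q j b d] mono[of j "\<not> b"] by simp
      next
        case False
        then have "q = p" using stC a by metis
        show ?thesis using tr
          by (cases rule: tr.cases) (use a False \<open>q = p\<close> in \<open>auto simp: enter_level_def split: if_splits\<close>)
      qed
    qed
    subgoal
    proof (intro allI impI)
      fix q j assume w: "duel_winner \<sigma>' j = Some q"
      show "\<exists>b. leads \<sigma>' j q b"
      proof (cases "duel_winner \<sigma> j = Some q")
        case True
        then obtain b where "leads \<sigma> j q b" using inv_duels_duel_winner[OF inv True] by (elim exE)
        from leads_tr[OF tr inv True this] show ?thesis ..
      next
        case False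
        show ?thesis using tr
        proof (cases rule: tr.cases)
          case (Duel_win0 b d)
          then have "leads \<sigma>' j q b" using w False inv_duels_mem[OF inv, of p 0 b d]
            by (cases b) (auto simp: leads_def owner_def split: if_splits)
          then show ?thesis ..
        next
          case (Duel_win j' b d)
          then have "leads \<sigma>' j q b" using w False inv_duels_mem[OF inv, of p "Suc j'" b d]
            by (cases b) (auto simp: leads_def owner_def split: if_splits)
          then show ?thesis ..
        qed (use w False in auto)
      qed
    qed
    subgoal
    proof -
      have "mem \<sigma> (YReg i) = 0 \<Longrightarrow> splitter_winner \<sigma> i = None" for i using inv_duels_splitter_winner[OF inv, of i] by (cases "splitter_winner \<sigma> i") auto
      note y = this
      show ?thesis
        using tr y inv_duels_splitter_winner[OF inv] inv_duels_ST[OF inv] by (cases rule: tr.cases) (auto simp: enter_level_def)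
    qed
    subgoal using tr inv_duels_ST[OF inv] by (cases rule: tr.cases) (auto simp: enter_level_def)
    subgoal
    proof
      fix q
      have "stat \<sigma> p = Active x \<Longrightarrow> duel_winner \<sigma> 0 \<noteq> Some p" for x using inv_duels_Done[OF inv, of p] by auto
      note y = this
      show "stat \<sigma>' q = Done False \<longleftrightarrow> duel_winner \<sigma>' 0 = Some q"
        using tr y inv_duels_Done[OF inv, of q] wn[of p 0] by (cases rule: tr.cases) (auto simp: enter_level_def)
    qed
    subgoal
    proof (intro allI impI)
      fix j b assume a: "mem \<sigma>' (Counter j b) \<noteq> 0"
      show "owner \<sigma>' j b \<noteq> None"
      proof (cases "mem \<sigma> (Counter j b) = 0")
        case True
        then have "stat \<sigma>' p = Active (DuelRead j b (Suc (mem \<sigma> (Counter j b))))" using a memC[of j b] by auto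
        then show ?thesis using k1[of p j b "Suc (mem \<sigma> (Counter j b))"] by simp
      next
        case False
        then show ?thesis using inv_duels_own[OF inv, of j b] ownm[of j b] by simp
      qed
    qed
    done
qed

section \<open>Progress\<close>

definition occurs :: "acfg \<Rightarrow> lstate \<Rightarrow> bool" where
  "occurs \<sigma> x \<longleftrightarrow> (\<exists>q. stat \<sigma> q = Active x)"

lemma tr_stat_other: "tr s p c \<sigma> \<sigma>' \<Longrightarrow> q \<noteq> p \<Longrightarrow> stat \<sigma>' q = stat \<sigma> q"
  by (erule tr.cases; simp)

lemma occurs_tr: "tr s p c \<sigma> \<sigma>' \<Longrightarrow> occurs \<sigma> x \<Longrightarrow> occurs \<sigma>' x \<or> stat \<sigma> p = Active x"
  unfolding occurs_def by (metis tr_stat_other)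

lemma occurs_now: "stat \<sigma> p = Active x \<Longrightarrow> occurs \<sigma> x"
  unfolding occurs_def by blast

text \<open>A relay: whenever a stage of a level has been passed, either some process stands before
  the next stage or that stage has been passed too. Most clauses claim mere existence, because the
  process that carries the hope may change with every step. In the election the hope rests on cells
  whose successor is unmarked, in a duel on a side that is not behind.\<close>

definition inv_progress :: "nat \<Rightarrow> acfg \<Rightarrow> bool" where
  "inv_progress s \<sigma> \<longleftrightarrow>
    (\<forall>i x. mem \<sigma> (GReg i x) \<noteq> 0 \<longrightarrow> x \<le> s) \<and>
    (\<forall>p i. i < levels \<sigma> p \<longrightarrow> i < s \<longrightarrow> stat \<sigma> p = Active (GWrite i) \<or> (\<exists>x. mem \<sigma> (GReg i x) \<noteq> 0)) \<and>
    (\<forall>i x. mem \<sigma> (GReg i x) \<noteq> 0 \<longrightarrow> mem \<sigma> (GReg i (Suc x)) = 0 \<longrightarrow>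
       occurs \<sigma> (GRead i x) \<or> occurs \<sigma> (WriteX i) \<or> mem \<sigma> (XReg i) \<noteq> 0) \<and>
    (\<forall>p i. i < levels \<sigma> p \<longrightarrow> s \<le> i \<longrightarrow> occurs \<sigma> (WriteX i) \<or> mem \<sigma> (XReg i) \<noteq> 0) \<and>
    (\<forall>i. mem \<sigma> (XReg i) \<noteq> 0 \<longrightarrow> occurs \<sigma> (ReadY i) \<or> occurs \<sigma> (WriteY i) \<or> mem \<sigma> (YReg i) \<noteq> 0) \<and>
    (\<forall>i. mem \<sigma> (YReg i) \<noteq> 0 \<longrightarrow> occurs \<sigma> (ReadX i) \<or> splitter_winner \<sigma> i \<noteq> None \<or> (\<exists>p. Suc i < levels \<sigma> p)) \<and>
    (\<forall>p j b. owner \<sigma> j b = Some p \<longrightarrow>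
       (\<exists>d. stat \<sigma> p = Active (DuelRead j b d) \<or> stat \<sigma> p = Active (DuelWrite j b d)) \<or> duel_winner \<sigma> j \<noteq> None \<or>
       mem \<sigma> (Counter j b) < mem \<sigma> (Counter j (\<not> b))) \<and>
    (mem \<sigma> DoneReg \<noteq> 0 \<longrightarrow> (\<exists>p. levels \<sigma> p \<noteq> 0)) \<and>
    (\<forall>p. stat \<sigma> p = Done True \<longrightarrow> mem \<sigma> DoneReg \<noteq> 0)"

lemma inv_progress_D:
  assumes "inv_progress s \<sigma>"
  shows inv_progress_Gs: "\<And>i x. mem \<sigma> (GReg i x) \<noteq> 0 \<Longrightarrow> x \<le> s"
    and inv_progress_G: "\<And>p i. i < levels \<sigma> p \<Longrightarrow> i < s \<Longrightarrow> stat \<sigma> p = Active (GWrite i) \<or> (\<exists>x. mem \<sigma> (GReg i x) \<noteq> 0)"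
    and inv_progress_top: "\<And>i x. mem \<sigma> (GReg i x) \<noteq> 0 \<Longrightarrow> mem \<sigma> (GReg i (Suc x)) = 0 \<Longrightarrow>
       occurs \<sigma> (GRead i x) \<or> occurs \<sigma> (WriteX i) \<or> mem \<sigma> (XReg i) \<noteq> 0"
    and inv_progress_SX: "\<And>p i. i < levels \<sigma> p \<Longrightarrow> s \<le> i \<Longrightarrow> occurs \<sigma> (WriteX i) \<or> mem \<sigma> (XReg i) \<noteq> 0"
    and inv_progress_X: "\<And>i. mem \<sigma> (XReg i) \<noteq> 0 \<Longrightarrow> occurs \<sigma> (ReadY i) \<or> occurs \<sigma> (WriteY i) \<or> mem \<sigma> (YReg i) \<noteq> 0"
    and inv_progress_Y: "\<And>i. mem \<sigma> (YReg i) \<noteq> 0 \<Longrightarrow> occurs \<sigma> (ReadX i) \<or> splitter_winner \<sigma> i \<noteq> None \<or> (\<exists>p. Suc i < levels \<sigma> p)"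
    and inv_progress_own: "\<And>p j b. owner \<sigma> j b = Some p \<Longrightarrow>
       (\<exists>d. stat \<sigma> p = Active (DuelRead j b d) \<or> stat \<sigma> p = Active (DuelWrite j b d)) \<or> duel_winner \<sigma> j \<noteq> None \<or>
       mem \<sigma> (Counter j b) < mem \<sigma> (Counter j (\<not> b))"
    and inv_progress_DoneReg: "mem \<sigma> DoneReg \<noteq> 0 \<Longrightarrow> \<exists>p. levels \<sigma> p \<noteq> 0"
    and inv_progress_Done: "\<And>p. stat \<sigma> p = Done True \<Longrightarrow> mem \<sigma> DoneReg \<noteq> 0"
  using assms unfolding inv_progress_def by (elim conjE; simp only: not_False_eq_True; blast)+

lemma inv_progress_init_cfg: "inv_progress s init_cfg"
  by (auto simp: inv_progress_def init_cfg_def owner_def)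

lemma occurs_Start: "occurs \<sigma> x \<Longrightarrow> stat \<sigma> p = Idle \<Longrightarrow> occurs (\<sigma>\<lparr>stat := (stat \<sigma>)(p := Active Start)\<rparr>) x"
proof -
  assume "occurs \<sigma> x" and p: "stat \<sigma> p = Idle"
  then obtain q where q: "stat \<sigma> q = Active x" unfolding occurs_def by blast
  with p have "q \<noteq> p" by auto
  with q show ?thesis by (intro occurs_now[of _ q]) simp
qed

lemma inv_progress_inv:
  assumes inv: "inv_progress s \<sigma>" and p: "stat \<sigma> p = Idle"
  shows "inv_progress s (\<sigma>\<lparr>stat := (stat \<sigma>)(p := Active Start)\<rparr>)"
proof -
  note s = occurs_Start[OF _ p]
  show ?thesis
    unfolding inv_progress_def
    apply (intro conjI)
    subgoal using inv_progress_Gs[OF inv] by simp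
    subgoal
      apply (intro allI impI)
      subgoal for q i using inv_progress_G[OF inv, of i q] p by (cases "q = p") auto
      done
    subgoal
      apply (intro allI impI)
      subgoal for i x using inv_progress_top[OF inv, of i x] s[of "GRead i x"] s[of "WriteX i"] by auto
      done
    subgoal
      apply (intro allI impI)
      subgoal for q i using inv_progress_SX[OF inv, of i q] s[of "WriteX i"] by auto
      done
    subgoal
      apply (intro allI impI)
      subgoal for i using inv_progress_X[OF inv, of i] s[of "ReadY i"] s[of "WriteY i"] by auto
      done
    subgoal
      apply (intro allI impI)
      subgoal for i using inv_progress_Y[OF inv, of i] s[of "ReadX i"] by auto
      done
    subgoal
      apply (intro allI impI)
      subgoal for q j b using inv_progress_own[OF inv, of j b q] p by (cases "q = p") auto
      done
    subgoal using inv_progress_DoneReg[OF inv] by simp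
    subgoal using inv_progress_Done[OF inv] by auto
    done
qed

lemma inv_progress_tr:
  assumes tr: "tr s p c \<sigma> \<sigma>'" and inv: "inv_progress s \<sigma>" and C: "inv_duels \<sigma>" and B: "inv_levels n s \<sigma>"
  shows "inv_progress s \<sigma>'"
proof -
  note at = occurs_tr[OF tr]
  have C': "inv_duels \<sigma>'" using inv_duels_tr[OF tr C] .
  have lvm: "levels \<sigma> q \<le> levels \<sigma>' q" for q
    using tr by (cases rule: tr.cases) (use inv_levels_lv0[OF B, of p] inv_levels_pre_level[OF B, of p] in auto)
  have gm: "mem \<sigma> (GReg i x) \<noteq> 0 \<Longrightarrow> mem \<sigma>' (GReg i x) \<noteq> 0" for i x
    using tr by (cases rule: tr.cases) auto
  have ym: "mem \<sigma> (YReg i) \<noteq> 0 \<Longrightarrow> mem \<sigma>' (YReg i) \<noteq> 0" for i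
    using tr by (cases rule: tr.cases) auto
  have "stat \<sigma> p \<noteq> Idle" using tr by (cases rule: tr.cases) auto
  then have p: "p \<noteq> 0" using inv_levels_p[OF B, of p] by auto
  have xm: "mem \<sigma> (XReg i) \<noteq> 0 \<Longrightarrow> mem \<sigma>' (XReg i) \<noteq> 0" for i
    using tr p by (cases rule: tr.cases) auto
  have em: "splitter_winner \<sigma> i \<noteq> None \<Longrightarrow> splitter_winner \<sigma>' i \<noteq> None" for i
    using tr by (cases rule: tr.cases) auto
  have wm: "duel_winner \<sigma> i \<noteq> None \<Longrightarrow> duel_winner \<sigma>' i \<noteq> None" for i
    using tr by (cases rule: tr.cases) auto
  have dm: "mem \<sigma> DoneReg \<noteq> 0 \<Longrightarrow> mem \<sigma>' DoneReg \<noteq> 0"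
    using tr by (cases rule: tr.cases) auto
  have sx: "occurs \<sigma>' (WriteX i) \<or> mem \<sigma>' (XReg i) \<noteq> 0" if "occurs \<sigma> (WriteX i) \<or> mem \<sigma> (XReg i) \<noteq> 0" for i
  proof (cases "stat \<sigma> p = Active (WriteX i)")
    case True
    show ?thesis using tr True p by (cases rule: tr.cases) auto
  next
    case False
    then show ?thesis using that at[of "WriteX i"] xm by blast
  qed
  show ?thesis
    unfolding inv_progress_def
    apply (intro conjI allI impI)
    subgoal for i x using tr inv_progress_Gs[OF inv, of i x] by (cases rule: tr.cases) (auto split: if_splits)
    subgoal for q i
    proof -
      assume a: "i < levels \<sigma>' q" "i < s"
      show ?thesis
      proof (cases "i < levels \<sigma> q")
        case True
        show ?thesis
        proof (cases "stat \<sigma> q = Active (GWrite i)")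
          case G: True
          show ?thesis
            by (cases "q = p"; use tr G in \<open>cases rule: tr.cases\<close>) (auto split: if_splits)
        next
          case False
          then show ?thesis using inv_progress_G[OF inv True a(2)] gm by blast
        qed
      next
        case False
        have l0: "levels \<sigma> p = Suc k" if "stat \<sigma> p = Active (ReadX k)" for k using inv_levels_pre_level[OF B that] by simp
        show ?thesis using tr False a l0
          by (cases rule: tr.cases) (auto simp: enter_level_def less_Suc_eq split: if_splits)
      qed
    qed
    subgoal for i x
    proof -
      assume a: "mem \<sigma>' (GReg i x) \<noteq> 0" "mem \<sigma>' (GReg i (Suc x)) = 0"
      show ?thesis
      proof (cases "mem \<sigma> (GReg i x) = 0")
        case True
        have "stat \<sigma>' p = Active (GRead i x)" using tr True a by (cases rule: tr.cases) (auto split: if_splits)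
        then show ?thesis using occurs_now by blast
      next
        case False
        have z: "mem \<sigma> (GReg i (Suc x)) = 0" using gm a by blast
        show ?thesis
        proof (cases "stat \<sigma> p = Active (GRead i x)")
          case True
          have "stat \<sigma>' p = Active (WriteX i)" using tr True z by (cases rule: tr.cases) auto
          then show ?thesis using occurs_now by blast
        next
          case np: False
          then show ?thesis using inv_progress_top[OF inv False z] at[of "GRead i x"] sx by blast
        qed
      qed
    qed
    subgoal for q i
    proof -
      assume a: "i < levels \<sigma>' q" "s \<le> i"
      show ?thesis
      proof (cases "i < levels \<sigma> q")
        case True
        then show ?thesis using inv_progress_SX[OF inv True a(2)] sx by blast
      next
        case False
        have l0: "levels \<sigma> p = Suc k" if "stat \<sigma> p = Active (ReadX k)" for k using inv_levels_pre_level[OF B that] by simp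
        have "stat \<sigma>' p = Active (WriteX i)" using tr False a l0
          by (cases rule: tr.cases) (auto simp: enter_level_def less_Suc_eq split: if_splits)
        then show ?thesis using occurs_now by blast
      qed
    qed
    subgoal for i
    proof -
      assume a: "mem \<sigma>' (XReg i) \<noteq> 0"
      show ?thesis
      proof (cases "mem \<sigma> (XReg i) = 0")
        case True
        have "stat \<sigma>' p = Active (ReadY i)" using tr True a by (cases rule: tr.cases) (auto split: if_splits)
        then show ?thesis using occurs_now by blast
      next
        case False
        consider "stat \<sigma> p = Active (ReadY i)" | "stat \<sigma> p = Active (WriteY i)"
          | "stat \<sigma> p \<noteq> Active (ReadY i)" "stat \<sigma> p \<noteq> Active (WriteY i)" by blast
        then show ?thesis
        proof cases
          case 1
          have "stat \<sigma>' p = Active (WriteY i) \<or> mem \<sigma>' (YReg i) \<noteq> 0" using tr 1 by (cases rule: tr.cases) auto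
          then show ?thesis using occurs_now by blast
        next
          case 2
          have "mem \<sigma>' (YReg i) \<noteq> 0" using tr 2 by (cases rule: tr.cases) auto
          then show ?thesis by blast
        next
          case 3
          then show ?thesis using inv_progress_X[OF inv False] at ym by blast
        qed
      qed
    qed
    subgoal for i
    proof -
      assume a: "mem \<sigma>' (YReg i) \<noteq> 0"
      show ?thesis
      proof (cases "mem \<sigma> (YReg i) = 0")
        case True
        have "stat \<sigma>' p = Active (ReadX i)" using tr True a by (cases rule: tr.cases) (auto split: if_splits)
        then show ?thesis using occurs_now by blast
      next
        case False
        show ?thesis
        proof (cases "stat \<sigma> p = Active (ReadX i)")
          case True
          have "splitter_winner \<sigma>' i \<noteq> None \<or> Suc i < levels \<sigma>' p" using tr True by (cases rule: tr.cases) auto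
          then show ?thesis by blast
        next
          case np: False
          then show ?thesis using inv_progress_Y[OF inv False] at[of "ReadX i"] em lvm by (meson less_le_trans)
        qed
      qed
    qed
    subgoal for q j b
    proof -
      assume a: "owner \<sigma>' j b = Some q"
      show ?thesis
      proof (cases "owner \<sigma> j b = Some q")
        case False
        show ?thesis using tr
          by (cases rule: tr.cases; use a False in \<open>cases b\<close>) (auto simp: owner_def split: if_splits)
      next
        case True
        consider (here) d where "stat \<sigma> q = Active (DuelRead j b d) \<or> stat \<sigma> q = Active (DuelWrite j b d)"
          | (won) "duel_winner \<sigma> j \<noteq> None" | (lost) "mem \<sigma> (Counter j b) < mem \<sigma> (Counter j (\<not> b))"
            "\<And>d. stat \<sigma> q \<noteq> Active (DuelWrite j b d)"
          using inv_progress_own[OF inv True] by blast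
        then show ?thesis
        proof cases
          case won
          then show ?thesis using wm by blast
        next
          case lost
          \<comment> \<open>Only the owner \<open>q\<close> writes this counter, and it has no write
            pending, so a side that is behind stays behind.\<close>
          have "mem \<sigma>' (Counter j b) = mem \<sigma> (Counter j b)"
            using tr
          proof (cases rule: tr.cases)
            case (DuelWrite0 j' b' d)
            then show ?thesis using lost(2)[of d] inv_duels_mem[OF C, of p j' b' d] True by (cases "b = b'") auto
          qed auto
          moreover have "mem \<sigma> (Counter j (\<not> b)) \<le> mem \<sigma>' (Counter j (\<not> b))"
            using tr
          proof (cases rule: tr.cases)
            case (DuelWrite0 j' b' d)
            then show ?thesis using inv_duels_mem[OF C, of p j' b' d] by auto
          qed auto
          ultimately show ?thesis using lost(1) by simp
        next
          case here
          show ?thesis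
          proof (cases "q = p")
            case False
            then show ?thesis using here tr_stat_other[OF tr False] by auto
          next
            case True
            have m: "mem \<sigma> (Counter j b) = d" using inv_duels_mem[OF C here] by simp
            show ?thesis using tr
              by (cases rule: tr.cases) (use here True m in auto)
          qed
        qed
      qed
    qed
    subgoal
    proof -
      assume a: "mem \<sigma>' DoneReg \<noteq> 0"
      have "levels \<sigma> p \<noteq> 0 \<or> mem \<sigma> DoneReg \<noteq> 0"
        using tr a inv_levels_Losing[OF B, of p] by (cases rule: tr.cases) auto
      then show ?thesis using inv_progress_DoneReg[OF inv] lvm by (metis le_zero_eq)
    qed
    subgoal for q
    proof -
      assume a: "stat \<sigma>' q = Done True"
      show ?thesis
      proof (cases "stat \<sigma> q = Done True")
        case True
        then show ?thesis using inv_progress_Done[OF inv] dm by blast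
      next
        case False
        show ?thesis using tr a False by (cases rule: tr.cases) (auto simp: enter_level_def split: if_splits)
      qed
    qed
    done
qed

text \<open>The processes that may be placed first in a linearization. \<open>Start\<close> is
  excluded because such a process may have been invoked after a loser completed.\<close>

definition alive :: "acfg \<Rightarrow> nat \<Rightarrow> bool" where
  "alive \<sigma> w \<longleftrightarrow> stat \<sigma> w = Done False \<or> (\<exists>x. stat \<sigma> w = Active x \<and> x \<noteq> Start \<and> x \<noteq> Losing)"

lemma alive_occurs: "occurs \<sigma> x \<Longrightarrow> x \<noteq> Start \<Longrightarrow> x \<noteq> Losing \<Longrightarrow> \<exists>w. alive \<sigma> w"
  unfolding occurs_def alive_def by blast

text \<open>The two sides of a duel cannot both be behind. Hence an owned duel either still has a
  live participant or is decided, and then its winner owns a side of the next lower duel. The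
  induction ends at duel 0, whose winner has returned \<open>False\<close>.\<close>

lemma alive_chain:
  assumes C: "inv_duels \<sigma>" and D: "inv_progress s \<sigma>" and o: "owner \<sigma> j b \<noteq> None"
  shows "\<exists>w. alive \<sigma> w"
  using o
proof (induction j arbitrary: b)
  case (0 b)
  have A: "(\<exists>w. alive \<sigma> w) \<or> duel_winner \<sigma> 0 \<noteq> None \<or> mem \<sigma> (Counter 0 b) < mem \<sigma> (Counter 0 (\<not> b))" if o: "owner \<sigma> 0 b \<noteq> None" for b
    using o inv_progress_own[OF D, of 0 b] unfolding alive_def by fastforce
  have W: "\<exists>w. alive \<sigma> w" if "duel_winner \<sigma> 0 \<noteq> None"
    using that inv_duels_Done[OF C] unfolding alive_def by blast
  have O: "owner \<sigma> 0 (\<not> b) \<noteq> None" if "mem \<sigma> (Counter 0 b) < mem \<sigma> (Counter 0 (\<not> b))"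
    using inv_duels_own[OF C, of 0 "\<not> b"] that by simp
  show ?case using A[of b] A[of "\<not> b"] W O 0 by auto
next
  case (Suc j b)
  have A: "(\<exists>w. alive \<sigma> w) \<or> duel_winner \<sigma> (Suc j) \<noteq> None \<or> mem \<sigma> (Counter (Suc j) b) < mem \<sigma> (Counter (Suc j) (\<not> b))"
    if o: "owner \<sigma> (Suc j) b \<noteq> None" for b
    using o inv_progress_own[OF D, of "Suc j" b] unfolding alive_def by fastforce
  have W: "\<exists>w. alive \<sigma> w" if "duel_winner \<sigma> (Suc j) \<noteq> None"
    using that Suc.IH[of True] by (simp add: owner_def)
  have O: "owner \<sigma> (Suc j) (\<not> b) \<noteq> None" if "mem \<sigma> (Counter (Suc j) b) < mem \<sigma> (Counter (Suc j) (\<not> b))"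
    using inv_duels_own[OF C, of "Suc j" "\<not> b"] that by simp
  show ?case using A[of b] A[of "\<not> b"] W O Suc.prems by auto
qed

text \<open>Consider the deepest level entered by anyone. Nobody has escaped further, so the relay
  of \<open>inv_progress\<close> must end at that level with a live process or with a splitter
  winner.\<close>

lemma alive_ex:
  assumes B: "inv_levels n s \<sigma>" and C: "inv_duels \<sigma>" and D: "inv_progress s \<sigma>" and p: "levels \<sigma> p \<noteq> 0"
  shows "\<exists>w. alive \<sigma> w"
proof -
  have "\<exists>q. 0 < levels \<sigma> q" using p by blast
  moreover have "\<forall>k. (\<exists>q. k < levels \<sigma> q) \<longrightarrow> k \<le> n"
    using levels_le[OF B] by (meson less_le_trans less_imp_le)
  ultimately have "\<exists>i. (\<exists>q. i < levels \<sigma> q) \<and> (\<forall>k. (\<exists>q. k < levels \<sigma> q) \<longrightarrow> k \<le> i)"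
    by (rule Nat.ex_has_greatest_nat)
  then obtain i q where i: "i < levels \<sigma> q" and mx: "\<And>k q. k < levels \<sigma> q \<Longrightarrow> k \<le> i" by blast
  have "(\<exists>w. alive \<sigma> w) \<or> mem \<sigma> (XReg i) \<noteq> 0"
  proof (cases "i < s")
    case False
    then show ?thesis using inv_progress_SX[OF D i] alive_occurs[of \<sigma> "WriteX i"] by auto
  next
    case True
    consider "stat \<sigma> q = Active (GWrite i)" | x where "mem \<sigma> (GReg i x) \<noteq> 0" using inv_progress_G[OF D i True] by blast
    then show ?thesis
    proof cases
      case 1
      then show ?thesis using alive_occurs[OF occurs_now] by blast
    next
      case (2 x)
      \<comment> \<open>The cap on cell indices guarantees a highest marked cell. Its successor is
        unmarked, so the clause of \<open>inv_progress\<close> about such cells applies.\<close>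
      have "\<exists>y. mem \<sigma> (GReg i y) \<noteq> 0 \<and> (\<forall>z. mem \<sigma> (GReg i z) \<noteq> 0 \<longrightarrow> z \<le> y)"
        using inv_progress_Gs[OF D, of i] 2 by (intro Nat.ex_has_greatest_nat[of "\<lambda>y. mem \<sigma> (GReg i y) \<noteq> 0" x s]) auto
      then obtain y where y: "mem \<sigma> (GReg i y) \<noteq> 0" "mem \<sigma> (GReg i (Suc y)) = 0"
        by (metis not_less_eq_eq order_refl)
      show ?thesis using inv_progress_top[OF D y] alive_occurs[of \<sigma> "WriteX i"] alive_occurs[of \<sigma> "GRead i y"] by auto
    qed
  qed
  moreover have "(\<exists>w. alive \<sigma> w) \<or> mem \<sigma> (YReg i) \<noteq> 0" if "mem \<sigma> (XReg i) \<noteq> 0"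
    using inv_progress_X[OF D that] alive_occurs[of \<sigma> "ReadY i"] alive_occurs[of \<sigma> "WriteY i"] by auto
  moreover have "\<exists>w. alive \<sigma> w" if y: "mem \<sigma> (YReg i) \<noteq> 0"
  proof -
    have "\<not> Suc i < levels \<sigma> r" for r using mx[of "Suc i" r] by auto
    then have "occurs \<sigma> (ReadX i) \<or> owner \<sigma> i False \<noteq> None" using inv_progress_Y[OF D y] by (auto simp: owner_def)
    then show ?thesis using alive_occurs[of \<sigma> "ReadX i"] alive_chain[OF C D] by blast
  qed
  ultimately show ?thesis by blast
qed

section \<open>The implementation and its simulation\<close>

text \<open>Five interleaved blocks; the pairing function keeps all cells with \<open>i, x = O(log n)\<close> below \<open>O(n)\<close>
  and makes the addressing injective on all abstract registers.\<close>

fun addr :: "areg \<Rightarrow> nat" where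
  "addr DoneReg = 0"
| "addr DummyReg = 1"
| "addr (XReg i) = 5 * i + 2"
| "addr (YReg i) = 5 * i + 3"
| "addr (Counter i b) = 5 * i + (if b then 4 else 5)"
| "addr (GReg i x) = 5 * prod_encode (i, x) + 6"

lemma addr_inj: "addr r = addr r' \<Longrightarrow> r = r'"
proof -
  have d: "5 * a + k = 5 * b + l \<longleftrightarrow> a = b \<and> k = l" if "k \<in> {2, 3, 4, 5, 6}" "l \<in> {2, 3, 4, 5, 6}" for a b k l :: nat
    using that by (auto; presburger)
  show "addr r = addr r' \<Longrightarrow> r = r'"
    by (cases r; cases r') (simp_all add: d prod_encode_eq split: if_splits, presburger+)
qed

text \<open>The factor 4 leaves room for the cell index \<open>\<lceil>log 2 L\<rceil> + 2\<close>
  with \<open>L \<le> n\<close> that is chosen in the analysis of the elections.\<close>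

definition lg :: "nat \<Rightarrow> nat" where
  "lg n = (LEAST s. 4 * n \<le> 2 ^ s)"

lemma lg_ge: "4 * n \<le> 2 ^ lg n"
  unfolding lg_def by (rule LeastI_ex) (meson less_exp less_imp_le)

lemma lg_lt: "n \<ge> 1 \<Longrightarrow> 2 ^ lg n < 8 * n"
proof -
  assume n: "n \<ge> 1"
  have "lg n \<noteq> 0" using lg_ge[of n] n by (cases "lg n = 0") auto
  then obtain k where k: "lg n = Suc k" by (cases "lg n") auto
  have "\<not> 4 * n \<le> 2 ^ k" using not_less_Least[of k "\<lambda>s. 4 * n \<le> 2 ^ s"] k unfolding lg_def by simp
  then show ?thesis using k by simp
qed

lemma square_le_pow2: "s * s + s \<le> 4 * 2 ^ s" for s :: nat
proof (induction s)
  case (Suc s)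
  have "2 * s + 2 \<le> 4 * 2 ^ s" using less_exp[of s] by linarith
  then show ?case using Suc by simp
qed simp

text \<open>The pairing code is quadratic in \<open>lg n\<close>, and \<open>square_le_pow2\<close>
  trades this square for a multiple of \<open>2 ^ lg n < 8 * n\<close>. The code is at most
  \<open>64 * n\<close> and its address at most \<open>320 * n + 6\<close>; 400 rounds this
  up.\<close>

lemma addr_GReg_less:
  assumes "n \<ge> 1" "i < lg n" "x \<le> Suc (lg n)"
  shows "addr (GReg i x) < 400 * n"
proof -
  let ?s = "lg n"
  have "(i + x) * Suc (i + x) \<le> (2 * ?s) * Suc (2 * ?s)" using assms by (intro mult_le_mono) auto
  then have "triangle (i + x) \<le> ?s * Suc (2 * ?s)" unfolding triangle_def by simp
  then have "prod_encode (i, x) \<le> 2 * (?s * ?s + ?s)" using assms by (simp add: prod_encode_def algebra_simps)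
  also have "\<dots> \<le> 2 * (4 * 2 ^ ?s)" using square_le_pow2[of ?s] by (intro mult_le_mono) auto
  also have "\<dots> \<le> 2 * (4 * (8 * n))" using lg_lt[OF assms(1)] by simp
  finally show ?thesis using assms(1) by simp
qed

text \<open>The ID is part of the local state because \<open>act\<close> and \<open>upd\<close> are
  not told which process they serve.\<close>

definition encode :: "nat \<Rightarrow> lstate \<Rightarrow> nat list" where
  "encode p x = [p, to_nat x]"

definition decode_pid :: "nat list \<Rightarrow> nat" where "decode_pid l = hd l"
definition decode_state :: "nat list \<Rightarrow> lstate" where "decode_state l = from_nat (hd (tl l))"

lemma dec_encode [simp]: "decode_pid (encode p x) = p" "decode_state (encode p x) = x"
  by (simp_all add: decode_pid_def decode_state_def encode_def)

text \<open>\<open>wf_impl\<close> quantifies over all local states, reachable or not, so addresses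
  out of range are redirected to 0. By \<open>addr_valid\<close> reachable states stay in
  range.\<close>

definition concr_op :: "nat \<Rightarrow> aop \<Rightarrow> op" where
  "concr_op N x = (case x of ARd r \<Rightarrow> Rd (if addr r < N then addr r else 0)
     | AWr r v \<Rightarrow> Wr (if addr r < N then addr r else 0) v)"

definition logstar_tas :: "nat \<Rightarrow> nat list tas_impl" where
  "logstar_tas n = \<lparr>nregs = 400 * n, mem0 = (\<lambda>_. 0), init = (\<lambda>p. encode p Start),
     coin = (\<lambda>_. geometric_pmf (1/2)),
     act = (\<lambda>l c. concr_op (400 * n) (next_op (lg n) (decode_pid l) (decode_state l) c)),
     upd = (\<lambda>l c v. encode (decode_pid l) (next_state (lg n) (decode_pid l) (decode_state l) c v)),
     ret = (\<lambda>l. case decode_state l of Return b \<Rightarrow> Some b | _ \<Rightarrow> None)\<rparr>"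

lemma logstar_tas_simps [simp]:
  "nregs (logstar_tas n) = 400 * n" "mem0 (logstar_tas n) = (\<lambda>_. 0)" "init (logstar_tas n) p = encode p Start"
  "coin (logstar_tas n) l = geometric_pmf (1/2)"
  "act (logstar_tas n) l c = concr_op (400 * n) (next_op (lg n) (decode_pid l) (decode_state l) c)"
  "upd (logstar_tas n) l c v = encode (decode_pid l) (next_state (lg n) (decode_pid l) (decode_state l) c v)"
  "ret (logstar_tas n) l = (case decode_state l of Return b \<Rightarrow> Some b | _ \<Rightarrow> None)"
  by (simp_all add: logstar_tas_def)

lemma wf_logstar_tas: "n \<ge> 1 \<Longrightarrow> wf_impl (logstar_tas n)"
  by (auto simp: wf_impl_def concr_op_def split: aop.splits)

definition concr_stat :: "nat \<Rightarrow> lstate pstat \<Rightarrow> nat list pstat" where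
  "concr_stat p x = (case x of Idle \<Rightarrow> Idle | Active y \<Rightarrow> Active (encode p y) | Done b \<Rightarrow> Done b)"

lemma concr_stat_simps [simp]: "concr_stat p Idle = Idle" "concr_stat p (Active y) = Active (encode p y)" "concr_stat p (Done b) = Done b"
  by (simp_all add: concr_stat_def)

lemma concr_stat_eq [simp]: "concr_stat p x = Idle \<longleftrightarrow> x = Idle" "concr_stat p x = Done b \<longleftrightarrow> x = Done b"
  "is_done (concr_stat p x) \<longleftrightarrow> is_done x"
  by (cases x; auto simp: is_done_def)+

definition simulates :: "acfg \<Rightarrow> nat list cfg \<Rightarrow> bool" where
  "simulates \<sigma> cf \<longleftrightarrow> (\<forall>r. fst cf (addr r) = mem \<sigma> r) \<and> (\<forall>p. snd cf p = concr_stat p (stat \<sigma> p))"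

text \<open>\<open>SOME\<close> turns the relation into a function of the history. In a feasible
  step a successor exists by \<open>tr_ex_invariant\<close>, and any successor will do.\<close>

fun abs_step :: "nat \<Rightarrow> event \<Rightarrow> acfg \<Rightarrow> acfg" where
  "abs_step s (Inv p) \<sigma> = (if stat \<sigma> p = Idle then \<sigma>\<lparr>stat := (stat \<sigma>)(p := Active Start)\<rparr> else \<sigma>)"
| "abs_step s (Stp p c) \<sigma> = (SOME \<sigma>'. tr s p c \<sigma> \<sigma>')"

definition abs_run :: "nat \<Rightarrow> event list \<Rightarrow> acfg" where
  "abs_run s h = fold (abs_step s) h init_cfg"

lemma abs_run_simps [simp]: "abs_run s [] = init_cfg" "abs_run s (h @ [e]) = abs_step s e (abs_run s h)"
  by (simp_all add: abs_run_def)

lemma run_snoc: "run I [] = (mem0 I, \<lambda>_. Idle)" "run I (h @ [e]) = apply_ev I (run I h) e"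
  by (simp_all add: run_def)

lemma feasible_Nil: "feasible I n []"
  by (simp add: feasible_def)

lemma feasible_snoc: "feasible I n (h @ [e]) \<longleftrightarrow> feasible I n h \<and> enabled I n (run I h) e"
proof
  assume a: "feasible I n (h @ [e])"
  have "enabled I n (run I (take i h)) (h ! i)" if "i < length h" for i
    using a[unfolded feasible_def, rule_format, of i] that by (simp add: nth_append)
  moreover have "enabled I n (run I h) e"
    using a[unfolded feasible_def, rule_format, of "length h"] by simp
  ultimately show "feasible I n h \<and> enabled I n (run I h) e" by (simp add: feasible_def)
next
  assume a: "feasible I n h \<and> enabled I n (run I h) e"
  show "feasible I n (h @ [e])" unfolding feasible_def
  proof (intro allI impI)
    fix i assume "i < length (h @ [e])"
    then show "enabled I n (run I (take i (h @ [e]))) ((h @ [e]) ! i)"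
      using a by (cases "i < length h") (auto simp: feasible_def nth_append less_Suc_eq)
  qed
qed

definition invariant :: "nat \<Rightarrow> nat \<Rightarrow> acfg \<Rightarrow> bool" where
  "invariant n s \<sigma> \<longleftrightarrow> inv_levels n s \<sigma> \<and> inv_duels \<sigma> \<and> inv_progress s \<sigma>"

lemma invariant_init_cfg: "invariant n s init_cfg"
  by (simp add: invariant_def inv_levels_init_cfg inv_duels_init_cfg inv_progress_init_cfg)

lemma invariant_inv: "invariant n s \<sigma> \<Longrightarrow> p \<in> {1..n} \<Longrightarrow> stat \<sigma> p = Idle \<Longrightarrow>
  invariant n s (\<sigma>\<lparr>stat := (stat \<sigma>)(p := Active Start)\<rparr>)"
  by (simp add: invariant_def inv_levels_inv inv_duels_inv inv_progress_inv)

lemma invariant_tr: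
  assumes "tr s p c \<sigma> \<sigma>'" "invariant n s \<sigma>"
  shows "invariant n s \<sigma>'"
proof -
  have I: "inv_levels n s \<sigma>" "inv_duels \<sigma>" "inv_progress s \<sigma>" using assms(2) by (simp_all add: invariant_def)
  show ?thesis
    unfolding invariant_def using inv_levels_tr[OF assms(1) I(1)] inv_duels_tr[OF assms(1) I(2)] inv_progress_tr[OF assms(1) I(3,2,1)] by simp
qed

lemma addr_valid:
  assumes B: "inv_levels n (lg n) \<sigma>" and p: "stat \<sigma> p = Active x"
  shows "case next_op (lg n) p x c of ARd r \<Rightarrow> addr r < 400 * n | AWr r v \<Rightarrow> addr r < 400 * n"
proof -
  have n: "n \<ge> 1" using inv_levels_p[OF B, of p] p by auto
  have l: "i < n" if "pre_level x = Some i" for i using inv_levels_pre_level[OF B p that] levels_le[OF B, of p] by simp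
  have l': "j < n" if "chain_port x = Some (j, b)" for j b using inv_levels_chain_port[OF B p that] levels_le[OF B, of p] by simp
  show ?thesis
  proof (cases x)
    case (GWrite i)
    then have "i < lg n" using inv_levels_G[OF B] p by blast
    then show ?thesis using GWrite addr_GReg_less[OF n, of i "min c (lg n)"] by simp
  next
    case (GRead i y)
    then have "i < lg n" "y \<le> lg n" using inv_levels_G[OF B] p by blast+
    then show ?thesis using GRead addr_GReg_less[OF n, of i "Suc y"] by simp
  qed (use n l l' in auto)
qed

lemma tr_ex_invariant:
  assumes "invariant n s \<sigma>" "stat \<sigma> p = Active x"
  shows "tr s p c \<sigma> (abs_step s (Stp p c) \<sigma>)"
proof -
  have "\<exists>\<sigma>'. tr s p c \<sigma> \<sigma>'"
    using assms inv_levels_Return[of n s \<sigma> p] by (intro tr_ex[of \<sigma> p x]) (auto simp: invariant_def)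
  then show ?thesis by (simp add: someI_ex)
qed

lemma simulates_step:
  assumes G: "invariant n (lg n) \<sigma>" and L: "simulates \<sigma> cf" and en: "enabled (logstar_tas n) n cf e"
  shows "simulates (abs_step (lg n) e \<sigma>) (apply_ev (logstar_tas n) cf e) \<and> invariant n (lg n) (abs_step (lg n) e \<sigma>)"
proof -
  obtain m st where cf: "cf = (m, st)" by (cases cf)
  have m: "m (addr r) = mem \<sigma> r" for r using L cf by (simp add: simulates_def)
  have st: "st p = concr_stat p (stat \<sigma> p)" for p using L cf by (simp add: simulates_def)
  show ?thesis
  proof (cases e)
    case (Inv p)
    then have "p \<in> {1..n}" "stat \<sigma> p = Idle" using en cf st by auto
    moreover have "enter (logstar_tas n) (encode p Start) = Active (encode p Start)" by (simp add: enter_def)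
    ultimately show ?thesis using Inv cf m st invariant_inv[OF G] by (auto simp: simulates_def)
  next
    case (Stp p c)
    obtain x where x: "stat \<sigma> p = Active x" using en cf st Stp by (auto simp: concr_stat_def split: pstat.splits)
    define \<sigma>' where "\<sigma>' = abs_step (lg n) e \<sigma>"
    have tr: "tr (lg n) p c \<sigma> \<sigma>'" using tr_ex_invariant[OF G x] Stp by (simp add: \<sigma>'_def)
    have B: "inv_levels n (lg n) \<sigma>" using G by (simp add: invariant_def)
    have v: "case next_op (lg n) p x c of ARd r \<Rightarrow> addr r < 400 * n | AWr r v \<Rightarrow> addr r < 400 * n"
      by (rule addr_valid[OF B x])
    have en: "enter (logstar_tas n) (encode p y) = concr_stat p (case y of Return b \<Rightarrow> Done b | y \<Rightarrow> Active y)" for y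
      by (cases y) (auto simp: enter_def)
    obtain y where y: "stat \<sigma> p = Active y"
      "mem \<sigma>' = (case next_op (lg n) p y c of ARd r \<Rightarrow> mem \<sigma> | AWr r u \<Rightarrow> (mem \<sigma>)(r := u))"
      "stat \<sigma>' = (stat \<sigma>)(p := (case next_state (lg n) p y c (case next_op (lg n) p y c of ARd r \<Rightarrow> mem \<sigma> r | AWr r u \<Rightarrow> 0)
        of Return b \<Rightarrow> Done b | y \<Rightarrow> Active y))"
      by (rule tr_act[OF tr])
    have "y = x" using y(1) x by simp
    note mem' = y(2)[unfolded this] and stat' = y(3)[unfolded this]
    have "simulates \<sigma>' (apply_ev (logstar_tas n) cf e)"
    proof (cases "next_op (lg n) p x c")
      case (ARd r)
      then have "apply_ev (logstar_tas n) cf e = (m, st(p := enter (logstar_tas n) (encode p (next_state (lg n) p x c (mem \<sigma> r)))))"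
        using v x Stp cf st m by (simp add: concr_op_def)
      then show ?thesis using m st ARd by (simp add: simulates_def mem' stat' en)
    next
      case (AWr r u)
      then have "apply_ev (logstar_tas n) cf e = (m(addr r := u), st(p := enter (logstar_tas n) (encode p (next_state (lg n) p x c 0))))"
        using v x Stp cf st m by (simp add: concr_op_def)
      then show ?thesis using m st AWr addr_inj by (auto simp: simulates_def mem' stat' en)
    qed
    then show ?thesis using invariant_tr[OF tr G] by (simp add: \<sigma>'_def)
  qed
qed

lemma feasible_invariant:
  "feasible (logstar_tas n) n h \<Longrightarrow> invariant n (lg n) (abs_run (lg n) h) \<and> simulates (abs_run (lg n) h) (run (logstar_tas n) h)"
proof (induction h rule: rev_induct)
  case Nil
  show ?case by (auto simp: invariant_init_cfg simulates_def run_snoc) (simp_all add: init_cfg_def)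
next
  case (snoc e h)
  then show ?case using simulates_step[of n "abs_run (lg n) h" "run (logstar_tas n) h" e]
    by (simp add: feasible_snoc run_snoc)
qed

section \<open>Linearizability\<close>

definition status :: "nat \<Rightarrow> event list \<Rightarrow> nat \<Rightarrow> lstate pstat" where
  "status n h p = stat (abs_run (lg n) h) p"

lemma snd_run: "feasible (logstar_tas n) n h \<Longrightarrow> snd (run (logstar_tas n) h) p = concr_stat p (status n h p)"
  using feasible_invariant[of n h] by (simp add: simulates_def status_def)

lemma invariant_abs_run: "feasible (logstar_tas n) n h \<Longrightarrow> invariant n (lg n) (abs_run (lg n) h)"
  using feasible_invariant by blast

lemma enabled_snd:
  "enabled I n cf (Inv p) \<longleftrightarrow> p \<in> {1..n} \<and> snd cf p = Idle"
  "enabled I n cf (Stp p c) \<longleftrightarrow> (\<exists>s. snd cf p = Active s \<and> c \<in> set_pmf (coin I s))"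
  by (cases cf; simp)+

lemma feasible_Inv: "feasible (logstar_tas n) n (h @ [Inv p]) \<longleftrightarrow> feasible (logstar_tas n) n h \<and> p \<in> {1..n} \<and> status n h p = Idle"
  by (cases "feasible (logstar_tas n) n h") (simp_all add: feasible_snoc enabled_snd snd_run)

text \<open>\<open>geometric_pmf (1/2)\<close> has full support, so every coin value is
  possible.\<close>

lemma feasible_Stp: "feasible (logstar_tas n) n (h @ [Stp p c]) \<longleftrightarrow> feasible (logstar_tas n) n h \<and> (\<exists>x. status n h p = Active x)"
proof -
  have "c \<in> set_pmf (geometric_pmf (1/2))" by (subst set_pmf_geometric) auto
  then show ?thesis
    by (cases "feasible (logstar_tas n) n h"; cases "status n h p") (simp_all add: feasible_snoc enabled_snd snd_run)
qed

lemma status_Inv: "feasible (logstar_tas n) n (h @ [Inv p]) \<Longrightarrow> status n (h @ [Inv p]) = (status n h)(p := Active Start)"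
  by (rule ext) (simp add: feasible_Inv status_def)

lemma abs_run_Inv: "feasible (logstar_tas n) n (h @ [Inv p]) \<Longrightarrow>
  abs_run (lg n) (h @ [Inv p]) = (abs_run (lg n) h)\<lparr>stat := (stat (abs_run (lg n) h))(p := Active Start)\<rparr>"
  by (simp add: feasible_Inv status_def)

lemma abs_run_Stp: "feasible (logstar_tas n) n (h @ [Stp p c]) \<Longrightarrow> tr (lg n) p c (abs_run (lg n) h) (abs_run (lg n) (h @ [Stp p c]))"
proof -
  assume "feasible (logstar_tas n) n (h @ [Stp p c])"
  then obtain x where "feasible (logstar_tas n) n h" "stat (abs_run (lg n) h) p = Active x"
    by (auto simp: feasible_Stp status_def)
  then show ?thesis unfolding abs_run_simps by (intro tr_ex_invariant[OF invariant_abs_run])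
qed

lemma tr_Done: "tr s p c \<sigma> \<sigma>' \<Longrightarrow> stat \<sigma> q = Done b \<Longrightarrow> stat \<sigma>' q = Done b"
  by (erule tr.cases; cases "q = p"; simp)

lemma status_Done_snoc: "feasible (logstar_tas n) n (h @ [e]) \<Longrightarrow> status n h q = Done b \<Longrightarrow> status n (h @ [e]) q = Done b"
proof (cases e)
  case (Inv p)
  assume "feasible (logstar_tas n) n (h @ [e])" "status n h q = Done b"
  then show ?thesis using Inv status_Inv[of n h p] by (auto simp: feasible_Inv)
next
  case (Stp p c)
  assume "feasible (logstar_tas n) n (h @ [e])" "status n h q = Done b"
  then show ?thesis using Stp tr_Done[OF abs_run_Stp, of n h p c q b] by (simp add: status_def)
qed

lemma precedes_snoc: "precedes I (h @ [e]) a b \<longleftrightarrow> precedes I h a b \<or> (e = Inv b \<and> is_done (snd (run I h) a))"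
proof
  assume "precedes I (h @ [e]) a b"
  then obtain j where j: "j < Suc (length h)" "(h @ [e]) ! j = Inv b" "is_done (snd (run I (take j (h @ [e]))) a)"
    by (auto simp: precedes_def)
  show "precedes I h a b \<or> (e = Inv b \<and> is_done (snd (run I h) a))"
  proof (cases "j = length h")
    case True
    then show ?thesis using j by simp
  next
    case False
    then have "j < length h" using j by simp
    then have "h ! j = Inv b" "is_done (snd (run I (take j h)) a)" using j by (simp_all add: nth_append)
    then show ?thesis using \<open>j < length h\<close> unfolding precedes_def by blast
  qed
next
  assume "precedes I h a b \<or> (e = Inv b \<and> is_done (snd (run I h) a))"
  then show "precedes I (h @ [e]) a b"
  proof
    assume "precedes I h a b"
    then obtain j where "j < length h" "h ! j = Inv b" "is_done (snd (run I (take j h)) a)"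
      unfolding precedes_def by blast
    then show ?thesis unfolding precedes_def by (intro exI[of _ j]) (simp add: nth_append)
  next
    assume "e = Inv b \<and> is_done (snd (run I h) a)"
    then show ?thesis unfolding precedes_def by (intro exI[of _ "length h"]) simp
  qed
qed

lemma invoked: "feasible (logstar_tas n) n h \<Longrightarrow> Inv p \<in> set h \<longleftrightarrow> status n h p \<noteq> Idle"
proof (induction h rule: rev_induct)
  case Nil
  then show ?case by (simp add: status_def init_cfg_def)
next
  case (snoc e h)
  have f: "feasible (logstar_tas n) n h" using snoc.prems feasible_snoc by blast
  show ?case
  proof (cases e)
    case (Inv q)
    then show ?thesis using snoc.IH[OF f] snoc.prems status_Inv[of n h q] by auto
  next
    case (Stp q c)
    have "tr (lg n) q c (abs_run (lg n) h) (abs_run (lg n) (h @ [e]))" using abs_run_Stp snoc.prems Stp by blast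
    then have "status n (h @ [e]) p = Idle \<longleftrightarrow> status n h p = Idle" unfolding status_def by (cases rule: tr.cases) auto
    then show ?thesis using snoc.IH[OF f] Stp by auto
  qed
qed

lemma precedes_Done:
  "feasible (logstar_tas n) n h \<Longrightarrow> precedes (logstar_tas n) h a b \<Longrightarrow> \<exists>r. status n h a = Done r"
proof (induction h rule: rev_induct)
  case Nil
  then show ?case by (simp add: precedes_def)
next
  case (snoc e h)
  have f: "feasible (logstar_tas n) n h" using snoc.prems feasible_snoc by blast
  have "\<exists>r. status n h a = Done r"
    using snoc.prems(2) snoc.IH[OF f] snd_run[OF f, of a] by (auto simp: precedes_snoc is_done_def)
  then show ?case using status_Done_snoc[OF snoc.prems(1)] by blast
qed

lemma precedes_irrefl: "feasible (logstar_tas n) n h \<Longrightarrow> \<not> precedes (logstar_tas n) h a a"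
proof (induction h rule: rev_induct)
  case Nil
  then show ?case by (simp add: precedes_def)
next
  case (snoc e h)
  have f: "feasible (logstar_tas n) n h" using snoc.prems feasible_snoc by blast
  then show ?case using snoc snd_run[OF f, of a] by (auto simp: precedes_snoc is_done_def feasible_Inv)
qed

text \<open>When \<open>w\<close> became alive it read the flag as unset, so no process had returned
  \<open>True\<close> by then. An operation completed even before the invocation of \<open>w\<close>
  can therefore only have returned \<open>False\<close>.\<close>

lemma precedes_alive:
  "feasible (logstar_tas n) n h \<Longrightarrow> alive (abs_run (lg n) h) w \<Longrightarrow> precedes (logstar_tas n) h a w \<Longrightarrow> status n h a = Done False"
proof (induction h rule: rev_induct)
  case Nil
  then show ?case by (simp add: precedes_def)
next
  case (snoc e h)
  have f: "feasible (logstar_tas n) n h" using snoc.prems feasible_snoc by blast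
  show ?case
  proof (cases e)
    case (Inv q)
    have "status n (h @ [e]) = (status n h)(q := Active Start)" using snoc.prems(1) status_Inv Inv by blast
    then have s: "stat (abs_run (lg n) (h @ [e])) = (stat (abs_run (lg n) h))(q := Active Start)"
      unfolding status_def by (simp add: fun_eq_iff)
    then have w: "w \<noteq> q" "alive (abs_run (lg n) h) w" using snoc.prems(2) unfolding alive_def by (auto split: if_splits)
    then have "status n h a = Done False" using snoc.IH[OF f w(2)] snoc.prems(3) Inv by (auto simp: precedes_snoc)
    then show ?thesis using status_Done_snoc[OF snoc.prems(1)] by blast
  next
    case (Stp q c)
    have pr: "precedes (logstar_tas n) h a w" using snoc.prems(3) Stp by (simp add: precedes_snoc)
    have t: "tr (lg n) q c (abs_run (lg n) h) (abs_run (lg n) (h @ [e]))" using abs_run_Stp snoc.prems Stp by blast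
    have "status n h a = Done False"
    proof (cases "alive (abs_run (lg n) h) w")
      case True
      then show ?thesis using snoc.IH[OF f True pr] by simp
    next
      case False
      obtain r where r: "status n h a = Done r" using precedes_Done[OF f pr] by blast
      have "mem (abs_run (lg n) h) DoneReg = 0"
        using t by (cases rule: tr.cases) (use False snoc.prems(2) in \<open>auto simp: alive_def split: if_splits\<close>)
      then show ?thesis using invariant_abs_run[OF f] inv_progress_Done[of "lg n" "abs_run (lg n) h" a] r
        by (cases r) (auto simp: invariant_def status_def)
    qed
    then show ?thesis using status_Done_snoc[OF snoc.prems(1)] by blast
  qed
qed

section \<open>The linearization order\<close>

fun invocations :: "event list \<Rightarrow> nat list" where
  "invocations [] = []"
| "invocations (Inv p # h) = p # invocations h"
| "invocations (Stp p c # h) = invocations h"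

lemma invocations_append: "invocations (h @ h') = invocations h @ invocations h'"
  by (induction h rule: invocations.induct) auto

lemma set_invocations: "set (invocations h) = {p. Inv p \<in> set h}"
  by (induction h rule: invocations.induct) auto

lemma distinct_invocations: "feasible (logstar_tas n) n h \<Longrightarrow> distinct (invocations h)"
proof (induction h rule: rev_induct)
  case (snoc e h)
  have f: "feasible (logstar_tas n) n h" using snoc.prems feasible_snoc by blast
  then show ?case using snoc invoked[OF f] by (cases e) (auto simp: invocations_append set_invocations feasible_Inv)
qed simp

lemma sorted_invocations: "feasible (logstar_tas n) n h \<Longrightarrow> sorted_wrt (\<lambda>x y. \<not> precedes (logstar_tas n) h y x) (invocations h)"
proof (induction h rule: rev_induct)
  case (snoc e h)
  have f: "feasible (logstar_tas n) n h" using snoc.prems feasible_snoc by blast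
  show ?case
  proof (cases e)
    case (Stp q c)
    then show ?thesis using snoc.IH[OF f] by (simp add: invocations_append precedes_snoc)
  next
    case (Inv q)
    have q: "status n h q = Idle" using snoc.prems Inv feasible_Inv by blast
    then have "q \<notin> set (invocations h)" using invoked[OF f] by (simp add: set_invocations)
    moreover have "\<not> precedes (logstar_tas n) h q x" for x using precedes_Done[OF f, of q x] q by auto
    moreover have "sorted_wrt (\<lambda>x y. \<not> precedes (logstar_tas n) (h @ [e]) y x) (invocations h)"
      using \<open>q \<notin> set (invocations h)\<close> by (intro sorted_wrt_mono_rel[OF _ snoc.IH[OF f]]) (auto simp: precedes_snoc Inv)
    ultimately show ?thesis using Inv by (auto simp: invocations_append sorted_wrt_append precedes_snoc)
  qed
qed simp

lemma status_Done_False_unique: "feasible (logstar_tas n) n h \<Longrightarrow> status n h p = Done False \<Longrightarrow> status n h q = Done False \<Longrightarrow> p = q"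
  using invariant_abs_run[of n h] inv_duels_Done[of "abs_run (lg n) h" p] inv_duels_Done[of "abs_run (lg n) h" q]
  by (simp add: invariant_def status_def)

theorem correct_logstar_tas: "correct_tas (logstar_tas n) n"
  unfolding correct_tas_def
proof (intro allI impI)
  fix h assume f: "feasible (logstar_tas n) n h"
  have st: "snd (run (logstar_tas n) h) p = concr_stat p (status n h p)" for p by (rule snd_run[OF f])
  show "linearizable (logstar_tas n) h"
  proof (cases "\<exists>p b. status n h p = Done b")
    case False
    then show ?thesis unfolding linearizable_def by (intro exI[of _ "[]"]) (auto simp: st)
  next
    case True
    have g: "inv_levels n (lg n) (abs_run (lg n) h)" "inv_duels (abs_run (lg n) h)" "inv_progress (lg n) (abs_run (lg n) h)"
      using invariant_abs_run[OF f] by (simp_all add: invariant_def)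
    \<comment> \<open>The process to be placed first: the winner if it has returned, otherwise any
      live process. One exists because a loser has set the flag, which proves that some process
      entered level 0.\<close>
    obtain w where w: "alive (abs_run (lg n) h) w" and wF: "\<And>p. status n h p = Done False \<Longrightarrow> p = w"
    proof (cases "\<exists>p. status n h p = Done False")
      case True
      then obtain p where "status n h p = Done False" by blast
      then have "alive (abs_run (lg n) h) p" by (simp add: alive_def status_def)
      then show ?thesis using that[of p] status_Done_False_unique[OF f _ \<open>status n h p = Done False\<close>] by simp
    next
      case noF: False
      obtain p b where "status n h p = Done b" using True by blast
      with noF have "status n h p = Done True" by (cases b) auto
      then have "mem (abs_run (lg n) h) DoneReg \<noteq> 0" using inv_progress_Done[OF g(3)] by (simp add: status_def)
      then obtain q where q: "levels (abs_run (lg n) h) q \<noteq> 0" using inv_progress_DoneReg[OF g(3)] by blast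
      obtain w where "alive (abs_run (lg n) h) w" using alive_ex[OF g q] by (elim exE)
      from that[OF this] show ?thesis using noF by simp
    qed
    have wI: "Inv w \<in> set h" using invoked[OF f, of w] w by (auto simp: alive_def status_def)
    \<comment> \<open>The other completed operations follow in invocation order, and pending ones
      are dropped. A real-time predecessor is invoked earlier, so only the position of
      \<open>w\<close> at the front needs an argument.\<close>
    define L where "L = w # filter (\<lambda>p. p \<noteq> w \<and> (\<exists>b. status n h p = Done b)) (invocations h)"
    have pw: "\<not> precedes (logstar_tas n) h p w" for p
    proof
      assume a: "precedes (logstar_tas n) h p w"
      then have "p = w" by (intro wF precedes_alive[OF f w])
      then show False using a precedes_irrefl[OF f] by simp
    qed
    have so: "sorted_wrt (\<lambda>x y. \<not> precedes (logstar_tas n) h y x) L"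
      unfolding L_def using pw sorted_invocations[OF f] by (simp add: sorted_wrt_filter)
    have "i < j" if "i < length L" "j < length L" "precedes (logstar_tas n) h (L ! i) (L ! j)" for i j
    proof (rule ccontr)
      assume "\<not> i < j"
      then have "j < i \<or> i = j" by auto
      then show False
        using sorted_wrt_nth_less[OF so, of j i] that precedes_irrefl[OF f] by auto
    qed
    moreover have "p \<in> set L \<and> b = (hd L \<noteq> p)" if "snd (run (logstar_tas n) h) p = Done b" for p b
    proof -
      have p: "status n h p = Done b" using that st by simp
      then have "p \<in> set (invocations h)" using invoked[OF f, of p] by (simp add: set_invocations)
      moreover have "b = False" if "p = w" using w p that by (auto simp: alive_def status_def)
      moreover have "b = True" if "p \<noteq> w" using wF[of p] p that by (cases b) auto
      ultimately show ?thesis using p by (auto simp: L_def)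
    qed
    moreover have "distinct L" using distinct_invocations[OF f] by (simp add: L_def)
    moreover have "\<forall>p\<in>set L. Inv p \<in> set h" using wI by (auto simp: L_def set_invocations)
    ultimately show ?thesis unfolding linearizable_def by (intro exI[of _ L]) simp
  qed
qed

section \<open>Deferring the coin flips\<close>

definition coin_pmf :: "nat pmf" where "coin_pmf = geometric_pmf (1/2)"

lemma kind_concr_op: "kind (concr_op N (next_op s p x c)) = kind (concr_op N (next_op s p x 0))"
  by (cases x) (simp_all add: concr_op_def)

text \<open>Here the restriction of the adversary takes effect: in each local state the kind of the
  operation and the written value are the same for all coins, so the view reveals nothing about
  pending ones.\<close>

lemma adv_view_logstar_tas: "adv_view (logstar_tas n) h f = adv_view (logstar_tas n) h (\<lambda>_. 0)"
  unfolding adv_view_def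
proof (intro arg_cong[of _ _ "Pair h"] ext)
  fix p
  show "(case snd (run (logstar_tas n) h) p of Active s \<Rightarrow> Some (kind (act (logstar_tas n) s (f p))) | _ \<Rightarrow> None) =
    (case snd (run (logstar_tas n) h) p of Active s \<Rightarrow> Some (kind (act (logstar_tas n) s 0)) | _ \<Rightarrow> None)"
  proof (cases "snd (run (logstar_tas n) h) p")
    case (Active l)
    then show ?thesis using kind_concr_op[of "400 * n" "lg n" "decode_pid l" "decode_state l" "f p"] by simp
  qed simp_all
qed

definition lazy_step :: "nat \<Rightarrow> nat \<Rightarrow> adversary \<Rightarrow> event list \<Rightarrow> event list pmf" where
  "lazy_step n k A h = (let p = A (adv_view (logstar_tas n) h (\<lambda>_. 0)) in
     if p \<in> {1..n} \<and> status n h p = Idle \<and> card {q. Inv q \<in> set h} < k then return_pmf (h @ [Inv p])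
     else (case status n h p of Active x \<Rightarrow> map_pmf (\<lambda>c. h @ [Stp p c]) coin_pmf | _ \<Rightarrow> return_pmf h))"

definition lazy_exec :: "nat \<Rightarrow> nat \<Rightarrow> adversary \<Rightarrow> nat \<Rightarrow> event list pmf" where
  "lazy_exec n k A t = ((\<lambda>P. bind_pmf P (lazy_step n k A)) ^^ t) (return_pmf [])"

lemma lazy_exec_simps: "lazy_exec n k A 0 = return_pmf []" "lazy_exec n k A (Suc t) = bind_pmf (lazy_exec n k A t) (lazy_step n k A)"
  by (simp_all add: lazy_exec_def)

lemma lazy_step_cases:
  assumes f: "feasible (logstar_tas n) n h"
  obtains (inv) p where "feasible (logstar_tas n) n (h @ [Inv p])" "lazy_step n k A h = return_pmf (h @ [Inv p])"
      "card {q. Inv q \<in> set h} < k"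
    | (stp) p x where "status n h p = Active x" "lazy_step n k A h = map_pmf (\<lambda>c. h @ [Stp p c]) coin_pmf"
    | (stop) "lazy_step n k A h = return_pmf h"
proof -
  define p where "p = A (adv_view (logstar_tas n) h (\<lambda>_. 0))"
  show ?thesis
  proof (cases "p \<in> {1..n} \<and> status n h p = Idle \<and> card {q. Inv q \<in> set h} < k")
    case True
    then show ?thesis using f by (intro inv[of p]) (auto simp: lazy_step_def p_def Let_def feasible_Inv)
  next
    case False
    then have e: "lazy_step n k A h = (case status n h p of Active x \<Rightarrow> map_pmf (\<lambda>c. h @ [Stp p c]) coin_pmf | _ \<Rightarrow> return_pmf h)"
      unfolding lazy_step_def Let_def p_def[symmetric] by auto
    show ?thesis
    proof (cases "status n h p")
      case (Active x)
      then show ?thesis using e by (intro stp[of p x]) simp_all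
    qed (use e in \<open>auto intro: stop\<close>)
  qed
qed

lemma lazy_exec_feasible:
  "h \<in> set_pmf (lazy_exec n k A t) \<Longrightarrow> feasible (logstar_tas n) n h \<and> card {q. Inv q \<in> set h} \<le> k"
proof (induction t arbitrary: h)
  case 0
  then show ?case by (simp add: lazy_exec_simps feasible_Nil)
next
  case (Suc t)
  then obtain g where g: "g \<in> set_pmf (lazy_exec n k A t)" "h \<in> set_pmf (lazy_step n k A g)"
    by (auto simp: lazy_exec_simps)
  have fg: "feasible (logstar_tas n) n g" "card {q. Inv q \<in> set g} \<le> k" using Suc.IH[OF g(1)] by simp_all
  show ?case using fg(1)
  proof (cases rule: lazy_step_cases[of n g k A])
    case (inv p)
    have "{q. Inv q \<in> set (g @ [Inv p])} = insert p {q. Inv q \<in> set g}" by auto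
    moreover have "finite {q. Inv q \<in> set g}" by (simp flip: set_invocations)
    ultimately show ?thesis using g(2) inv by (auto simp: card_insert_if)
  next
    case (stp p x)
    then show ?thesis using g(2) fg by (auto simp: feasible_Stp)
  next
    case stop
    then show ?thesis using g(2) fg by simp
  qed
qed

section \<open>The law of the pending coins given the history\<close>

definition last_coin :: "event list \<Rightarrow> nat \<Rightarrow> nat" where
  "last_coin h p = fold (\<lambda>e z. case e of Stp q c \<Rightarrow> if q = p then c else z | Inv q \<Rightarrow> z) h 0"

lemma last_coin_simps [simp]: "last_coin [] p = 0" "last_coin (h @ [Inv q]) p = last_coin h p"
  "last_coin (h @ [Stp q c]) p = (if q = p then c else last_coin h p)"
  by (simp_all add: last_coin_def)

text \<open>The conditional law of one pending coin. \<open>draw\<close> leaves the entry of a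
  process alone once it has returned, so there the last used coin stays in place; before the first
  step this is the initial entry 0.\<close>

definition pending_coin :: "nat \<Rightarrow> event list \<Rightarrow> nat \<Rightarrow> nat pmf" where
  "pending_coin n h p = (case status n h p of Active x \<Rightarrow> coin_pmf | _ \<Rightarrow> return_pmf (last_coin h p))"

definition pending_coins :: "nat \<Rightarrow> event list \<Rightarrow> (nat \<Rightarrow> nat) pmf" where
  "pending_coins n h = Pi_pmf {1..n} 0 (pending_coin n h)"

lemma Pi_pmf_split:
  assumes "finite A" "p \<in> A"
  shows "Pi_pmf A d D = bind_pmf (D p) (\<lambda>y. map_pmf (\<lambda>f. f(p := y)) (Pi_pmf (A - {p}) d D))"
  using Pi_pmf_insert'[of "A - {p}" p d D] assms by (simp add: insert_absorb map_pmf_def)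

lemma Pi_pmf_resample:
  assumes "finite A" "p \<in> A" "\<And>q. q \<in> A \<Longrightarrow> q \<noteq> p \<Longrightarrow> D' q = D q"
  shows "Pi_pmf A d D' = bind_pmf (Pi_pmf A d D) (\<lambda>f. map_pmf (\<lambda>c. f(p := c)) (D' p))"
proof -
  have e: "Pi_pmf (A - {p}) d D' = Pi_pmf (A - {p}) d D" using assms(3) by (intro Pi_pmf_cong) auto
  have u: "fun_upd (f(p := x)) p = fun_upd f p" for f :: "'a \<Rightarrow> 'b" and x by (rule ext) simp
  have "bind_pmf (Pi_pmf A d D) (\<lambda>f. map_pmf (\<lambda>c. f(p := c)) (D' p)) =
    bind_pmf (D p) (\<lambda>y. bind_pmf (Pi_pmf (A - {p}) d D) (\<lambda>f. map_pmf (\<lambda>c. f(p := c)) (D' p)))"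
    unfolding Pi_pmf_split[OF assms(1,2), of d D] by (simp add: bind_assoc_pmf bind_map_pmf u)
  also have "\<dots> = bind_pmf (Pi_pmf (A - {p}) d D) (\<lambda>f. map_pmf (\<lambda>c. f(p := c)) (D' p))" by simp
  also have "\<dots> = bind_pmf (D' p) (\<lambda>y. map_pmf (\<lambda>f. f(p := y)) (Pi_pmf (A - {p}) d D))"
    unfolding map_pmf_def by (rule bind_commute_pmf)
  finally show ?thesis unfolding Pi_pmf_split[OF assms(1,2), of d D'] e by simp
qed

lemma draw_logstar_tas:
  assumes "feasible (logstar_tas n) n h"
  shows "draw (logstar_tas n) h f p =
    (case status n h p of Active x \<Rightarrow> map_pmf (\<lambda>c. (h, f(p := c))) coin_pmf | _ \<Rightarrow> return_pmf (h, f))"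
  unfolding draw_def snd_run[OF assms] by (cases "status n h p") (simp_all add: coin_pmf_def)

lemma status_other: "feasible (logstar_tas n) n (h @ [Stp p c]) \<Longrightarrow> q \<noteq> p \<Longrightarrow> status n (h @ [Stp p c]) q = status n h q"
  using tr_stat_other[OF abs_run_Stp] by (simp add: status_def del: abs_run_simps)

text \<open>Given the history, the pending coins form a product law. The scheduled process reveals
  one coordinate, which can pass for a coin flipped now, and receives a fresh one if it is still
  active; the remaining coordinates keep their law.\<close>

lemma step_lazy:
  assumes f: "feasible (logstar_tas n) n h"
  shows "bind_pmf (pending_coins n h) (\<lambda>g. step_pmf (logstar_tas n) n k A (h, g)) =
    bind_pmf (lazy_step n k A h) (\<lambda>h'. map_pmf (Pair h') (pending_coins n h'))"
proof -
  define p where "p = A (adv_view (logstar_tas n) h (\<lambda>_. 0))"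
  have st: "snd (run (logstar_tas n) h) q = concr_stat q (status n h q)" for q by (rule snd_run[OF f])
  have step: "step_pmf (logstar_tas n) n k A (h, g) =
      (if p \<in> {1..n} \<and> status n h p = Idle \<and> card {q. Inv q \<in> set h} < k
      then draw (logstar_tas n) (h @ [Inv p]) g p
      else (case status n h p of Active s \<Rightarrow> draw (logstar_tas n) (h @ [Stp p (g p)]) g p | _ \<Rightarrow> return_pmf (h, g)))" for g
    unfolding step_pmf_def Let_def fst_conv snd_conv adv_view_logstar_tas[of n h g] p_def[symmetric] st
    by (cases "status n h p") simp_all
  have ls: "lazy_step n k A h = (if p \<in> {1..n} \<and> status n h p = Idle \<and> card {q. Inv q \<in> set h} < k then return_pmf (h @ [Inv p])
     else (case status n h p of Active x \<Rightarrow> map_pmf (\<lambda>c. h @ [Stp p c]) coin_pmf | _ \<Rightarrow> return_pmf h))"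
    unfolding lazy_step_def Let_def p_def[symmetric] by simp
  show ?thesis
  proof (cases "p \<in> {1..n} \<and> status n h p = Idle \<and> card {q. Inv q \<in> set h} < k")
    case True
    let ?h = "h @ [Inv p]"
    have f': "feasible (logstar_tas n) n ?h" using True f by (simp add: feasible_Inv)
    have status': "status n ?h = (status n h)(p := Active Start)" by (rule status_Inv[OF f'])
    have "pending_coins n ?h = bind_pmf (pending_coins n h) (\<lambda>g. map_pmf (\<lambda>c. g(p := c)) (pending_coin n ?h p))"
      unfolding pending_coins_def using True by (intro Pi_pmf_resample) (auto simp: pending_coin_def status' split: pstat.splits)
    moreover have "pending_coin n ?h p = coin_pmf" by (simp add: pending_coin_def status')
    ultimately have P: "map_pmf (Pair ?h) (pending_coins n ?h) = bind_pmf (pending_coins n h) (\<lambda>g. map_pmf (\<lambda>c. (?h, g(p := c))) coin_pmf)"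
      by (simp add: map_bind_pmf pmf.map_comp o_def)
    have "step_pmf (logstar_tas n) n k A (h, g) = map_pmf (\<lambda>c. (?h, g(p := c))) coin_pmf" for g
      unfolding step draw_logstar_tas[OF f'] using True by (simp add: status')
    then show ?thesis using True P ls by (simp add: bind_return_pmf)
  next
    case nInv: False
    show ?thesis
    proof (cases "status n h p")
      case (Active x)
      have p1: "p \<in> {1..n}"
        using inv_levels_p[of n "lg n" "abs_run (lg n) h" p] invariant_abs_run[OF f] Active by (simp add: invariant_def status_def)
      have f': "feasible (logstar_tas n) n (h @ [Stp p c])" for c using Active f by (simp add: feasible_Stp)
      let ?R = "Pi_pmf ({1..n} - {p}) 0 (pending_coin n h)"
      have pe: "pending_coins n h = bind_pmf coin_pmf (\<lambda>c. map_pmf (\<lambda>g. g(p := c)) ?R)"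
        unfolding pending_coins_def using p1 Active by (subst Pi_pmf_split[of _ p]) (auto simp: pending_coin_def)
      have D': "pending_coin n (h @ [Stp p c]) q = pending_coin n h q" if "q \<noteq> p" for q c
        unfolding pending_coin_def using status_other[OF f' that] that by (simp split: pstat.splits)
      have R': "Pi_pmf ({1..n} - {p}) 0 (pending_coin n (h @ [Stp p c])) = ?R" for c
        by (intro Pi_pmf_cong) (auto simp: D')
      have pe': "pending_coins n (h @ [Stp p c]) =
        bind_pmf (pending_coin n (h @ [Stp p c]) p) (\<lambda>y. map_pmf (\<lambda>g. g(p := y)) ?R)" for c
        using Pi_pmf_split[OF finite_atLeastAtMost p1, of 0 "pending_coin n (h @ [Stp p c])"] unfolding pending_coins_def R' .
      have main: "bind_pmf ?R (\<lambda>g. draw (logstar_tas n) (h @ [Stp p c]) (g(p := c)) p) =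
          map_pmf (Pair (h @ [Stp p c])) (pending_coins n (h @ [Stp p c]))" for c
      proof (cases "status n (h @ [Stp p c]) p")
        case (Active y)
        have "bind_pmf ?R (\<lambda>g. draw (logstar_tas n) (h @ [Stp p c]) (g(p := c)) p) =
          bind_pmf ?R (\<lambda>g. bind_pmf coin_pmf (\<lambda>c'. return_pmf (h @ [Stp p c], g(p := c'))))"
          unfolding draw_logstar_tas[OF f'] using Active by (simp add: map_pmf_def)
        also have "\<dots> = bind_pmf coin_pmf (\<lambda>c'. bind_pmf ?R (\<lambda>g. return_pmf (h @ [Stp p c], g(p := c'))))"
          by (rule bind_commute_pmf)
        also have "\<dots> = map_pmf (Pair (h @ [Stp p c])) (pending_coins n (h @ [Stp p c]))"
          unfolding pe' using Active by (simp add: pending_coin_def map_bind_pmf map_pmf_def bind_assoc_pmf bind_return_pmf)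
        finally show ?thesis .
      next
        case Idle
        then show ?thesis unfolding pe' draw_logstar_tas[OF f']
          by (simp add: pending_coin_def map_pmf_def bind_assoc_pmf bind_return_pmf)
      next
        case (Done b)
        then show ?thesis unfolding pe' draw_logstar_tas[OF f']
          by (simp add: pending_coin_def map_pmf_def bind_assoc_pmf bind_return_pmf)
      qed
      have "bind_pmf (pending_coins n h) (\<lambda>g. step_pmf (logstar_tas n) n k A (h, g)) =
        bind_pmf (pending_coins n h) (\<lambda>g. draw (logstar_tas n) (h @ [Stp p (g p)]) g p)"
        unfolding step using nInv Active by simp
      also have "\<dots> = bind_pmf coin_pmf (\<lambda>c. bind_pmf ?R (\<lambda>g. draw (logstar_tas n) (h @ [Stp p c]) (g(p := c)) p))"
        unfolding pe by (simp add: bind_assoc_pmf bind_map_pmf)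
      also have "\<dots> = bind_pmf coin_pmf (\<lambda>c. map_pmf (Pair (h @ [Stp p c])) (pending_coins n (h @ [Stp p c])))"
        unfolding main ..
      also have "\<dots> = bind_pmf (lazy_step n k A h) (\<lambda>h'. map_pmf (Pair h') (pending_coins n h'))"
        using nInv Active ls by (simp add: bind_map_pmf)
      finally show ?thesis .
    next
      case Idle
      then show ?thesis unfolding step ls if_not_P[OF nInv] by (simp add: map_pmf_def bind_return_pmf)
    next
      case (Done b)
      then show ?thesis unfolding step ls if_not_P[OF nInv] by (simp add: map_pmf_def bind_return_pmf)
    qed
  qed
qed

lemma exec_lazy:
  "exec_pmf (logstar_tas n) n k A t = bind_pmf (lazy_exec n k A t) (\<lambda>h. map_pmf (Pair h) (pending_coins n h))"
proof (induction t)
  case 0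
  have "pending_coin n [] = (\<lambda>_. return_pmf 0)" by (rule ext) (simp add: pending_coin_def status_def init_cfg_def)
  then have "pending_coins n [] = return_pmf (\<lambda>_. 0)" by (simp add: pending_coins_def)
  then show ?case by (simp add: exec_pmf_def lazy_exec_simps bind_return_pmf)
next
  case (Suc t)
  have "exec_pmf (logstar_tas n) n k A (Suc t) = bind_pmf (exec_pmf (logstar_tas n) n k A t) (step_pmf (logstar_tas n) n k A)"
    by (simp add: exec_pmf_def)
  also have "\<dots> = bind_pmf (lazy_exec n k A t) (\<lambda>h. bind_pmf (pending_coins n h) (\<lambda>g. step_pmf (logstar_tas n) n k A (h, g)))"
    unfolding Suc by (simp add: bind_assoc_pmf bind_map_pmf)
  also have "\<dots> = bind_pmf (lazy_exec n k A t) (\<lambda>h. bind_pmf (lazy_step n k A h) (\<lambda>h'. map_pmf (Pair h') (pending_coins n h')))"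
    by (intro bind_pmf_cong refl step_lazy) (use lazy_exec_feasible in blast)
  also have "\<dots> = bind_pmf (lazy_exec n k A (Suc t)) (\<lambda>h. map_pmf (Pair h) (pending_coins n h))"
    by (simp add: lazy_exec_simps bind_assoc_pmf)
  finally show ?case .
qed

lemma exec_fst: "map_pmf fst (exec_pmf (logstar_tas n) n k A t) = lazy_exec n k A t"
  unfolding exec_lazy by (simp add: map_bind_pmf pmf.map_comp o_def map_pmf_const bind_return_pmf')

lemma nn_integral_exec:
  "(\<integral>\<^sup>+ x. f (fst x) \<partial>measure_pmf (exec_pmf (logstar_tas n) n k A t)) = (\<integral>\<^sup>+ h. f h \<partial>measure_pmf (lazy_exec n k A t))"
  by (simp flip: exec_fst)

text \<open>The inequality \<open>E F' - F \<le> E G' - G\<close> per step, written without subtraction for \<open>ennreal\<close>.\<close>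

lemma drift:
  fixes F G :: "event list \<Rightarrow> ennreal"
  assumes Inv: "\<And>h p. feasible (logstar_tas n) n (h @ [Inv p]) \<Longrightarrow> F (h @ [Inv p]) + G h \<le> F h + G (h @ [Inv p])"
    and Stp: "\<And>h p x. feasible (logstar_tas n) n h \<Longrightarrow> status n h p = Active x \<Longrightarrow>
      (\<integral>\<^sup>+ c. F (h @ [Stp p c]) \<partial>measure_pmf coin_pmf) + G h \<le> F h + (\<integral>\<^sup>+ c. G (h @ [Stp p c]) \<partial>measure_pmf coin_pmf)"
    and fin: "\<And>h. feasible (logstar_tas n) n h \<Longrightarrow> G h \<le> ennreal K"
  shows "(\<integral>\<^sup>+ h. F h \<partial>measure_pmf (lazy_exec n k A t)) \<le> F [] + (\<integral>\<^sup>+ h. G h \<partial>measure_pmf (lazy_exec n k A t))"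
proof (induction t)
  case 0
  then show ?case by (simp add: lazy_exec_simps)
next
  case (Suc t)
  let ?E = "\<lambda>H. \<integral>\<^sup>+ h. H h \<partial>measure_pmf (lazy_exec n k A t)"
  let ?L = "\<lambda>H h. \<integral>\<^sup>+ h'. H h' \<partial>measure_pmf (lazy_step n k A h)"
  have Suc': "(\<integral>\<^sup>+ h. H h \<partial>measure_pmf (lazy_exec n k A (Suc t))) = ?E (?L H)" for H :: "event list \<Rightarrow> ennreal"
    by (simp add: lazy_exec_simps)
  have step: "?L F h + G h \<le> F h + ?L G h" if f: "feasible (logstar_tas n) n h" for h
    using f
  proof (cases rule: lazy_step_cases[of n h k A])
    case (inv p)
    then show ?thesis using Inv[of h p] by simp
  next
    case (stp p x)
    then show ?thesis using Stp[OF f, of p x] by simp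
  next
    case stop
    then show ?thesis by simp
  qed
  \<comment> \<open>The expectation of \<open>G\<close> is cancelled on both sides below, which in
    \<open>ennreal\<close> requires it to be finite; this is the purpose of the bound
    \<open>K\<close>.\<close>
  have Gfin: "?E G \<noteq> \<infinity>"
  proof -
    have "?E G \<le> ?E (\<lambda>_. ennreal K)"
      by (intro nn_integral_mono_AE) (use lazy_exec_feasible fin in \<open>auto simp: AE_measure_pmf_iff\<close>)
    also have "\<dots> = ennreal K" by simp
    finally show ?thesis by (auto simp: top_unique)
  qed
  have "?E (?L F) + ?E G = ?E (\<lambda>h. ?L F h + G h)" by (simp add: nn_integral_add)
  also have "\<dots> \<le> ?E (\<lambda>h. F h + ?L G h)"
    by (intro nn_integral_mono_AE) (use lazy_exec_feasible step in \<open>auto simp: AE_measure_pmf_iff\<close>)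
  also have "\<dots> = ?E F + ?E (?L G)" by (simp add: nn_integral_add)
  also have "\<dots> \<le> (F [] + ?E G) + ?E (?L G)" using Suc by (intro add_mono) auto
  finally have "?E G + ?E (?L F) \<le> ?E G + (F [] + ?E (?L G))" by (simp add: ac_simps)
  then have "?E (?L F) \<le> F [] + ?E (?L G)" using Gfin by (simp add: ennreal_add_left_cancel_le)
  then show ?case by (simp add: Suc')
qed

section \<open>Step counting\<close>

text \<open>Ensures that a duel at a level nobody has reached is untouched, so that its potential
  has the initial value when the level is first reached.\<close>

definition inv_owners :: "acfg \<Rightarrow> bool" where
  "inv_owners \<sigma> \<longleftrightarrow> (\<forall>i q. (splitter_winner \<sigma> i = Some q \<longrightarrow> i < levels \<sigma> q) \<and> (duel_winner \<sigma> i = Some q \<longrightarrow> i < levels \<sigma> q))"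

lemma levels_mono: "tr s p c \<sigma> \<sigma>' \<Longrightarrow> inv_levels n s \<sigma> \<Longrightarrow> levels \<sigma> q \<le> levels \<sigma>' q"
  by (erule tr.cases; use inv_levels_lv0[of n s \<sigma> p] inv_levels_pre_level[of n s \<sigma> p] in auto)

lemma inv_owners_tr:
  assumes tr: "tr s p c \<sigma> \<sigma>'" and B: "inv_levels n s \<sigma>" and E: "inv_owners \<sigma>"
  shows "inv_owners \<sigma>'"
proof -
  have "splitter_winner \<sigma>' i = Some q \<Longrightarrow> splitter_winner \<sigma> i = Some q \<or> i < levels \<sigma> q" for i q
    using tr by (cases rule: tr.cases) (use inv_levels_pre_level[OF B, of p "ReadX i" i] in \<open>auto split: if_splits\<close>)
  moreover have "duel_winner \<sigma>' i = Some q \<Longrightarrow> duel_winner \<sigma> i = Some q \<or> i < levels \<sigma> q" for i q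
    using tr
  proof (cases rule: tr.cases)
    case (Duel_win0 b d)
    then show "duel_winner \<sigma>' i = Some q \<Longrightarrow> ?thesis"
      using inv_levels_chain_port[OF B, of p "DuelRead 0 b d" 0 b] by (auto split: if_splits)
  next
    case (Duel_win j b d)
    then show "duel_winner \<sigma>' i = Some q \<Longrightarrow> ?thesis"
      using inv_levels_chain_port[OF B, of p "DuelRead (Suc j) b d" "Suc j" b] by (auto split: if_splits)
  qed auto
  ultimately show ?thesis
    using E levels_mono[OF tr B] unfolding inv_owners_def by (meson less_le_trans)
qed

lemma inv_owners_abs_run: "feasible (logstar_tas n) n h \<Longrightarrow> inv_owners (abs_run (lg n) h)"
proof (induction h rule: rev_induct)
  case Nil
  show ?case by (simp add: inv_owners_def init_cfg_def)
next
  case (snoc e h)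
  have f: "feasible (logstar_tas n) n h" using snoc.prems feasible_snoc by blast
  show ?case
  proof (cases e)
    case (Inv p)
    then show ?thesis using snoc.IH[OF f] by (simp add: inv_owners_def)
  next
    case (Stp p c)
    have "inv_levels n (lg n) (abs_run (lg n) h)" using invariant_abs_run[OF f] by (simp add: invariant_def)
    then show ?thesis using inv_owners_tr[OF abs_run_Stp _ snoc.IH[OF f]] snoc.prems Stp by blast
  qed
qed

lemma owner_levels: "inv_owners \<sigma> \<Longrightarrow> owner \<sigma> j b = Some q \<Longrightarrow> j < levels \<sigma> q"
  unfolding inv_owners_def owner_def by (cases b) (auto dest: Suc_lessD)

text \<open>An upper bound for the steps taken before reaching a state, apart from those counted in
  \<open>duel_steps\<close>: six per level entered, and one for leaving each duel.\<close>

fun stage_cost :: "lstate \<Rightarrow> nat \<Rightarrow> nat" where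
  "stage_cost Start l = 0"
| "stage_cost (GWrite i) l = 1 + 6 * i"
| "stage_cost (GRead i x) l = 2 + 6 * i"
| "stage_cost (WriteX i) l = 3 + 6 * i"
| "stage_cost (ReadY i) l = 4 + 6 * i"
| "stage_cost (WriteY i) l = 5 + 6 * i"
| "stage_cost (ReadX i) l = 6 + 6 * i"
| "stage_cost (DuelRead j b d) l = 7 * l - j"
| "stage_cost (DuelWrite j b d) l = 7 * l - j"
| "stage_cost Losing l = 1 + 7 * l"
| "stage_cost (Return b) l = 0"

text \<open>Every process is charged the steps of both participants in all duels. This is crude but
  uniform in the process, so the maximum over processes disappears and the expectation splits by
  level. Levels below \<open>n\<close> are all there are, by \<open>levels_le\<close>.\<close>

definition total_duel_steps :: "nat \<Rightarrow> acfg \<Rightarrow> nat" where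
  "total_duel_steps n \<sigma> = (\<Sum>j<n. duel_steps \<sigma> j)"

definition cost :: "nat \<Rightarrow> acfg \<Rightarrow> nat \<Rightarrow> nat" where
  "cost n \<sigma> p = (case stat \<sigma> p of Idle \<Rightarrow> 0 | Active x \<Rightarrow> stage_cost x (levels \<sigma> p) + total_duel_steps n \<sigma>
     | Done b \<Rightarrow> 2 + 7 * levels \<sigma> p + total_duel_steps n \<sigma>)"

lemma total_duel_steps_simps [simp]:
  "total_duel_steps n (\<sigma>\<lparr>mem := a\<rparr>) = total_duel_steps n \<sigma>" "total_duel_steps n (\<sigma>\<lparr>stat := f\<rparr>) = total_duel_steps n \<sigma>"
  "total_duel_steps n (\<sigma>\<lparr>levels := g\<rparr>) = total_duel_steps n \<sigma>" "total_duel_steps n (\<sigma>\<lparr>splitter_winner := e\<rparr>) = total_duel_steps n \<sigma>" "total_duel_steps n (\<sigma>\<lparr>duel_winner := e\<rparr>) = total_duel_steps n \<sigma>"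
  by (simp_all add: total_duel_steps_def)

lemma sum_fun_upd_Suc: "j < n \<Longrightarrow> (\<Sum>i<n. (f(j := Suc (f j))) i) = Suc (\<Sum>i<n. f i)" for f :: "nat \<Rightarrow> nat"
  by (simp add: sum.remove[of "{..<n}" j])

lemma total_duel_steps_tr:
  assumes tr: "tr s p c \<sigma> \<sigma>'" and B: "inv_levels n s \<sigma>"
  shows "total_duel_steps n \<sigma>' = (if \<exists>j b d. stat \<sigma> p = Active (DuelWrite j b d) \<or> stat \<sigma>' p = Active (DuelWrite j b d)
    then Suc (total_duel_steps n \<sigma>) else total_duel_steps n \<sigma>)"
proof -
  have u: "total_duel_steps n (\<sigma>\<lparr>mem := a, stat := f, duel_steps := (duel_steps \<sigma>)(j := Suc (duel_steps \<sigma> j))\<rparr>) = Suc (total_duel_steps n \<sigma>)"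
    "total_duel_steps n (\<sigma>\<lparr>stat := f, duel_steps := (duel_steps \<sigma>)(j := Suc (duel_steps \<sigma> j))\<rparr>) = Suc (total_duel_steps n \<sigma>)"
    if "j < n" for j a f
    using sum_fun_upd_Suc[OF that, of "duel_steps \<sigma>"] by (simp_all add: total_duel_steps_def)
  have l: "j < n" if "stat \<sigma> p = Active x" "chain_port x = Some (j, b)" for x j b
    using inv_levels_chain_port[OF B that] levels_le[OF B, of p] by simp
  show ?thesis using tr
  proof (cases rule: tr.cases)
    case (Duel_cont j b d)
    then show ?thesis using u(2)[of j] l[of "DuelRead j b d"] by auto
  next
    case (DuelWrite0 j b d)
    then show ?thesis using u(1)[of j] l[of "DuelWrite j b d"] by auto
  next
    case (DuelWrite1 j b d)
    then show ?thesis using u(1)[of j] l[of "DuelWrite j b d"] by auto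
  qed (auto simp: enter_level_def)
qed

lemma cost_tr:
  assumes tr: "tr s p c \<sigma> \<sigma>'" and B: "inv_levels n s \<sigma>"
  shows "cost n \<sigma> q + (if q = p then 1 else 0) \<le> cost n \<sigma>' q"
proof (cases "q = p")
  case False
  have "levels \<sigma>' q = levels \<sigma> q" using tr False by (cases rule: tr.cases) simp_all
  then show ?thesis using False tr_stat_other[OF tr False] total_duel_steps_tr[OF tr B]
    by (auto simp: cost_def split: pstat.splits)
next
  case True
  have pl: "levels \<sigma> p = Suc i" if "stat \<sigma> p = Active x" "pre_level x = Some i" for x i using inv_levels_pre_level[OF B that] .
  have ch: "j < levels \<sigma> p" if "stat \<sigma> p = Active x" "chain_port x = Some (j, b)" for x j b using inv_levels_chain_port[OF B that] .
  show ?thesis using tr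
  proof (cases rule: tr.cases)
    case (GRead1 i x)
    then show ?thesis using True pl[of "GRead i x"] by (simp add: cost_def)
  next
    case (ReadY1 i)
    then show ?thesis using True pl[of "ReadY i"] by (simp add: cost_def)
  next
    case (ReadX_stop i)
    then show ?thesis using True pl[of "ReadX i"] by (simp add: cost_def)
  next
    case (Duel_win j b d)
    then show ?thesis using True ch[of "DuelRead (Suc j) b d"] by (simp add: cost_def)
  next
    case (Duel_cont j b d)
    then show ?thesis using True total_duel_steps_tr[OF tr B] by (simp add: cost_def)
  next
    case (DuelWrite0 j b d)
    then show ?thesis using True total_duel_steps_tr[OF tr B] by (simp add: cost_def)
  next
    case (DuelWrite1 j b d)
    then show ?thesis using True total_duel_steps_tr[OF tr B] by (simp add: cost_def)
  qed (use True in \<open>simp_all add: cost_def enter_level_def\<close>)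
qed

lemma steps_le_cost: "feasible (logstar_tas n) n h \<Longrightarrow> steps p h \<le> cost n (abs_run (lg n) h) p"
proof (induction h rule: rev_induct)
  case Nil
  show ?case by (simp add: steps_def)
next
  case (snoc e h)
  have f: "feasible (logstar_tas n) n h" using snoc.prems feasible_snoc by blast
  show ?case
  proof (cases e)
    case (Inv q)
    have "cost n (abs_run (lg n) h) p \<le> cost n (abs_run (lg n) (h @ [e])) p"
      using snoc.prems unfolding Inv by (auto simp: abs_run_Inv feasible_Inv status_def cost_def simp del: abs_run_simps split: pstat.splits)
    then show ?thesis using snoc.IH[OF f] Inv by (simp add: steps_def del: abs_run_simps)
  next
    case (Stp q c)
    have B: "inv_levels n (lg n) (abs_run (lg n) h)" using invariant_abs_run[OF f] by (simp add: invariant_def)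
    have t: "tr (lg n) q c (abs_run (lg n) h) (abs_run (lg n) (h @ [e]))" using abs_run_Stp snoc.prems Stp by blast
    show ?thesis using cost_tr[OF t B, of p] snoc.IH[OF f] Stp by (auto simp: steps_def simp del: abs_run_simps)
  qed
qed

lemma cost_le:
  assumes B: "inv_levels n s \<sigma>"
  shows "cost n \<sigma> p \<le> 2 + 7 * levels \<sigma> p + total_duel_steps n \<sigma>"
proof (cases "stat \<sigma> p")
  case (Active x)
  then show ?thesis using inv_levels_pre_level[OF B Active] by (cases x) (auto simp: cost_def)
qed (simp_all add: cost_def)

section \<open>Cost of the duels\<close>

lemma nn_integral_coin_pmf_coin:
  assumes "a \<ge> 0" "b \<ge> 0"
  shows "(\<integral>\<^sup>+ c. ennreal (if c = 0 then a else b) \<partial>measure_pmf coin_pmf) = ennreal ((a + b) / 2)"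
proof -
  have p: "measure_pmf.prob coin_pmf {0} = 1/2" by (simp add: measure_pmf_single coin_pmf_def)
  have q: "measure_pmf.prob coin_pmf (- {0}) = 1/2"
    using measure_pmf.prob_compl[of "{0}" coin_pmf] p by (simp add: Compl_eq_Diff_UNIV)
  have "(\<integral>\<^sup>+ c. ennreal (if c = 0 then a else b) \<partial>measure_pmf coin_pmf) =
    (\<integral>\<^sup>+ c. ennreal a * indicator {0} c + ennreal b * indicator (- {0}) c \<partial>measure_pmf coin_pmf)"
    by (intro nn_integral_cong) (auto split: split_indicator)
  also have "\<dots> = ennreal a * ennreal (1/2) + ennreal b * ennreal (1/2)"
    by (subst nn_integral_add) (simp_all add: nn_integral_cmult_indicator measure_pmf.emeasure_eq_measure p q)
  also have "\<dots> = ennreal ((a + b) / 2)"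
  proof -
    have "ennreal a * ennreal (1/2) = ennreal (a * (1/2))" "ennreal b * ennreal (1/2) = ennreal (b * (1/2))"
      using assms by (intro ennreal_mult[symmetric]; simp)+
    moreover have "ennreal (a * (1/2)) + ennreal (b * (1/2)) = ennreal (a * (1/2) + b * (1/2))"
      using assms by (intro ennreal_plus[symmetric]) simp_all
    moreover have "a * (1/2) + b * (1/2) = (a + b) / 2" by simp
    ultimately show ?thesis by (simp only:)
  qed
  finally show ?thesis .
qed

lemma nn_integral_pointwise:
  fixes M :: "nat pmf" and f g :: "nat \<Rightarrow> nat"
  assumes "\<And>c. f c + b \<le> a + g c"
  shows "(\<integral>\<^sup>+ c. ennreal (real (f c)) \<partial>measure_pmf M) + ennreal (real b) \<le>
    ennreal (real a) + (\<integral>\<^sup>+ c. ennreal (real (g c)) \<partial>measure_pmf M)"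
proof -
  have "(\<integral>\<^sup>+ c. ennreal (real (f c)) \<partial>measure_pmf M) + ennreal (real b) =
    (\<integral>\<^sup>+ c. ennreal (real (f c)) + ennreal (real b) \<partial>measure_pmf M)"
    by (subst nn_integral_add) simp_all
  also have "\<dots> \<le> (\<integral>\<^sup>+ c. ennreal (real a) + ennreal (real (g c)) \<partial>measure_pmf M)"
  proof (intro nn_integral_mono)
    fix c
    have "real (f c) + real b \<le> real a + real (g c)" using assms[of c] by linarith
    then show "ennreal (real (f c)) + ennreal (real b) \<le> ennreal (real a) + ennreal (real (g c))"
      by (simp flip: ennreal_plus)
  qed
  also have "\<dots> = ennreal (real a) + (\<integral>\<^sup>+ c. ennreal (real (g c)) \<partial>measure_pmf M)"
    by (subst nn_integral_add) simp_all
  finally show ?thesis .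
qed

text \<open>An upper bound for the expected number of remaining steps of a duel with counters \<open>x\<close>, \<open>y\<close>, where
  \<open>u\<close>, \<open>v\<close> tell whether a write of the respective side is pending.  The constants solve the linear
  system that results from always letting the adversary make its worst move; for example
  \<open>14 = 1 + 11/2 + 15/2\<close> when the counters are equal and both writes are pending.\<close>

definition lead_pot :: "nat \<Rightarrow> bool \<Rightarrow> bool \<Rightarrow> nat" where
  "lead_pot g u v = (if g = 1 then (if v then 11 else 4) - of_bool u else if v then 3 else 0)"

definition duel_pot :: "nat \<Rightarrow> nat \<Rightarrow> bool \<Rightarrow> bool \<Rightarrow> nat" where
  "duel_pot x y u v = (if x = y then 16 - of_bool u - of_bool v
     else if y < x then lead_pot (x - y) u v else lead_pot (y - x) v u)"

lemma duel_pot_sym: "duel_pot x y u v = duel_pot y x v u"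
  by (auto simp: duel_pot_def)

lemma duel_pot_read: "y \<le> x \<Longrightarrow> x < y + 2 \<Longrightarrow> Suc (duel_pot x y True v) \<le> duel_pot x y False v"
  by (cases "x = y"; cases "x = Suc y") (auto simp: duel_pot_def lead_pot_def)

text \<open>One step plus the mean potential over both outcomes, doubled to stay in
  \<open>nat\<close>. The hypotheses reflect that a write is pending only after a read that showed a
  lead of at most one, and that the opposing counter never decreases.\<close>

lemma duel_pot_write:
  assumes "x \<le> Suc y" "v \<Longrightarrow> y \<le> Suc x"
  shows "2 + duel_pot (Suc x) y False v + duel_pot x y False v \<le> 2 * duel_pot x y True v"
proof -
  consider "x = y" | "x = Suc y" | "y = Suc x" | "y = Suc (Suc x)" "\<not> v" | "Suc (Suc x) < y" "\<not> v"
    using assms by linarith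
  then show ?thesis
  proof cases
    case 5
    then have "y - x \<noteq> Suc 0" "y - Suc x \<noteq> Suc 0" by auto
    then show ?thesis using 5 by (simp add: duel_pot_def lead_pot_def)
  qed (auto simp: duel_pot_def lead_pot_def)
qed

section \<open>The duel potential along an execution\<close>

definition pending_write :: "acfg \<Rightarrow> nat \<Rightarrow> bool \<Rightarrow> bool" where
  "pending_write \<sigma> j b \<longleftrightarrow> (\<exists>q d. stat \<sigma> q = Active (DuelWrite j b d))"

definition duel_pot_at :: "acfg \<Rightarrow> nat \<Rightarrow> nat" where
  "duel_pot_at \<sigma> j = duel_pot (mem \<sigma> (Counter j True)) (mem \<sigma> (Counter j False)) (pending_write \<sigma> j True) (pending_write \<sigma> j False)"

lemma duel_pot_at_b: "duel_pot_at \<sigma> j = duel_pot (mem \<sigma> (Counter j b)) (mem \<sigma> (Counter j (\<not> b))) (pending_write \<sigma> j b) (pending_write \<sigma> j (\<not> b))"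
  by (cases b) (simp_all add: duel_pot_at_def duel_pot_sym)

text \<open>Steps spent plus a bound for the steps to come. The latter is left out until the level
  is reached, so that unreached levels cost nothing; on arrival its initial value 16, for equal
  counters and no pending write, is paid from \<open>level_budget\<close>.\<close>

definition level_pot :: "nat \<Rightarrow> acfg \<Rightarrow> nat" where
  "level_pot j \<sigma> = duel_steps \<sigma> j + (if reached \<sigma> j \<noteq> {} then duel_pot_at \<sigma> j else 0)"

definition level_budget :: "nat \<Rightarrow> acfg \<Rightarrow> nat" where
  "level_budget j \<sigma> = (if reached \<sigma> j \<noteq> {} then 16 else 0)"

lemma reached_mono: "tr s p c \<sigma> \<sigma>' \<Longrightarrow> inv_levels n s \<sigma> \<Longrightarrow> reached \<sigma> i \<subseteq> reached \<sigma>' i"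
  unfolding reached_def using levels_mono by (auto intro: less_le_trans)

lemma chain_new:
  assumes "inv_duels \<sigma>" "inv_owners \<sigma>" "reached \<sigma> j = {}"
  shows "mem \<sigma> (Counter j b) = 0" "\<not> pending_write \<sigma> j b"
proof -
  have "owner \<sigma> j b = None" for b
  proof (cases "owner \<sigma> j b")
    case (Some q)
    then show ?thesis using owner_levels[OF assms(2) Some] assms(3) by (auto simp: reached_def)
  qed simp
  then show "mem \<sigma> (Counter j b) = 0" "\<not> pending_write \<sigma> j b"
    using inv_duels_own[OF assms(1), of j b] inv_duels_mem[OF assms(1), of _ j b] unfolding pending_write_def by fastforce+
qed

text \<open>A read that makes a write pending is paid for by \<open>duel_pot_read\<close>. Any other
  such step leaves the potential of duel \<open>j\<close> alone and at most opens the level, where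
  potential and budget both rise by 16.\<close>

lemma chain_other:
  assumes tr: "tr s p c \<sigma> \<sigma>'" and B: "inv_levels n s \<sigma>" and C: "inv_duels \<sigma>" and E: "inv_owners \<sigma>"
    and np: "\<And>b d. stat \<sigma> p \<noteq> Active (DuelWrite j b d)"
  shows "level_pot j \<sigma>' + level_budget j \<sigma> \<le> level_pot j \<sigma> + level_budget j \<sigma>'"
proof (cases "\<exists>b d. stat \<sigma>' p = Active (DuelWrite j b d)")
  case False
  have w: "pending_write \<sigma>' j b = pending_write \<sigma> j b" for b
    unfolding pending_write_def using tr_stat_other[OF tr] False np by metis
  have m: "mem \<sigma>' (Counter j b) = mem \<sigma> (Counter j b) \<and> duel_steps \<sigma>' j = duel_steps \<sigma> j" for b
    using tr by (cases rule: tr.cases) (use False np in auto)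
  have c: "duel_pot_at \<sigma>' j = duel_pot_at \<sigma> j" by (simp add: duel_pot_at_def w m)
  show ?thesis
  proof (cases "reached \<sigma> j = {}")
    case True
    have "duel_pot_at \<sigma> j = 16" using chain_new[OF C E True] by (simp add: duel_pot_at_def duel_pot_def)
    then show ?thesis using m c True by (simp add: level_pot_def level_budget_def)
  next
    case ne: False
    then have "reached \<sigma>' j \<noteq> {}" using reached_mono[OF tr B] by blast
    then show ?thesis using m c ne by (simp add: level_pot_def level_budget_def)
  qed
next
  case True
  then obtain b d where s': "stat \<sigma>' p = Active (DuelWrite j b d)" by blast
  have cr: "stat \<sigma> p = Active (DuelRead j b d) \<and> mem \<sigma> (Counter j (\<not> b)) \<le> d \<and> d < mem \<sigma> (Counter j (\<not> b)) + 2 \<and>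
      mem \<sigma>' = mem \<sigma> \<and> duel_steps \<sigma>' j = Suc (duel_steps \<sigma> j)"
    using tr by (cases rule: tr.cases) (use s' in \<open>auto simp: enter_level_def split: if_splits\<close>)
  then have md: "mem \<sigma> (Counter j b) = d" and ow: "owner \<sigma> j b = Some p" using inv_duels_mem[OF C, of p j b d] by auto
  have V: "reached \<sigma> j \<noteq> {}" using inv_levels_chain_port[OF B, of p "DuelRead j b d" j b] cr by (auto simp: reached_def)
  have V': "reached \<sigma>' j \<noteq> {}" using V reached_mono[OF tr B] by blast
  have w0: "\<not> pending_write \<sigma> j b"
  proof
    assume "pending_write \<sigma> j b"
    then obtain q e where q: "stat \<sigma> q = Active (DuelWrite j b e)" by (auto simp: pending_write_def)
    then have "q = p" using inv_duels_mem[OF C, of q j b e] ow by simp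
    then show False using q cr by simp
  qed
  have w1: "pending_write \<sigma>' j b" using s' by (auto simp: pending_write_def)
  have w2: "pending_write \<sigma>' j (\<not> b) = pending_write \<sigma> j (\<not> b)"
  proof -
    have "stat \<sigma>' q = Active (DuelWrite j (\<not> b) e) \<longleftrightarrow> stat \<sigma> q = Active (DuelWrite j (\<not> b) e)" for q e
      using tr_stat_other[OF tr, of q] s' cr by (cases "q = p") auto
    then show ?thesis by (simp add: pending_write_def)
  qed
  have "Suc (duel_pot_at \<sigma>' j) \<le> duel_pot_at \<sigma> j"
    unfolding duel_pot_at_b[of _ j b] using duel_pot_read[of "mem \<sigma> (Counter j (\<not> b))" d] cr md w0 w1 w2 by simp
  then show ?thesis using V V' cr by (simp add: level_pot_def level_budget_def)
qed

text \<open>The new potential depends on the coin only through success or failure, so its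
  expectation is the mean of two values.\<close>

lemma chain_write:
  assumes tr: "\<And>c. tr s p c \<sigma> (\<sigma>' c)" and B: "inv_levels n s \<sigma>" and C: "inv_duels \<sigma>"
    and st: "stat \<sigma> p = Active (DuelWrite j b d)"
  shows "\<exists>x y. (\<forall>c. level_pot j (\<sigma>' c) = (if c = 0 then x else y)) \<and> x + y \<le> 2 * level_pot j \<sigma>"
proof -
  have md: "mem \<sigma> (Counter j b) = d" and ow: "owner \<sigma> j b = Some p" using inv_duels_mem[OF C, of p j b d] st by auto
  have d1: "d \<le> Suc (mem \<sigma> (Counter j (\<not> b)))" using inv_duels_DuelWrite[OF C st] .
  have V: "reached \<sigma> j \<noteq> {}" using inv_levels_chain_port[OF B, of p "DuelWrite j b d" j b] st by (auto simp: reached_def)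
  have V': "reached (\<sigma>' c) j \<noteq> {}" for c using V reached_mono[OF tr[of c] B] by blast
  have s': "stat (\<sigma>' c) p = Active (DuelRead j b (if c = 0 then Suc d else d)) \<and> duel_steps (\<sigma>' c) j = Suc (duel_steps \<sigma> j) \<and>
      mem (\<sigma>' c) (Counter j b) = (if c = 0 then Suc d else d) \<and> mem (\<sigma>' c) (Counter j (\<not> b)) = mem \<sigma> (Counter j (\<not> b))" for c
    using tr[of c] by (cases rule: tr.cases) (use st md in auto)
  have w0: "pending_write \<sigma> j b" using st by (auto simp: pending_write_def)
  have w1: "\<not> pending_write (\<sigma>' c) j b" for c
  proof
    assume "pending_write (\<sigma>' c) j b"
    then obtain q e where q: "stat (\<sigma>' c) q = Active (DuelWrite j b e)" by (auto simp: pending_write_def)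
    then have qp: "q \<noteq> p" using s'[of c] by auto
    then have "stat \<sigma> q = Active (DuelWrite j b e)" using q tr_stat_other[OF tr] by metis
    then show False using inv_duels_mem[OF C, of q j b e] ow qp by simp
  qed
  have w2: "pending_write (\<sigma>' c) j (\<not> b) = pending_write \<sigma> j (\<not> b)" for c
  proof -
    have "stat (\<sigma>' c) q = Active (DuelWrite j (\<not> b) e) \<longleftrightarrow> stat \<sigma> q = Active (DuelWrite j (\<not> b) e)" for q e
      using tr_stat_other[OF tr, of q] s'[of c] st by (cases "q = p") auto
    then show ?thesis by (simp add: pending_write_def)
  qed
  have v: "mem \<sigma> (Counter j (\<not> b)) \<le> Suc d" if vw: "pending_write \<sigma> j (\<not> b)"
  proof -
    obtain q e where q: "stat \<sigma> q = Active (DuelWrite j (\<not> b) e)" using vw by (auto simp: pending_write_def)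
    show ?thesis using inv_duels_DuelWrite[OF C q] inv_duels_mem[OF C, of q j "\<not> b" e] q md by simp
  qed
  let ?P = "\<lambda>x. duel_pot x (mem \<sigma> (Counter j (\<not> b))) False (pending_write \<sigma> j (\<not> b))"
  have "level_pot j (\<sigma>' c) = (if c = 0 then Suc (duel_steps \<sigma> j) + ?P (Suc d) else Suc (duel_steps \<sigma> j) + ?P d)" for c
    using V'[of c] s'[of c] w1[of c] w2[of c] by (simp add: level_pot_def duel_pot_at_b[of _ j b])
  moreover have "level_pot j \<sigma> = duel_steps \<sigma> j + duel_pot d (mem \<sigma> (Counter j (\<not> b))) True (pending_write \<sigma> j (\<not> b))"
    using V md w0 by (simp add: level_pot_def duel_pot_at_b[of _ j b])
  moreover note duel_pot_write[OF d1 v]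
  ultimately show ?thesis
    by (intro exI[of _ "Suc (duel_steps \<sigma> j) + ?P (Suc d)"] exI[of _ "Suc (duel_steps \<sigma> j) + ?P d"]) auto
qed

abbreviation cfg_at :: "nat \<Rightarrow> event list \<Rightarrow> acfg" where "cfg_at n h \<equiv> abs_run (lg n) h"

text \<open>The right-hand side is 16 times the probability that level \<open>j\<close> is reached.
  This is why the later sum over all \<open>j < n\<close> does not grow with
  \<open>n\<close>.\<close>

lemma chain_drift:
  "(\<integral>\<^sup>+ h. ennreal (real (duel_steps (cfg_at n h) j)) \<partial>measure_pmf (lazy_exec n k A t)) \<le>
   (\<integral>\<^sup>+ h. ennreal (real (level_budget j (cfg_at n h))) \<partial>measure_pmf (lazy_exec n k A t))"
proof -
  have "(\<integral>\<^sup>+ h. ennreal (real (duel_steps (cfg_at n h) j)) \<partial>measure_pmf (lazy_exec n k A t)) \<le>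
    (\<integral>\<^sup>+ h. ennreal (real (level_pot j (cfg_at n h))) \<partial>measure_pmf (lazy_exec n k A t))"
    by (intro nn_integral_mono ennreal_leI) (simp add: level_pot_def)
  also have "\<dots> \<le> ennreal (real (level_pot j (cfg_at n []))) + (\<integral>\<^sup>+ h. ennreal (real (level_budget j (cfg_at n h))) \<partial>measure_pmf (lazy_exec n k A t))"
  proof (rule drift[where K = 16])
    fix h p assume "feasible (logstar_tas n) n (h @ [Inv p])"
    note a = abs_run_Inv[OF this] and p = this[unfolded feasible_Inv]
    have i: "stat (cfg_at n h) p = Idle" using p by (simp add: status_def)
    have e: "duel_steps (cfg_at n (h @ [Inv p])) = duel_steps (cfg_at n h)" "mem (cfg_at n (h @ [Inv p])) = mem (cfg_at n h)"
      "reached (cfg_at n (h @ [Inv p])) j = reached (cfg_at n h) j"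
      unfolding a by (simp_all add: reached_def)
    have w: "pending_write (cfg_at n (h @ [Inv p])) j b = pending_write (cfg_at n h) j b" for b
    proof -
      have "stat (cfg_at n (h @ [Inv p])) q = Active (DuelWrite j b d) \<longleftrightarrow> stat (cfg_at n h) q = Active (DuelWrite j b d)" for q d
        unfolding a using i by auto
      then show ?thesis by (simp add: pending_write_def)
    qed
    show "ennreal (real (level_pot j (cfg_at n (h @ [Inv p])))) + ennreal (real (level_budget j (cfg_at n h)))
        \<le> ennreal (real (level_pot j (cfg_at n h))) + ennreal (real (level_budget j (cfg_at n (h @ [Inv p]))))"
      unfolding level_pot_def level_budget_def duel_pot_at_def e w ..
  next
    fix h p x assume f: "feasible (logstar_tas n) n h" and x: "status n h p = Active x"
    have f': "feasible (logstar_tas n) n (h @ [Stp p c])" for c using f x by (simp add: feasible_Stp)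
    have t: "tr (lg n) p c (cfg_at n h) (cfg_at n (h @ [Stp p c]))" for c by (rule abs_run_Stp[OF f'])
    have I: "inv_levels n (lg n) (cfg_at n h)" "inv_duels (cfg_at n h)" "inv_owners (cfg_at n h)"
      using invariant_abs_run[OF f] inv_owners_abs_run[OF f] by (simp_all add: invariant_def)
    show "(\<integral>\<^sup>+ c. ennreal (real (level_pot j (cfg_at n (h @ [Stp p c])))) \<partial>measure_pmf coin_pmf) + ennreal (real (level_budget j (cfg_at n h)))
      \<le> ennreal (real (level_pot j (cfg_at n h))) + (\<integral>\<^sup>+ c. ennreal (real (level_budget j (cfg_at n (h @ [Stp p c])))) \<partial>measure_pmf coin_pmf)"
    proof (cases "\<exists>b d. stat (cfg_at n h) p = Active (DuelWrite j b d)")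
      case False
      then show ?thesis by (intro nn_integral_pointwise chain_other[OF t I]) blast
    next
      case True
      then obtain b d where st: "stat (cfg_at n h) p = Active (DuelWrite j b d)" by blast
      obtain u v where uv: "\<And>c. level_pot j (cfg_at n (h @ [Stp p c])) = (if c = 0 then u else v)" "u + v \<le> 2 * level_pot j (cfg_at n h)"
        using chain_write[of "lg n" p "cfg_at n h" "\<lambda>c. cfg_at n (h @ [Stp p c])", OF t I(1,2) st] by blast
      have "(\<integral>\<^sup>+ c. ennreal (real (level_pot j (cfg_at n (h @ [Stp p c])))) \<partial>measure_pmf coin_pmf) =
        (\<integral>\<^sup>+ c. ennreal (if c = 0 then real u else real v) \<partial>measure_pmf coin_pmf)"
        unfolding uv(1) by (intro nn_integral_cong) auto
      also have "\<dots> = ennreal ((real u + real v) / 2)" by (rule nn_integral_coin_pmf_coin) simp_all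
      also have "\<dots> \<le> ennreal (real (level_pot j (cfg_at n h)))" 
      proof (intro ennreal_leI)
        have "real (u + v) \<le> real (2 * level_pot j (cfg_at n h))" using uv(2) by (simp only: of_nat_le_iff)
        then show "(real u + real v) / 2 \<le> real (level_pot j (cfg_at n h))" by simp
      qed
      finally have 1: "(\<integral>\<^sup>+ c. ennreal (real (level_pot j (cfg_at n (h @ [Stp p c])))) \<partial>measure_pmf coin_pmf)
        \<le> ennreal (real (level_pot j (cfg_at n h)))" .
      have V: "reached (cfg_at n h) j \<noteq> {}" using inv_levels_chain_port[OF I(1), of p "DuelWrite j b d" j b] st by (auto simp: reached_def)
      have "reached (cfg_at n (h @ [Stp p c])) j \<noteq> {}" for c using V reached_mono[OF t I(1)] by blast
      then have "(\<integral>\<^sup>+ c. ennreal (real (level_budget j (cfg_at n (h @ [Stp p c])))) \<partial>measure_pmf coin_pmf) = ennreal (real (level_budget j (cfg_at n h)))"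
        using V by (simp add: level_budget_def)
      then show ?thesis using 1 by (intro add_mono) simp_all
    qed
  next
    fix h show "ennreal (real (level_budget j (cfg_at n h))) \<le> ennreal 16" by (intro ennreal_leI) (simp add: level_budget_def)
  qed
  also have "level_pot j (cfg_at n []) = 0" by (simp add: level_pot_def init_cfg_def reached_def)
  finally show ?thesis by simp
qed

section \<open>Group elections\<close>

text \<open>\<open>elected\<close> also contains the processes that would survive if they read right now; a write to the
  cell they are about to read removes them.\<close>

definition elected :: "acfg \<Rightarrow> nat \<Rightarrow> nat set" where
  "elected \<sigma> i = {p. Suc i < levels \<sigma> p \<or> stat \<sigma> p \<in> {Active (WriteX i), Active (ReadY i), Active (WriteY i), Active (ReadX i)} \<or>
     (\<exists>x. stat \<sigma> p = Active (GRead i x) \<and> mem \<sigma> (GReg i (Suc x)) = 0)}"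

text \<open>Slot \<open>j\<close> stands for the unmarked cell \<open>Suc j\<close>: while it is
  free, writing cell \<open>j\<close> makes a candidate, and writing cell \<open>Suc j\<close>
  closes it.\<close>

definition free_slots :: "nat \<Rightarrow> acfg \<Rightarrow> nat \<Rightarrow> nat set" where
  "free_slots J \<sigma> i = {j. j < J \<and> mem \<sigma> (GReg i (Suc j)) = 0}"

definition writers :: "acfg \<Rightarrow> nat \<Rightarrow> nat set" where
  "writers \<sigma> i = {p. i < levels \<sigma> p \<and> stat \<sigma> p \<noteq> Active (GWrite i)}"

text \<open>A slot has weight 2 because its closing cell \<open>Suc j\<close> is hit half as often
  as the cell \<open>j\<close> that profits from it, so the expected gain and loss of each slot
  cancel. Cells from \<open>J\<close> on are not tracked and enter through the tail
  probability.\<close>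

definition election_pot :: "nat \<Rightarrow> nat \<Rightarrow> acfg \<Rightarrow> nat" where
  "election_pot J i \<sigma> = card (elected \<sigma> i) + 2 * card (free_slots J \<sigma> i)"

lemma finite_free_slots [simp]: "finite (free_slots J \<sigma> i)"
  by (simp add: free_slots_def)

lemma writers_sub: "writers \<sigma> i \<subseteq> reached \<sigma> i"
  by (auto simp: writers_def reached_def)

lemma elected_finite: "inv_levels n s \<sigma> \<Longrightarrow> finite (elected \<sigma> i)"
proof (rule finite_subset)
  assume B: "inv_levels n s \<sigma>"
  show "elected \<sigma> i \<subseteq> {1..n}"
  proof
    fix p assume "p \<in> elected \<sigma> i"
    then have "levels \<sigma> p \<noteq> 0 \<or> stat \<sigma> p \<noteq> Idle" by (auto simp: elected_def)
    then show "p \<in> {1..n}" by (rule inv_levels_p[OF B])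
  qed
qed simp

lemma reached_Suc_sub_elected: "reached \<sigma> (Suc i) \<subseteq> elected \<sigma> i"
  by (auto simp: reached_def elected_def)

text \<open>As level \<open>i\<close> has an election, its splitter is entered only from
  \<open>GRead\<close>, and only by processes that were already counted.\<close>

lemma elected_tr:
  assumes tr: "tr s p c \<sigma> \<sigma>'" and B: "inv_levels n s \<sigma>" and i: "i < s" and np: "stat \<sigma> p \<noteq> Active (GWrite i)"
  shows "elected \<sigma>' i \<subseteq> elected \<sigma> i"
proof
  fix q assume q: "q \<in> elected \<sigma>' i"
  have m: "mem \<sigma>' (GReg i x) = mem \<sigma> (GReg i x)" for x
    using tr by (cases rule: tr.cases) (use np in auto)
  show "q \<in> elected \<sigma> i"
  proof (cases "q = p")
    case False
    have "levels \<sigma>' q = levels \<sigma> q" using tr False by (cases rule: tr.cases) simp_all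
    then show ?thesis using q tr_stat_other[OF tr False] m by (simp add: elected_def)
  next
    case True
    have l: "levels \<sigma> p = Suc k" if "stat \<sigma> p = Active (ReadX k)" for k using inv_levels_pre_level[OF B that] by simp
    show ?thesis using tr
      by (cases rule: tr.cases)
        (use q True i np l in \<open>auto simp: elected_def enter_level_def less_Suc_eq split: if_splits\<close>)
  qed
qed

lemma writers_tr:
  assumes tr: "tr s p c \<sigma> \<sigma>'" and B: "inv_levels n s \<sigma>"
  shows "writers \<sigma> i \<subseteq> writers \<sigma>' i"
proof
  fix q assume q: "q \<in> writers \<sigma> i"
  show "q \<in> writers \<sigma>' i"
  proof (cases "q = p")
    case False
    have "levels \<sigma>' q = levels \<sigma> q" using tr False by (cases rule: tr.cases) simp_all
    then show ?thesis using q tr_stat_other[OF tr False] by (simp add: writers_def)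
  next
    case True
    have l: "levels \<sigma> p = Suc k" if "stat \<sigma> p = Active (ReadX k)" for k using inv_levels_pre_level[OF B that] by simp
    have l0: "levels \<sigma> p = 0" if "stat \<sigma> p = Active Start" using inv_levels_lv0[OF B] that by blast
    show ?thesis using tr
      by (cases rule: tr.cases) (use q True l l0 in \<open>auto simp: writers_def enter_level_def split: if_splits\<close>)
  qed
qed

lemma free_slots_tr: "tr s p c \<sigma> \<sigma>' \<Longrightarrow> free_slots J \<sigma>' i \<subseteq> free_slots J \<sigma> i"
  by (erule tr.cases) (auto simp: free_slots_def split: if_splits)

text \<open>The writer becomes a candidate only if its cell is a free slot or lies at
  \<open>J\<close> or above. The condition \<open>J \<le> s\<close> hides the cap
  \<open>min c s\<close> from the slots: they and their closing cells have index at most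
  \<open>J\<close>.\<close>

lemma ge_write:
  assumes tr: "tr s p c \<sigma> \<sigma>'" and B: "inv_levels n s \<sigma>" and st: "stat \<sigma> p = Active (GWrite i)" and J: "J \<le> s"
  shows "election_pot J i \<sigma>' + 2 * of_bool (c \<in> Suc ` free_slots J \<sigma> i) \<le> election_pot J i \<sigma> + (of_bool (c \<in> free_slots J \<sigma> i) + of_bool (J \<le> c))"
    and "card (writers \<sigma>' i) = Suc (card (writers \<sigma> i))"
proof -
  let ?x = "min c s"
  have e: "\<sigma>' = \<sigma>\<lparr>mem := (mem \<sigma>)(GReg i ?x := 1), stat := (stat \<sigma>)(p := Active (GRead i ?x))\<rparr>"
    using tr by (cases rule: tr.cases) (use st in auto)
  have lp: "levels \<sigma> p = Suc i" using inv_levels_pre_level[OF B st] by simp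
  have "writers \<sigma>' i = insert p (writers \<sigma> i)" "p \<notin> writers \<sigma> i" using st lp by (auto simp: writers_def e)
  moreover have "finite (writers \<sigma> i)" using reached_finite[OF B] writers_sub finite_subset by metis
  ultimately show "card (writers \<sigma>' i) = Suc (card (writers \<sigma> i))" by simp
  have El1: "elected \<sigma>' i \<subseteq> insert p (elected \<sigma> i)" by (auto simp: elected_def e split: if_splits)
  have El2: "elected \<sigma>' i \<subseteq> elected \<sigma> i" if "mem \<sigma> (GReg i (Suc ?x)) \<noteq> 0"
    using that lp by (auto simp: elected_def e split: if_splits)
  have c1: "card (elected \<sigma>' i) \<le> Suc (card (elected \<sigma> i))"
    using card_mono[OF _ El1] elected_finite[OF B, of i] card_insert_le_m1[of "Suc (card (elected \<sigma> i))"]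
    by (simp add: card_insert_if split: if_splits)
  have "card (elected \<sigma>' i) \<le> card (elected \<sigma> i)" if "c \<notin> free_slots J \<sigma> i" "\<not> J \<le> c"
    using that J card_mono[OF elected_finite[OF B] El2] by (simp add: free_slots_def min_absorb1)
  then have "card (elected \<sigma>' i) \<le> card (elected \<sigma> i) + (of_bool (c \<in> free_slots J \<sigma> i) + of_bool (J \<le> c))"
    using c1 by auto
  moreover have "card (free_slots J \<sigma>' i) + of_bool (c \<in> Suc ` free_slots J \<sigma> i) \<le> card (free_slots J \<sigma> i)"
  proof (cases "c \<in> Suc ` free_slots J \<sigma> i")
    case False
    then show ?thesis using card_mono[OF _ free_slots_tr[OF tr]] by simp
  next
    case True
    then obtain j where j: "c = Suc j" "j \<in> free_slots J \<sigma> i" by blast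
    then have x: "?x = Suc j" using J by (auto simp: free_slots_def)
    have "free_slots J \<sigma>' i \<subseteq> free_slots J \<sigma> i - {j}" using j x by (auto simp: free_slots_def e)
    then have "card (free_slots J \<sigma>' i) \<le> card (free_slots J \<sigma> i - {j})" by (intro card_mono) auto
    also have "\<dots> < card (free_slots J \<sigma> i)" using j by (intro psubset_card_mono) auto
    finally show ?thesis using True by simp
  qed
  ultimately show "election_pot J i \<sigma>' + 2 * of_bool (c \<in> Suc ` free_slots J \<sigma> i) \<le> election_pot J i \<sigma> + (of_bool (c \<in> free_slots J \<sigma> i) + of_bool (J \<le> c))"
    unfolding election_pot_def by linarith
qed

lemma pmf_coin_pmf: "pmf coin_pmf c = (1/2) ^ Suc c"
  by (simp add: coin_pmf_def)

text \<open>The reason for parameter 1/2: shifting an index by one halves its probability, in step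
  with the slot weight 2.\<close>

lemma prob_coin_pmf_Suc: "finite X \<Longrightarrow> 2 * measure_pmf.prob coin_pmf (Suc ` X) = measure_pmf.prob coin_pmf X"
  by (simp add: measure_measure_pmf_finite sum.reindex pmf_coin_pmf sum_distrib_left)

lemma prob_coin_pmf_ge: "measure_pmf.prob coin_pmf {c. J \<le> c} = (1/2) ^ J"
proof -
  have "(\<Sum>c<J. (1/2) ^ Suc c) = 1 - (1/2 :: real) ^ J" by (induction J) (simp_all add: field_simps)
  then have "measure_pmf.prob coin_pmf {..<J} = 1 - (1/2) ^ J"
    by (simp add: measure_measure_pmf_finite pmf_coin_pmf)
  moreover have "{c. J \<le> c} = UNIV - {..<J}" by auto
  ultimately show ?thesis using measure_pmf.prob_compl[of "{..<J}" coin_pmf] by simp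
qed

lemma nn_integral_of_bool: "(\<integral>\<^sup>+ c. ennreal (of_bool (c \<in> X)) \<partial>measure_pmf M) = ennreal (measure_pmf.prob M X)"
proof -
  have "(\<integral>\<^sup>+ c. ennreal (of_bool (c \<in> X)) \<partial>measure_pmf M) = (\<integral>\<^sup>+ c. indicator X c \<partial>measure_pmf M)"
    by (intro nn_integral_cong) (auto split: split_indicator)
  then show ?thesis by (simp add: measure_pmf.emeasure_eq_measure)
qed

lemma ge_write_int:
  assumes tr: "\<And>c. tr s p c \<sigma> (\<sigma>' c)" and B: "inv_levels n s \<sigma>" and st: "stat \<sigma> p = Active (GWrite i)" and J: "J \<le> s"
  shows "(\<integral>\<^sup>+ c. ennreal (real (election_pot J i (\<sigma>' c))) \<partial>measure_pmf coin_pmf) \<le> ennreal (real (election_pot J i \<sigma>) + (1/2) ^ J)"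
proof -
  let ?X = "free_slots J \<sigma> i"
  let ?f = "\<integral>\<^sup>+ c. ennreal (real (election_pot J i (\<sigma>' c))) \<partial>measure_pmf coin_pmf"
  \<comment> \<open>Twice the probability of closing a slot is the probability of hitting one, so
    this term reappears on the right and cancels, leaving only the tail
    \<open>(1/2) ^ J\<close>.\<close>
  have "?f + ennreal (measure_pmf.prob coin_pmf ?X) = ?f + 2 * ennreal (measure_pmf.prob coin_pmf (Suc ` ?X))"
    by (simp flip: prob_coin_pmf_Suc[of ?X] ennreal_numeral add: ennreal_mult)
  also have "\<dots> = (\<integral>\<^sup>+ c. ennreal (real (election_pot J i (\<sigma>' c))) + 2 * ennreal (of_bool (c \<in> Suc ` ?X)) \<partial>measure_pmf coin_pmf)"
    by (simp add: nn_integral_add nn_integral_cmult nn_integral_of_bool)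
  also have "\<dots> \<le> (\<integral>\<^sup>+ c. ennreal (real (election_pot J i \<sigma>)) + (ennreal (of_bool (c \<in> ?X)) + ennreal (of_bool (c \<in> {c. J \<le> c}))) \<partial>measure_pmf coin_pmf)"
  proof (intro nn_integral_mono)
    fix c
    have "real (election_pot J i (\<sigma>' c) + 2 * of_bool (c \<in> Suc ` ?X)) \<le> real (election_pot J i \<sigma> + (of_bool (c \<in> ?X) + of_bool (J \<le> c)))"
      using ge_write(1)[OF tr B st J] by (simp only: of_nat_le_iff)
    then have "ennreal (real (election_pot J i (\<sigma>' c)) + 2 * of_bool (c \<in> Suc ` ?X)) \<le>
        ennreal (real (election_pot J i \<sigma>) + (of_bool (c \<in> ?X) + of_bool (J \<le> c)))"
      by (intro ennreal_leI) simp
    then show "ennreal (real (election_pot J i (\<sigma>' c))) + 2 * ennreal (of_bool (c \<in> Suc ` ?X)) \<le>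
      ennreal (real (election_pot J i \<sigma>)) + (ennreal (of_bool (c \<in> ?X)) + ennreal (of_bool (c \<in> {c. J \<le> c})))"
      by (simp add: ennreal_plus ennreal_mult)
  qed
  also have "\<dots> = ennreal (real (election_pot J i \<sigma>)) + (ennreal (measure_pmf.prob coin_pmf ?X) + ennreal ((1/2) ^ J))"
    by (simp add: nn_integral_add nn_integral_of_bool nn_integral_of_bool[where X = "{c. J \<le> c}" and M = coin_pmf, simplified] prob_coin_pmf_ge)
  finally have "ennreal (measure_pmf.prob coin_pmf ?X) + ?f \<le>
      ennreal (measure_pmf.prob coin_pmf ?X) + (ennreal (real (election_pot J i \<sigma>)) + ennreal ((1/2) ^ J))"
    by (simp add: ac_simps)
  then have "?f \<le> ennreal (real (election_pot J i \<sigma>)) + ennreal ((1/2) ^ J)"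
    by (simp add: ennreal_add_left_cancel_le)
  then show ?thesis by (simp add: ennreal_plus)
qed

text \<open>The budget of the drift: each process writes once per level, so charging the tail
  probability to that write bounds the total by the population of the level.\<close>

definition writers_weight :: "nat \<Rightarrow> nat \<Rightarrow> acfg \<Rightarrow> real" where
  "writers_weight J i \<sigma> = (1/2) ^ J * real (card (writers \<sigma> i))"

definition exp_reached :: "nat \<Rightarrow> nat \<Rightarrow> adversary \<Rightarrow> nat \<Rightarrow> nat \<Rightarrow> ennreal" where
  "exp_reached n k A t i = (\<integral>\<^sup>+ h. ennreal (real (card (reached (cfg_at n h) i))) \<partial>measure_pmf (lazy_exec n k A t))"

lemma lazy_exec_inv_levels: "h \<in> set_pmf (lazy_exec n k A t) \<Longrightarrow> inv_levels n (lg n) (cfg_at n h)"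
  using lazy_exec_feasible invariant_abs_run by (fastforce simp: invariant_def)

text \<open>The term \<open>2 * J\<close> is the initial potential, with all slots free.
  \<open>J\<close> is a parameter of the analysis alone, so it can be tuned for each level to the
  expected population.\<close>

lemma exp_reached_Suc:
  assumes i: "i < lg n" and J: "J \<le> lg n"
  shows "exp_reached n k A t (Suc i) \<le> ennreal (2 * real J) + ennreal ((1/2) ^ J) * exp_reached n k A t i"
proof -
  have "exp_reached n k A t (Suc i) \<le> (\<integral>\<^sup>+ h. ennreal (real (election_pot J i (cfg_at n h))) \<partial>measure_pmf (lazy_exec n k A t))"
    unfolding exp_reached_def
  proof (intro nn_integral_mono_AE, unfold AE_measure_pmf_iff, intro ballI ennreal_leI)
    fix h assume "h \<in> set_pmf (lazy_exec n k A t)"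
    then have "card (reached (cfg_at n h) (Suc i)) \<le> card (elected (cfg_at n h) i)"
      by (intro card_mono elected_finite[OF lazy_exec_inv_levels] reached_Suc_sub_elected)
    then show "real (card (reached (cfg_at n h) (Suc i))) \<le> real (election_pot J i (cfg_at n h))" by (simp add: election_pot_def)
  qed
  also have "\<dots> \<le> ennreal (real (election_pot J i (cfg_at n []))) + (\<integral>\<^sup>+ h. ennreal (writers_weight J i (cfg_at n h)) \<partial>measure_pmf (lazy_exec n k A t))"
  proof (rule drift[where K = "(1/2) ^ J * real n"])
    fix h p assume f: "feasible (logstar_tas n) n (h @ [Inv p])"
    note a = abs_run_Inv[OF f] and p = f[unfolded feasible_Inv]
    have i: "stat (cfg_at n h) p = Idle" using p by (simp add: status_def)
    have "levels (cfg_at n h) p = 0"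
      using inv_levels_lv0[of n "lg n" "cfg_at n h" p] invariant_abs_run[of n h] p i by (simp add: invariant_def)
    then have "elected (cfg_at n (h @ [Inv p])) i = elected (cfg_at n h) i" "writers (cfg_at n (h @ [Inv p])) i = writers (cfg_at n h) i"
      "free_slots J (cfg_at n (h @ [Inv p])) i = free_slots J (cfg_at n h) i"
      unfolding a using i by (auto simp: elected_def writers_def free_slots_def)
    then show "ennreal (real (election_pot J i (cfg_at n (h @ [Inv p])))) + ennreal (writers_weight J i (cfg_at n h)) \<le>
      ennreal (real (election_pot J i (cfg_at n h))) + ennreal (writers_weight J i (cfg_at n (h @ [Inv p])))"
      unfolding election_pot_def writers_weight_def by simp
  next
    fix h p x assume f: "feasible (logstar_tas n) n h" and x: "status n h p = Active x"
    have f': "feasible (logstar_tas n) n (h @ [Stp p c])" for c using f x by (simp add: feasible_Stp)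
    have t: "tr (lg n) p c (cfg_at n h) (cfg_at n (h @ [Stp p c]))" for c by (rule abs_run_Stp[OF f'])
    have B: "inv_levels n (lg n) (cfg_at n h)" using invariant_abs_run[OF f] by (simp add: invariant_def)
    have B': "inv_levels n (lg n) (cfg_at n (h @ [Stp p c]))" for c using inv_levels_tr[OF t B] .
    show "(\<integral>\<^sup>+ c. ennreal (real (election_pot J i (cfg_at n (h @ [Stp p c])))) \<partial>measure_pmf coin_pmf) + ennreal (writers_weight J i (cfg_at n h))
      \<le> ennreal (real (election_pot J i (cfg_at n h))) + (\<integral>\<^sup>+ c. ennreal (writers_weight J i (cfg_at n (h @ [Stp p c]))) \<partial>measure_pmf coin_pmf)"
    proof (cases "stat (cfg_at n h) p = Active (GWrite i)")
      case False
      have "election_pot J i (cfg_at n (h @ [Stp p c])) \<le> election_pot J i (cfg_at n h)" for c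
        unfolding election_pot_def using card_mono[OF elected_finite[OF B] elected_tr[OF t B i False]]
          card_mono[OF finite_free_slots free_slots_tr[OF t, where J = J and i = i]] by (intro add_mono mult_le_mono) auto
      then have "(\<integral>\<^sup>+ c. ennreal (real (election_pot J i (cfg_at n (h @ [Stp p c])))) \<partial>measure_pmf coin_pmf) \<le>
          (\<integral>\<^sup>+ c. ennreal (real (election_pot J i (cfg_at n h))) \<partial>measure_pmf coin_pmf)"
        by (intro nn_integral_mono ennreal_leI) simp
      moreover have "writers_weight J i (cfg_at n h) \<le> writers_weight J i (cfg_at n (h @ [Stp p c]))" for c
      proof -
        have "finite (writers (cfg_at n (h @ [Stp p c])) i)" by (rule finite_subset[OF writers_sub reached_finite[OF B']])
        then show ?thesis unfolding writers_weight_def using card_mono[OF _ writers_tr[OF t B]] by simp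
      qed
      then have "(\<integral>\<^sup>+ c. ennreal (writers_weight J i (cfg_at n h)) \<partial>measure_pmf coin_pmf) \<le>
          (\<integral>\<^sup>+ c. ennreal (writers_weight J i (cfg_at n (h @ [Stp p c]))) \<partial>measure_pmf coin_pmf)"
        by (intro nn_integral_mono ennreal_leI)
      ultimately show ?thesis by (intro add_mono) simp_all
    next
      case True
      have "writers_weight J i (cfg_at n (h @ [Stp p c])) = (1/2) ^ J + writers_weight J i (cfg_at n h)" for c
        unfolding writers_weight_def ge_write(2)[OF t B True J] by (simp add: algebra_simps)
      then have "(\<integral>\<^sup>+ c. ennreal (writers_weight J i (cfg_at n (h @ [Stp p c]))) \<partial>measure_pmf coin_pmf) = ennreal ((1/2) ^ J + writers_weight J i (cfg_at n h))"
        by simp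
      also have "\<dots> = ennreal ((1/2) ^ J) + ennreal (writers_weight J i (cfg_at n h))"
        by (rule ennreal_plus) (simp_all add: writers_weight_def)
      finally have g: "(\<integral>\<^sup>+ c. ennreal (writers_weight J i (cfg_at n (h @ [Stp p c]))) \<partial>measure_pmf coin_pmf) =
        ennreal ((1/2) ^ J) + ennreal (writers_weight J i (cfg_at n h))" .
      have "(\<integral>\<^sup>+ c. ennreal (real (election_pot J i (cfg_at n (h @ [Stp p c])))) \<partial>measure_pmf coin_pmf) \<le>
          ennreal (real (election_pot J i (cfg_at n h)) + (1/2) ^ J)"
        by (rule ge_write_int[OF t B True J])
      also have "\<dots> = ennreal (real (election_pot J i (cfg_at n h))) + ennreal ((1/2) ^ J)"
        by (rule ennreal_plus) simp_all
      finally show ?thesis unfolding g by (simp add: add.assoc[symmetric] add_right_mono)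
    qed
  next
    fix h assume f: "feasible (logstar_tas n) n h"
    then have B: "inv_levels n (lg n) (cfg_at n h)" using invariant_abs_run by (simp add: invariant_def)
    have "card (writers (cfg_at n h) i) \<le> card {1..n}"
      using writers_sub[of "cfg_at n h" i] reached_sub[OF B, of i] by (intro card_mono) auto
    then show "ennreal (writers_weight J i (cfg_at n h)) \<le> ennreal ((1/2) ^ J * real n)"
      unfolding writers_weight_def by (intro ennreal_leI mult_left_mono) simp_all
  qed
  also have "election_pot J i (cfg_at n []) = 2 * J" by (simp add: election_pot_def elected_def free_slots_def init_cfg_def)
  also have "(\<integral>\<^sup>+ h. ennreal (writers_weight J i (cfg_at n h)) \<partial>measure_pmf (lazy_exec n k A t)) \<le>
      (\<integral>\<^sup>+ h. ennreal ((1/2) ^ J) * ennreal (real (card (reached (cfg_at n h) i))) \<partial>measure_pmf (lazy_exec n k A t))"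
  proof (intro nn_integral_mono_AE, unfold AE_measure_pmf_iff, intro ballI)
    fix h assume "h \<in> set_pmf (lazy_exec n k A t)"
    then have "card (writers (cfg_at n h) i) \<le> card (reached (cfg_at n h) i)"
      by (intro card_mono reached_finite[OF lazy_exec_inv_levels] writers_sub)
    then have "ennreal (writers_weight J i (cfg_at n h)) \<le> ennreal ((1/2) ^ J * real (card (reached (cfg_at n h) i)))"
      unfolding writers_weight_def by (intro ennreal_leI mult_left_mono) simp_all
    then show "ennreal (writers_weight J i (cfg_at n h)) \<le> ennreal ((1/2) ^ J) * ennreal (real (card (reached (cfg_at n h) i)))"
      by (simp add: ennreal_mult)
  qed
  also have "\<dots> = ennreal ((1/2) ^ J) * exp_reached n k A t i"
    unfolding exp_reached_def by (rule nn_integral_cmult) simp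
  finally show ?thesis by (simp add: add_mono)
qed

section \<open>The expected max-step complexity\<close>

lemma log_iter_le:
  assumes "x \<le> real r + 1"
  shows "\<exists>i\<le>r. (log 2 ^^ i) x \<le> 1"
  using assms
proof (induction r arbitrary: x)
  case 0
  then show ?case by simp
next
  case (Suc r)
  show ?case
  proof (cases "x \<le> 1")
    case True
    then show ?thesis by (intro exI[of _ 0]) simp
  next
    case False
    \<comment> \<open>One logarithm brings \<open>r + 2\<close> down to at most
      \<open>r + 1\<close>. This is far from sharp, but it shows that the iteration stops.\<close>
    have "real r + 2 \<le> 2 ^ Suc r"
    proof (induction r)
      case (Suc r)
      then show ?case by simp
    qed simp
    then have x: "x \<le> 2 ^ Suc r" using Suc.prems by simp
    have "log 2 x \<le> real (Suc r) \<longleftrightarrow> x \<le> 2 powr real (Suc r)" using False by (intro log_le_iff) simp_all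
    moreover have "2 powr real (Suc r) = (2::real) ^ Suc r" by (rule powr_realpow) simp
    ultimately have "log 2 x \<le> real (Suc r)" using x by (simp only:)
    then have "log 2 x \<le> real r + 1" by simp
    from Suc.IH[OF this] obtain i where "i \<le> r" "(log 2 ^^ i) (log 2 x) \<le> 1" by blast
    then show ?thesis by (intro exI[of _ "Suc i"]) (simp add: funpow_swap1)
  qed
qed

text \<open>The iteration from \<open>a\<close> is stopped as soon as it falls to 1 or less, because
  further logarithms would leave the range where the logarithm is monotone. Hence
  \<open>i' \<le> i\<close> instead of \<open>i\<close>.\<close>

lemma log_iter_mono:
  "a \<le> b \<Longrightarrow> (log 2 ^^ i) b \<le> 1 \<Longrightarrow> \<exists>i'\<le>i. (log 2 ^^ i') a \<le> 1"
proof (induction i arbitrary: a b)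
  case 0
  then show ?case by simp
next
  case (Suc i)
  show ?case
  proof (cases "a \<le> 1")
    case True
    then show ?thesis by (intro exI[of _ 0]) simp
  next
    case False
    then have "log 2 a \<le> log 2 b" using Suc.prems(1) by simp
    moreover have "(log 2 ^^ i) (log 2 b) \<le> 1" using Suc.prems(2) by (simp add: funpow_swap1)
    ultimately obtain i' where "i' \<le> i" "(log 2 ^^ i') (log 2 a) \<le> 1" using Suc.IH by blast
    then show ?thesis by (intro exI[of _ "Suc i'"]) (simp add: funpow_swap1)
  qed
qed

lemma logstar_le: "(log 2 ^^ i) (real k) \<le> 1 \<Longrightarrow> logstar k \<le> i"
  unfolding logstar_def by (rule Least_le)

lemma logstar_iter: "(log 2 ^^ logstar k) (real k) \<le> 1"
  unfolding logstar_def
proof (rule LeastI_ex)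
  show "\<exists>i. (log 2 ^^ i) (real k) \<le> 1" using log_iter_le[of "real k" k] by auto
qed

lemma logstar_less: "i < logstar k \<Longrightarrow> (log 2 ^^ i) (real k) > 1"
  using logstar_le[of i k] by force

lemma logstar_mono: "a \<le> b \<Longrightarrow> logstar a \<le> logstar b"
  using log_iter_mono[OF _ logstar_iter, of "real a" b] logstar_le[of _ a] by force

text \<open>Ensures that the log* levels of the analysis are among the \<open>lg n\<close> levels
  that have an election.\<close>

lemma logstar_lg: "n \<ge> 1 \<Longrightarrow> k \<le> n \<Longrightarrow> logstar k \<le> lg n"
proof (cases "real k \<le> 1")
  case True
  then show ?thesis using logstar_le[of 0 k] by simp
next
  case False
  assume n: "n \<ge> 1" and k: "k \<le> n"
  have "lg n \<noteq> 0" using lg_ge[of n] n by (cases "lg n = 0") auto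
  then obtain r where r: "lg n = Suc r" by (cases "lg n") auto
  have "k \<le> 2 ^ lg n" using k lg_ge[of n] by linarith
  then have "real k \<le> 2 ^ lg n" by (metis of_nat_le_iff of_nat_numeral of_nat_power)
  then have "log 2 (real k) \<le> real (lg n)" using False by (subst log_le_iff) (simp_all add: powr_realpow)
  then have "log 2 (real k) \<le> real r + 1" using r by simp
  from log_iter_le[OF this] obtain i where i: "i \<le> r" "(log 2 ^^ i) (log 2 (real k)) \<le> 1" by blast
  have "logstar k \<le> Suc i" by (rule logstar_le) (use i in \<open>simp add: funpow_swap1\<close>)
  then show ?thesis using i r by simp
qed

lemma log2_le_self:
  fixes x :: real
  assumes "x > 0"
  shows "log 2 x \<le> x"
proof -
  \<comment> \<open>The split is matched to \<open>ln2_ge_two_thirds\<close>: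
    \<open>ln t \<le> t - 1\<close> at \<open>t = x * (2/3)\<close> gives slope 2/3, which
    \<open>ln 2\<close> dominates.\<close>
  have "ln x = ln (x * (2/3)) + ln (3/2)" 
  proof -
    have "x * (2/3) * (3/2) = x" by simp
    then show ?thesis using ln_mult[of "x * (2/3)" "3/2"] assms by simp
  qed
  also have "\<dots> \<le> (x * (2/3) - 1) + (3/2 - 1)" using assms by (intro add_mono ln_le_minus_one) simp_all
  also have "\<dots> \<le> x * (2/3)" by simp
  also have "\<dots> \<le> x * ln 2" using assms ln2_ge_two_thirds by (intro mult_left_mono) simp_all
  finally show ?thesis by (simp add: log_def divide_le_eq)
qed

lemma log_iter_le_start: "i \<le> logstar k \<Longrightarrow> k \<ge> 1 \<Longrightarrow> (log 2 ^^ i) (real k) \<le> real k"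
proof (induction i)
  case (Suc i)
  have g: "(log 2 ^^ i) (real k) > 1" using logstar_less Suc.prems(1) by simp
  have "log 2 ((log 2 ^^ i) (real k)) \<le> (log 2 ^^ i) (real k)" by (rule log2_le_self) (use g in simp)
  then show ?case using Suc by simp
qed simp

section \<open>The expected population of the levels\<close>

lemma exp_reached_0: "exp_reached n k A t 0 \<le> ennreal (real (min k n))"
proof -
  have "exp_reached n k A t 0 \<le> (\<integral>\<^sup>+ h. ennreal (real (min k n)) \<partial>measure_pmf (lazy_exec n k A t))"
    unfolding exp_reached_def
  proof (intro nn_integral_mono_AE, unfold AE_measure_pmf_iff, intro ballI ennreal_leI)
    fix h assume h: "h \<in> set_pmf (lazy_exec n k A t)"
    have f: "feasible (logstar_tas n) n h" and c: "card {q. Inv q \<in> set h} \<le> k" using lazy_exec_feasible[OF h] by simp_all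
    have B: "inv_levels n (lg n) (cfg_at n h)" by (rule lazy_exec_inv_levels[OF h])
    have "reached (cfg_at n h) 0 \<subseteq> {q. Inv q \<in> set h}"
      using inv_levels_lv0[OF B] invoked[OF f] by (auto simp: reached_def status_def)
    moreover have "finite {q. Inv q \<in> set h}" by (simp flip: set_invocations)
    ultimately have "card (reached (cfg_at n h) 0) \<le> k" using c card_mono le_trans by blast
    moreover have "card (reached (cfg_at n h) 0) \<le> card {1..n}" using reached_sub[OF B] by (intro card_mono) auto
    ultimately show "real (card (reached (cfg_at n h) 0)) \<le> real (min k n)" by simp
  qed
  then show ?thesis by simp
qed

text \<open>The contention is cut to \<open>K = min k n\<close>, since \<open>k\<close> may exceed
  \<open>n\<close> while the cell indices only reach \<open>lg n\<close>. Before level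
  \<open>logstar K\<close> the iterate exceeds 1, so the \<open>max\<close> takes effect only at the
  end.\<close>

lemma exp_reached_iter:
  assumes n: "n \<ge> 1" and k: "k \<ge> 1"
  defines "K \<equiv> min k n"
  assumes i: "i \<le> logstar K"
  shows "exp_reached n k A t i \<le> ennreal (16 * max 1 ((log 2 ^^ i) (real K)))"
  using i
proof (induction i)
  case 0
  have "exp_reached n k A t 0 \<le> ennreal (real K)" using exp_reached_0 by (simp add: K_def)
  also have "\<dots> \<le> ennreal (16 * max 1 (real K))" by (intro ennreal_leI) simp
  finally show ?case by simp
next
  case (Suc i)
  have K: "K \<ge> 1" "K \<le> n" using n k by (simp_all add: K_def)
  define L where "L = (log 2 ^^ i) (real K)"
  have L1: "L > 1" unfolding L_def using logstar_less Suc.prems by simp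
  have LK: "L \<le> real n" using log_iter_le_start[of i K] Suc.prems K unfolding L_def by simp
  \<comment> \<open>The offset 2 makes \<open>(1/2) ^ J * L \<le> 1/4\<close>, so the inherited
    constant 16 contributes only 4. With \<open>l = log 2 L\<close> the total is at most
    \<open>2 * l + 10\<close>, which stays below \<open>16 * max 1 l\<close>.\<close>
  define J where "J = nat \<lceil>log 2 L\<rceil> + 2"
  have l0: "log 2 L > 0" using L1 by simp
  have Jr: "real J \<le> log 2 L + 3" "log 2 L + 2 \<le> real J" using l0 unfolding J_def by linarith+
  have "4 * real n \<le> 2 ^ lg n" using lg_ge[of n] by (metis of_nat_le_iff of_nat_mult of_nat_numeral of_nat_power)
  then have "4 * L \<le> 2 ^ lg n" using LK by simp
  then have "log 2 (4 * L) \<le> real (lg n)" using L1 by (subst log_le_iff) (simp_all add: powr_realpow)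
  moreover have "log 2 (4 * L) = log 2 L + 2"
    using L1 log_pow_cancel[of "2::real" 2] by (simp add: log_mult)
  ultimately have "\<lceil>log 2 L\<rceil> \<le> int (lg n) - 2" by (simp add: ceiling_le_iff)
  then have Js: "J \<le> lg n" using l0 unfolding J_def by linarith
  have "logstar K \<le> lg n" using logstar_lg n K by simp
  then have i_lg: "i < lg n" using Suc.prems by simp
  have "4 * L = 2 powr (log 2 L + 2)" using L1 by (simp add: powr_add)
  also have "\<dots> \<le> 2 powr real J" using Jr by simp
  also have "\<dots> = 2 ^ J" by (simp add: powr_realpow)
  finally have p: "(1/2) ^ J * L \<le> 1/4" by (simp add: power_divide field_simps)
  have "exp_reached n k A t (Suc i) \<le> ennreal (2 * real J) + ennreal ((1/2) ^ J) * exp_reached n k A t i"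
    by (rule exp_reached_Suc[OF i_lg Js])
  also have "\<dots> \<le> ennreal (2 * real J) + ennreal ((1/2) ^ J) * ennreal (16 * L)"
    using Suc.IH Suc.prems L1 by (intro add_left_mono mult_left_mono) (simp_all add: L_def max_def split: if_splits)
  also have "\<dots> = ennreal (2 * real J + (1/2) ^ J * (16 * L))"
    using L1 by (simp add: ennreal_plus ennreal_mult)
  also have "\<dots> \<le> ennreal (16 * max 1 (log 2 L))"
  proof (intro ennreal_leI)
    have "2 * real J + (1/2) ^ J * (16 * L) \<le> 2 * (log 2 L + 3) + 4" using Jr p by simp
    also have "\<dots> \<le> 16 * max 1 (log 2 L)" by (simp add: max_def)
    finally show "2 * real J + (1/2) ^ J * (16 * L) \<le> 16 * max 1 (log 2 L)" .
  qed
  finally show ?case by (simp add: L_def)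
qed

lemma exp_reached_logstar:
  assumes n: "n \<ge> 1" and k: "k \<ge> 1"
  shows "exp_reached n k A t (logstar (min k n)) \<le> 16"
proof -
  have "exp_reached n k A t (logstar (min k n)) \<le> ennreal (16 * max 1 ((log 2 ^^ logstar (min k n)) (real (min k n))))"
    using exp_reached_iter[OF n k, of "logstar (min k n)"] by simp
  also have "\<dots> = ennreal 16" using logstar_iter[of "min k n"] by (simp add: max_def)
  finally show ?thesis by simp
qed

section \<open>From levels to steps\<close>

lemma max_steps_le:
  assumes f: "feasible (logstar_tas n) n h" and n: "n \<ge> 1"
  shows "max_steps n h \<le> 2 + 7 * (m + card (reached (cfg_at n h) m)) + total_duel_steps n (cfg_at n h)"
proof -
  have B: "inv_levels n (lg n) (cfg_at n h)" using invariant_abs_run[OF f] by (simp add: invariant_def)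
  have "steps p h \<le> 2 + 7 * (m + card (reached (cfg_at n h) m)) + total_duel_steps n (cfg_at n h)" for p
  proof -
    have "7 * levels (cfg_at n h) p \<le> 7 * (m + card (reached (cfg_at n h) m))"
      by (rule mult_le_mono2[OF levels_le_add[OF B]])
    then show ?thesis using steps_le_cost[OF f, of p] cost_le[OF B, of p] by linarith
  qed
  then show ?thesis unfolding max_steps_def using n by (subst Max_le_iff) auto
qed

text \<open>The reached levels all lie below \<open>m + card (reached \<sigma> m)\<close>, and each
  of them has budget 16.\<close>

lemma sum_level_budget_le:
  assumes B: "inv_levels n s \<sigma>"
  shows "(\<Sum>j<n. level_budget j \<sigma>) \<le> 16 * (m + card (reached \<sigma> m))"
proof -
  have "{j \<in> {..<n}. reached \<sigma> j \<noteq> {}} \<subseteq> {..<m + card (reached \<sigma> m)}"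
    using levels_le_add[OF B, of _ m] by (auto simp: reached_def intro: less_le_trans)
  then have "card {j \<in> {..<n}. reached \<sigma> j \<noteq> {}} \<le> m + card (reached \<sigma> m)"
    using card_mono[of "{..<m + card (reached \<sigma> m)}"] by fastforce
  moreover have "(\<Sum>j<n. level_budget j \<sigma>) = 16 * card {j \<in> {..<n}. reached \<sigma> j \<noteq> {}}"
    by (simp add: level_budget_def sum.If_cases Int_def)
  ultimately show ?thesis by simp
qed

lemma nn_integral_affine:
  assumes "a \<ge> 0" "b \<ge> 0"
  shows "(\<integral>\<^sup>+ h. ennreal (a + b * real (card (reached (cfg_at n h) m))) \<partial>measure_pmf (lazy_exec n k A t)) =
    ennreal a + ennreal b * exp_reached n k A t m"
proof -
  have "(\<integral>\<^sup>+ h. ennreal (a + b * real (card (reached (cfg_at n h) m))) \<partial>measure_pmf (lazy_exec n k A t)) =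
    (\<integral>\<^sup>+ h. ennreal a + ennreal b * ennreal (real (card (reached (cfg_at n h) m))) \<partial>measure_pmf (lazy_exec n k A t))"
    using assms by (intro nn_integral_cong) (simp add: ennreal_plus ennreal_mult)
  then show ?thesis by (simp add: nn_integral_add nn_integral_cmult exp_reached_def)
qed

lemma exec_cost:
  assumes n: "n \<ge> 1" and k: "k \<ge> 1"
  shows "(\<integral>\<^sup>+ x. ennreal (real (max_steps n (fst x))) \<partial>measure_pmf (exec_pmf (logstar_tas n) n k A t))
    \<le> ennreal (393 * real (max 1 (logstar k)))"
proof -
  \<comment> \<open>At this level the elections have brought the expected population down to 16, so
    each further level can be charged to a process.\<close>
  define m where "m = logstar (min k n)"
  let ?I = "\<lambda>f. \<integral>\<^sup>+ h. f h \<partial>measure_pmf (lazy_exec n k A t)"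
  let ?a = "\<lambda>h. real (card (reached (cfg_at n h) m))"
  have "(\<integral>\<^sup>+ x. ennreal (real (max_steps n (fst x))) \<partial>measure_pmf (exec_pmf (logstar_tas n) n k A t)) =
      ?I (\<lambda>h. ennreal (real (max_steps n h)))"
    by (rule nn_integral_exec)
  also have "\<dots> \<le> ?I (\<lambda>h. ennreal ((2 + 7 * real m) + 7 * ?a h) + (\<Sum>j<n. ennreal (real (duel_steps (cfg_at n h) j))))"
  proof (intro nn_integral_mono_AE, unfold AE_measure_pmf_iff, intro ballI)
    fix h assume "h \<in> set_pmf (lazy_exec n k A t)"
    then have f: "feasible (logstar_tas n) n h" using lazy_exec_feasible by blast
    have "real (max_steps n h) \<le> real (2 + 7 * (m + card (reached (cfg_at n h) m)) + total_duel_steps n (cfg_at n h))"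
      using max_steps_le[OF f n] by (simp only: of_nat_le_iff)
    also have "\<dots> = ((2 + 7 * real m) + 7 * ?a h) + (\<Sum>j<n. real (duel_steps (cfg_at n h) j))" by (simp add: total_duel_steps_def)
    finally have "ennreal (real (max_steps n h)) \<le> ennreal (((2 + 7 * real m) + 7 * ?a h) + (\<Sum>j<n. real (duel_steps (cfg_at n h) j)))"
      by (rule ennreal_leI)
    also have "\<dots> = ennreal ((2 + 7 * real m) + 7 * ?a h) + ennreal (\<Sum>j<n. real (duel_steps (cfg_at n h) j))"
      by (rule ennreal_plus) (simp_all add: sum_nonneg)
    also have "ennreal (\<Sum>j<n. real (duel_steps (cfg_at n h) j)) = (\<Sum>j<n. ennreal (real (duel_steps (cfg_at n h) j)))"
      by (rule sum_ennreal[symmetric]) simp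
    finally show "ennreal (real (max_steps n h)) \<le>
      ennreal ((2 + 7 * real m) + 7 * ?a h) + (\<Sum>j<n. ennreal (real (duel_steps (cfg_at n h) j)))" .
  qed
  also have "\<dots> = ?I (\<lambda>h. ennreal ((2 + 7 * real m) + 7 * ?a h)) + (\<Sum>j<n. ?I (\<lambda>h. ennreal (real (duel_steps (cfg_at n h) j))))"
    by (simp add: nn_integral_add nn_integral_sum del: sum_ennreal)
  also have "\<dots> \<le> ?I (\<lambda>h. ennreal ((2 + 7 * real m) + 7 * ?a h)) + (\<Sum>j<n. ?I (\<lambda>h. ennreal (real (level_budget j (cfg_at n h)))))"
    by (intro add_left_mono sum_mono chain_drift)
  also have "(\<Sum>j<n. ?I (\<lambda>h. ennreal (real (level_budget j (cfg_at n h))))) = ?I (\<lambda>h. \<Sum>j<n. ennreal (real (level_budget j (cfg_at n h))))"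
    by (simp add: nn_integral_sum del: sum_ennreal)
  also have "\<dots> \<le> ?I (\<lambda>h. ennreal (16 * real m + 16 * ?a h))"
  proof (intro nn_integral_mono_AE, unfold AE_measure_pmf_iff, intro ballI)
    fix h assume "h \<in> set_pmf (lazy_exec n k A t)"
    then have B: "inv_levels n (lg n) (cfg_at n h)" by (rule lazy_exec_inv_levels)
    have "(\<Sum>j<n. ennreal (real (level_budget j (cfg_at n h)))) = ennreal (real (\<Sum>j<n. level_budget j (cfg_at n h)))"
      by (simp add: sum_ennreal)
    also have "\<dots> \<le> ennreal (real (16 * (m + card (reached (cfg_at n h) m))))"
      using sum_level_budget_le[OF B, of m] by (intro ennreal_leI) (simp only: of_nat_le_iff)
    finally show "(\<Sum>j<n. ennreal (real (level_budget j (cfg_at n h)))) \<le> ennreal (16 * real m + 16 * ?a h)" by simp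
  qed
  also have "?I (\<lambda>h. ennreal ((2 + 7 * real m) + 7 * ?a h)) + ?I (\<lambda>h. ennreal (16 * real m + 16 * ?a h)) =
      (ennreal (2 + 7 * real m) + ennreal 7 * exp_reached n k A t m) + (ennreal (16 * real m) + ennreal 16 * exp_reached n k A t m)"
    by (simp only: nn_integral_affine)
  also have "\<dots> \<le> (ennreal (2 + 7 * real m) + ennreal 7 * ennreal 16) + (ennreal (16 * real m) + ennreal 16 * ennreal 16)"
    using exp_reached_logstar[OF n k] by (intro add_mono mult_left_mono) (simp_all add: m_def)
  also have "\<dots> = ennreal (2 + 7 * real m + 7 * 16 + (16 * real m + 16 * 16))"
    by (simp only: ennreal_mult[symmetric] ennreal_plus[symmetric])
  also have "\<dots> \<le> ennreal (393 * real (max 1 (logstar k)))"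
  proof (intro ennreal_leI)
    \<comment> \<open>The left side below is \<open>370 + 23 * m\<close>, which explains 393. The
      \<open>max\<close> covers \<open>k = 1\<close>, where log* is 0.\<close>
    have "m \<le> logstar k" unfolding m_def by (intro logstar_mono) simp
    then show "2 + 7 * real m + 7 * 16 + (16 * real m + 16 * 16) \<le> 393 * real (max 1 (logstar k))" by (simp add: max_def)
  qed
  finally show ?thesis by (simp add: add_left_mono)
qed

theorem theorem3:
  "\<exists>I :: nat \<Rightarrow> nat list tas_impl.
     (\<forall>n\<ge>1. wf_impl (I n) \<and> correct_tas (I n) n) \<and>
     (\<lambda>n. real (nregs (I n))) \<in> \<Theta>(\<lambda>n. real n) \<and>
     (\<exists>C>0. \<forall>n\<ge>1. \<forall>k\<ge>1.
        max_step_cx (I n) n k \<le> ennreal (C * real (max 1 (logstar k))))"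
proof (intro exI[of _ logstar_tas] conjI allI impI)
  fix n :: nat assume "n \<ge> 1"
  then show "wf_impl (logstar_tas n)" by (rule wf_logstar_tas)
  show "correct_tas (logstar_tas n) n" by (rule correct_logstar_tas)
next
  show "(\<lambda>n. real (nregs (logstar_tas n))) \<in> \<Theta>(\<lambda>n. real n)" by simp
next
  show "\<exists>C>0. \<forall>n\<ge>1. \<forall>k\<ge>1. max_step_cx (logstar_tas n) n k \<le> ennreal (C * real (max 1 (logstar k)))"
    unfolding max_step_cx_def by (intro exI[of _ 393] conjI allI impI SUP_least exec_cost) simp_all
qed


end
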